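(* Let $F$ be a field of characteristic not $2$, let $(V,B)$ be a finite-dimensional symplectic vector space over $F$, and let $l_1,\ldots,l_n$ ($n\ge 2$) be Lagrangian subspaces of $V$. Fix $k\in\{2,\ldots,n\}$. 1. If $l_1\cap l_k=0$, then $T_{1,2,\ldots,k}\oplus T_{1,k,\ldots,n}\cong T_{1,2,\ldots,n}$ isometrically. 2. Without conditions, $T_{1,2,\ldots,k}\oplus T_{1,k,\ldots,n}$ is (isometric to) a quadratic subquotient of $T_{1,2,\ldots,n}$. Therefore $\tau(l_1,l_2,\ldots,l_k)+\tau(l_1,l_k,\ldots,l_n)=\tau(l_1,l_2,\ldots,l_n)$ in the Witt group $W(F)$.
   Context: A quadratic space is a finite-dimensional $F$-vector space with a non-degenerate symmetric bilinear form; $W(F)$ is the Witt group of quadratic spaces over $F$. If $T$ is a quadratic space and $I\subset T$ an isotropic subspace, then $I^\perp/I$ with the induced form is a quadratic space, called the quadratic subquotient of $T$ by $I$. Direct sums of quadratic spaces are orthogonal. For any finite sequence of Lagrangians $m_1,\ldots,m_r$ in $V$ ($r\ge2$), indexed cyclically by $\mathbb Z/r\mathbb Z$, put $K=\{w\in\bigoplus_{i\in\mathbb Z/r\mathbb Z} m_i:\sum_i w_i=0\}$. For $w\in K$ an anti-derivative is a family $\hat w=(\hat w_{\{i,i+1\}})_{i\in\mathbb Z/r\mathbb Z}$ of elements of $V$ (one for each $i$) with $\hat w_{\{i,i+1\}}-\hat w_{\{i-1,i\}}=w_i$ for all $i$; it exists and is unique up to a constant vector. The form $q(v,w)=\sum_iB(v_i,\hat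 w_{\{i,i+1\}})$ on $K$ is symmetric and independent of the choice of $\hat w$. Put $T=K/\ker q$, a quadratic space with the induced form. $T_{a_1,\ldots,a_r}$ denotes the quadratic space obtained from the sequence $(l_{a_1},\ldots,l_{a_r})$, and $\tau(l_{a_1},\ldots,l_{a_r})\in W(F)$ (the Maslov index) is its class. The sequence $1,k,\ldots,n$ means $1,k,k+1,\ldots,n$. *)

theory Defs
  imports "Jordan_Normal_Form.Missing_VectorSpace" "HOL-Algebra.AbelCoset"
begin

section \<open>Bilinear forms, symplectic and quadratic spaces\<close>

locale bilinear_form = vectorspace F V
  for F (structure) and V (structure) +
  fixes B :: "'c \<Rightarrow> 'c \<Rightarrow> 'a"
  assumes form_closed: "\<lbrakk>x \<in> carrier V; y \<in> carrier V\<rbrakk> \<Longrightarrow> B x y \<in> carrier F"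
    and form_add_left: "\<lbrakk>x \<in> carrier V; x' \<in> carrier V; y \<in> carrier V\<rbrakk>
      \<Longrightarrow> B (x \<oplus>\<^bsub>V\<^esub> x') y = B x y \<oplus>\<^bsub>F\<^esub> B x' y"
    and form_add_right: "\<lbrakk>x \<in> carrier V; y \<in> carrier V; y' \<in> carrier V\<rbrakk>
      \<Longrightarrow> B x (y \<oplus>\<^bsub>V\<^esub> y') = B x y \<oplus>\<^bsub>F\<^esub> B x y'"
    and form_smult_left: "\<lbrakk>c \<in> carrier F; x \<in> carrier V; y \<in> carrier V\<rbrakk>
      \<Longrightarrow> B (c \<odot>\<^bsub>V\<^esub> x) y = c \<otimes>\<^bsub>F\<^esub> B x y"
    and form_smult_right: "\<lbrakk>c \<in> carrier F; x \<in> carrier V; y \<in> carrier V\<rbrakk>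
      \<Longrightarrow> B x (c \<odot>\<^bsub>V\<^esub> y) = c \<otimes>\<^bsub>F\<^esub> B x y"

locale symplectic_space = bilinear_form +
  assumes fin_dim: "fin_dim"
    and alternating: "x \<in> carrier V \<Longrightarrow> B x x = \<zero>\<^bsub>F\<^esub>"
    and nondegenerate: "\<lbrakk>x \<in> carrier V; \<And>y. y \<in> carrier V \<Longrightarrow> B x y = \<zero>\<^bsub>F\<^esub>\<rbrakk> \<Longrightarrow> x = \<zero>\<^bsub>V\<^esub>"

definition perp ::
  "('a, 'd) ring_scheme \<Rightarrow> ('a, 'b, 'e) module_scheme \<Rightarrow> ('b \<Rightarrow> 'b \<Rightarrow> 'a) \<Rightarrow> 'b set \<Rightarrow> 'b set"
  where "perp F V B N = {x \<in> carrier V. \<forall>y\<in>N. B x y = \<zero>\<^bsub>F\<^esub>}"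

definition lagrangian ::
  "('a, 'd) ring_scheme \<Rightarrow> ('a, 'b, 'e) module_scheme \<Rightarrow> ('b \<Rightarrow> 'b \<Rightarrow> 'a) \<Rightarrow> 'b set \<Rightarrow> bool"
  where "lagrangian F V B L \<longleftrightarrow> subspace F L V \<and> perp F V B L = L"

text \<open>A vector space bundled with a form. The ring multiplication and unit that the record
  inherits from the library's modules play no role.\<close>

record ('a, 'b) form_space = "('a, 'b) module" +
  form :: "'b \<Rightarrow> 'b \<Rightarrow> 'a"

definition with_form :: "('a, 'b) module \<Rightarrow> ('b \<Rightarrow> 'b \<Rightarrow> 'a) \<Rightarrow> ('a, 'b) form_space"
  where "with_form M b = module.extend M (form_space.fields b)"

locale quadratic_space = bilinear_form F Q "form Q"
  for F (structure) and Q :: "('a, 'c) form_space" (structure) +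
  assumes fin_dim: "fin_dim"
    and symmetric: "\<lbrakk>x \<in> carrier Q; y \<in> carrier Q\<rbrakk> \<Longrightarrow> form Q x y = form Q y x"
    and nondegenerate:
      "\<lbrakk>x \<in> carrier Q; \<And>y. y \<in> carrier Q \<Longrightarrow> form Q x y = \<zero>\<^bsub>F\<^esub>\<rbrakk> \<Longrightarrow> x = \<zero>\<^bsub>Q\<^esub>"

definition isometric ::
  "('a, 'd) ring_scheme \<Rightarrow> ('a, 'b) form_space \<Rightarrow> ('a, 'c) form_space \<Rightarrow> bool"
  where "isometric F Q Q' \<longleftrightarrow> quadratic_space F Q \<and> quadratic_space F Q' \<and>
    (\<exists>f. linear_map F Q Q' f \<and> bij_betw f (carrier Q) (carrier Q') \<and>
      (\<forall>x\<in>carrier Q. \<forall>y\<in>carrier Q. form Q' (f x) (f y) = form Q x y))"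

definition orth_sum ::
  "('a, 'd) ring_scheme \<Rightarrow> ('a, 'b) form_space \<Rightarrow> ('a, 'c) form_space \<Rightarrow> ('a, 'b \<times> 'c) form_space"
  where "orth_sum F Q Q' = with_form (direct_sum Q Q')
    (\<lambda>x y. form Q (fst x) (fst y) \<oplus>\<^bsub>F\<^esub> form Q' (snd x) (snd y))"

text \<open>The quotient by a subspace \<open>N\<close> on which the form vanishes against everything, with
  cosets as elements; only for such \<open>N\<close> is the induced form independent of the representatives.\<close>

definition quotient_space :: "('a, 'b) form_space \<Rightarrow> 'b set \<Rightarrow> ('a, 'b set) form_space"
  where "quotient_space Q N =
    \<lparr>carrier = a_rcosets\<^bsub>Q\<^esub> N,
     mult = (\<lambda>X Y. N), one = N, zero = N,
     add = (\<lambda>X Y. X <+>\<^bsub>Q\<^esub> Y),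
     smult = (\<lambda>c X. \<Union>x\<in>X. N +>\<^bsub>Q\<^esub> (c \<odot>\<^bsub>Q\<^esub> x)),
     form = (\<lambda>X Y. form Q (SOME x. x \<in> X) (SOME y. y \<in> Y))\<rparr>"

definition isotropic :: "('a, 'd) ring_scheme \<Rightarrow> ('a, 'b) form_space \<Rightarrow> 'b set \<Rightarrow> bool"
  where "isotropic F Q I \<longleftrightarrow> subspace F I Q \<and> (\<forall>x\<in>I. \<forall>y\<in>I. form Q x y = \<zero>\<^bsub>F\<^esub>)"

definition subquotient ::
  "('a, 'd) ring_scheme \<Rightarrow> ('a, 'b) form_space \<Rightarrow> 'b set \<Rightarrow> ('a, 'b set) form_space"
  where "subquotient F Q I = quotient_space (Q\<lparr>carrier := perp F Q (form Q) I\<rparr>) I"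

section \<open>The Witt group\<close>

text \<open>The orthogonal sum of \<open>n\<close> hyperbolic planes, realised on \<open>F\<^sup>n \<times> F\<^sup>n\<close>.\<close>

definition hyperbolic_space ::
  "('a, 'd) ring_scheme \<Rightarrow> nat \<Rightarrow> ('a, (nat \<Rightarrow> 'a) \<times> (nat \<Rightarrow> 'a)) form_space"
  where "hyperbolic_space F n =
    with_form (direct_sum (ring.func_space F {..<n}) (ring.func_space F {..<n}))
      (\<lambda>x y. \<Oplus>\<^bsub>F\<^esub>i\<in>{..<n}. fst x i \<otimes>\<^bsub>F\<^esub> snd y i \<oplus>\<^bsub>F\<^esub> snd x i \<otimes>\<^bsub>F\<^esub> fst y i)"

definition witt_equivalent ::
  "('a, 'd) ring_scheme \<Rightarrow> ('a, 'b) form_space \<Rightarrow> ('a, 'c) form_space \<Rightarrow> bool"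
  where "witt_equivalent F Q Q' \<longleftrightarrow> quadratic_space F Q \<and> quadratic_space F Q' \<and>
    (\<exists>m n. isometric F (orth_sum F Q (hyperbolic_space F m)) (orth_sum F Q' (hyperbolic_space F n)))"

text \<open>Every quadratic space is isometric to one on \<open>F\<^sup>n\<close> for some \<open>n\<close>, so Witt classes can be
  formed among the spaces whose vectors have type \<^typ>\<open>nat \<Rightarrow> 'a\<close>. This gives the classes of
  spaces of all types the same home.\<close>

definition witt_class ::
  "('a, 'd) ring_scheme \<Rightarrow> ('a, 'b) form_space \<Rightarrow> ('a, nat \<Rightarrow> 'a) form_space set"
  where "witt_class F Q = {P. witt_equivalent F P Q}"

text \<open>The group operation, written \<open>\<otimes>\<close> in the library's group record, is the addition
  induced by the orthogonal sum.\<close>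

definition witt_group ::
  "('a, 'd) ring_scheme \<Rightarrow> ('a, nat \<Rightarrow> 'a) form_space set monoid"
  where "witt_group F =
    \<lparr>carrier = {witt_class F Q |Q :: ('a, nat \<Rightarrow> 'a) form_space. quadratic_space F Q},
     mult = (\<lambda>X Y. {P. \<exists>Q\<in>X. \<exists>Q'\<in>Y. witt_equivalent F P (orth_sum F Q Q')}),
     one = witt_class F (hyperbolic_space F 0)\<rparr>"

section \<open>The quadratic space of a cyclic sequence of Lagrangians\<close>

text \<open>A sequence of length \<open>r\<close> is a list, and \<open>{..<r}\<close> with successor \<open>(i + 1) mod r\<close>
  represents the cyclic index set.\<close>

definition external_sum :: "('a, 'b, 'e) module_scheme \<Rightarrow> 'b set list \<Rightarrow> ('a, nat \<Rightarrow> 'b) module"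
  where "external_sum V ms = (let I = {..<length ms} in
    \<lparr>carrier = (\<Pi>\<^sub>E i\<in>I. ms ! i),
     mult = (\<lambda>v w. \<lambda>i\<in>I. \<zero>\<^bsub>V\<^esub>), one = (\<lambda>i\<in>I. \<zero>\<^bsub>V\<^esub>), zero = (\<lambda>i\<in>I. \<zero>\<^bsub>V\<^esub>),
     add = (\<lambda>v w. \<lambda>i\<in>I. v i \<oplus>\<^bsub>V\<^esub> w i),
     smult = (\<lambda>c w. \<lambda>i\<in>I. c \<odot>\<^bsub>V\<^esub> w i)\<rparr>)"

text \<open>The entry \<open>h i\<close> is the component of the anti-derivative at the edge \<open>{i, i + 1}\<close>;
  the predecessor of \<open>i\<close> is \<open>(i + (r - 1)) mod r\<close>.\<close>

definition antiderivative ::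
  "('a, 'b, 'e) module_scheme \<Rightarrow> nat \<Rightarrow> (nat \<Rightarrow> 'b) \<Rightarrow> (nat \<Rightarrow> 'b) \<Rightarrow> bool"
  where "antiderivative V r w h \<longleftrightarrow> h \<in> {..<r} \<rightarrow> carrier V \<and>
    (\<forall>i<r. h i \<ominus>\<^bsub>V\<^esub> h ((i + (r - 1)) mod r) = w i)"

definition maslov_form ::
  "('a, 'd) ring_scheme \<Rightarrow> ('a, 'b, 'e) module_scheme \<Rightarrow> ('b \<Rightarrow> 'b \<Rightarrow> 'a) \<Rightarrow> nat
    \<Rightarrow> (nat \<Rightarrow> 'b) \<Rightarrow> (nat \<Rightarrow> 'b) \<Rightarrow> 'a"
  where "maslov_form F V B r v w =
    (let h = (SOME h. antiderivative V r w h) in \<Oplus>\<^bsub>F\<^esub>i\<in>{..<r}. B (v i) (h i))"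

definition maslov_presentation ::
  "('a, 'd) ring_scheme \<Rightarrow> ('a, 'b, 'e) module_scheme \<Rightarrow> ('b \<Rightarrow> 'b \<Rightarrow> 'a) \<Rightarrow> 'b set list
    \<Rightarrow> ('a, nat \<Rightarrow> 'b) form_space"
  where "maslov_presentation F V B ms = with_form
    ((external_sum V ms)\<lparr>carrier :=
      {w \<in> carrier (external_sum V ms). (\<Oplus>\<^bsub>V\<^esub>i\<in>{..<length ms}. w i) = \<zero>\<^bsub>V\<^esub>}\<rparr>)
    (maslov_form F V B (length ms))"

definition maslov_space ::
  "('a, 'd) ring_scheme \<Rightarrow> ('a, 'b, 'e) module_scheme \<Rightarrow> ('b \<Rightarrow> 'b \<Rightarrow> 'a) \<Rightarrow> 'b set list
    \<Rightarrow> ('a, (nat \<Rightarrow> 'b) set) form_space"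
  where "maslov_space F V B ms = (let K = maslov_presentation F V B ms in
    quotient_space K (perp F K (form K) (carrier K)))"

definition maslov_index ::
  "('a, 'd) ring_scheme \<Rightarrow> ('a, 'b, 'e) module_scheme \<Rightarrow> ('b \<Rightarrow> 'b \<Rightarrow> 'a) \<Rightarrow> 'b set list
    \<Rightarrow> ('a, nat \<Rightarrow> 'a) form_space set"
  where "maslov_index F V B ms = witt_class F (maslov_space F V B ms)"

end

theory Submission
  imports Defs
begin

text \<open>Write \<open>K\<^sub>a\<close>, \<open>K\<^sub>b\<close>, \<open>K\<^sub>c\<close> for the degenerate spaces with quotients \<open>T\<^sub>a = T\<^bsub>1,...,k\<^esub>\<close>,
  \<open>T\<^sub>b = T\<^bsub>1,k,...,n\<^esub>\<close> and \<open>T\<^sub>c = T\<^bsub>1,...,n\<^esub>\<close>. The cycle \<open>1,...,n\<close> is cut into two cycles by the chord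
  that joins \<open>1\<close> and \<open>k\<close>. Adding the components at the two ends of the chord glues a pair of
  sequences in \<open>K\<^sub>a \<oplus> K\<^sub>b\<close> to a sequence in \<open>K\<^sub>c\<close>, and this map preserves the forms (\<open>glued_form\<close>): if
  the anti-derivatives are normalised to agree on the chord, together they give an anti-derivative of
  the glued sequence, and the products in which the two sides differ are products of vectors of the
  same Lagrangian.

  A sequence \<open>z\<close> is in the image of the gluing iff the sum \<open>s\<close> of its components from \<open>1\<close> to \<open>k - 1\<close> lies in
  \<open>l\<^sub>1 + l\<^sub>k\<close>. Each \<open>u \<in> l\<^sub>1 \<inter> l\<^sub>k\<close> gives a chord vector, with the entries \<open>u\<close> at \<open>1\<close> and \<open>- u\<close> at \<open>k\<close>, and
  its product with \<open>z\<close> is \<open>B s u\<close>. Because \<open>l\<^sub>1 + l\<^sub>k = (l\<^sub>1 \<inter> l\<^sub>k)\<^sup>\<bottom>\<close>, the image of the gluing consists of the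
  sequences orthogonal to all chord vectors, so it maps onto \<open>I\<^sup>\<bottom>\<close>, where \<open>I \<subseteq> T\<^sub>c\<close> is the
  isotropic image of the chord vectors (\<open>cut_along_chord\<close>). Now \<open>K\<^sub>a \<oplus> K\<^sub>b\<close> maps onto \<open>T\<^sub>a \<oplus> T\<^sub>b\<close> and onto
  \<open>I\<^sup>\<bottom>/I\<close>, preserving the form. Both targets are non-degenerate, hence both are the quotient by the
  radical, and they are isometric (\<open>isometric_of_common_epi\<close>). If \<open>l\<^sub>1 \<inter> l\<^sub>k = 0\<close>, then \<open>I = 0\<close> and
  \<open>I\<^sup>\<bottom>/I\<close> is \<open>T\<^sub>c\<close>.

  For the Maslov index it remains to see that a quadratic space is Witt equivalent to each of its
  subquotients \<open>I\<^sup>\<bottom>/I\<close>, which holds because hyperbolic planes through generators of \<open>I\<close> split off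
  one by one (\<open>witt_equivalent_subquotient\<close>).

  Throughout, constructions are compared by means of form-preserving linear surjections from
  possibly degenerate spaces.\<close>

section \<open>Finite-dimensional spaces and bilinear forms\<close>

lemma (in abelian_group) minus_zero_right: "x \<in> carrier G \<Longrightarrow> x \<ominus> \<zero> = x"
  by (simp add: a_minus_def)

lemma (in vectorspace) subspaceI:
  assumes "W \<subseteq> carrier V" "\<zero>\<^bsub>V\<^esub> \<in> W"
    and "\<And>x y. \<lbrakk>x \<in> W; y \<in> W\<rbrakk> \<Longrightarrow> x \<oplus>\<^bsub>V\<^esub> y \<in> W"
    and "\<And>c x. \<lbrakk>c \<in> carrier K; x \<in> W\<rbrakk> \<Longrightarrow> c \<odot>\<^bsub>V\<^esub> x \<in> W"
  shows "subspace K W V"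
  using assms module_axioms vectorspace_axioms by (simp add: subspace_def submodule_def)

lemma subspaceD:
  assumes "subspace K W V"
  shows "W \<subseteq> carrier V" "\<zero>\<^bsub>V\<^esub> \<in> W"
    and "\<And>x y. \<lbrakk>x \<in> W; y \<in> W\<rbrakk> \<Longrightarrow> x \<oplus>\<^bsub>V\<^esub> y \<in> W"
    and "\<And>c x. \<lbrakk>c \<in> carrier K; x \<in> W\<rbrakk> \<Longrightarrow> c \<odot>\<^bsub>V\<^esub> x \<in> W"
  using assms by (auto simp: subspace_def submodule_def)

lemma (in vectorspace) subspace_uminus:
  assumes W: "subspace K W V" and x: "x \<in> W"
  shows "\<ominus>\<^bsub>V\<^esub> x \<in> W"
  using subspaceD(4)[OF W, of "\<ominus>\<^bsub>K\<^esub> \<one>\<^bsub>K\<^esub>" x] subspaceD(1)[OF W] x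
  by (auto simp: smult_minus_1)

lemma (in vectorspace) subspace_minus:
  assumes W: "subspace K W V" and "x \<in> W" "y \<in> W"
  shows "x \<ominus>\<^bsub>V\<^esub> y \<in> W"
  using subspace_uminus assms subspaceD(3)[OF W] by (auto simp: a_minus_def)

lemma (in vectorspace) span_least:
  "\<lbrakk>subspace K W V; A \<subseteq> W\<rbrakk> \<Longrightarrow> span A \<subseteq> W"
  by (simp add: span_is_subset subspace_def)

text \<open>Finite generation in terms of subspaces instead of linear combinations: subspaces pull back
  along maps that are linear, which makes this form easy to transport.\<close>

lemma (in vectorspace) fin_dim_iff:
  "fin_dim \<longleftrightarrow> (\<exists>A. finite A \<and> A \<subseteq> carrier V \<and>
     (\<forall>W. subspace K W V \<longrightarrow> A \<subseteq> W \<longrightarrow> W = carrier V))"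
proof
  assume fin_dim
  then show "\<exists>A. finite A \<and> A \<subseteq> carrier V \<and>
     (\<forall>W. subspace K W V \<longrightarrow> A \<subseteq> W \<longrightarrow> W = carrier V)"
    unfolding fin_dim_def using span_least subspaceD(1) by (metis subset_antisym)
next
  assume "\<exists>A. finite A \<and> A \<subseteq> carrier V \<and>
     (\<forall>W. subspace K W V \<longrightarrow> A \<subseteq> W \<longrightarrow> W = carrier V)"
  then show fin_dim
    unfolding fin_dim_def using span_is_subspace in_own_span by metis
qed

text \<open>The independent subsets of \<open>W\<close> have bounded size, and a maximal one spans \<open>W\<close>.\<close>

lemma (in vectorspace) subspace_finitely_spanned:
  assumes fd: fin_dim and W: "subspace K W V"
  obtains A where "finite A" "A \<subseteq> W" "span A = W"
proof -
  interpret W: vectorspace K "vs W" by (rule subspace_is_vs[OF W])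
  have sub: "submodule K W V" using W by simp
  have "finite A \<and> card A \<le> dim" if "A \<subseteq> carrier (vs W) \<and> W.lin_indpt A" for A
    using that span_li_not_depend(2)[of A W, OF _ sub] li_le_dim[OF fd, of A] subspaceD(1)[OF W]
    by auto
  moreover have "{} \<subseteq> carrier (vs W) \<and> W.lin_indpt {}"
    by (simp add: W.lin_dep_def)
  ultimately obtain A where A: "finite A" "maximal A (\<lambda>S. S \<subseteq> carrier (vs W) \<and> W.lin_indpt S)"
    using maximal_exists[of "\<lambda>S. S \<subseteq> carrier (vs W) \<and> W.lin_indpt S" dim "{}"] by blast
  then have "W.span A = W" "A \<subseteq> W"
    using W.max_li_is_gen by (auto simp: maximal_def)
  with A(1) show thesis
    using that span_li_not_depend(1)[of A W, OF _ sub] by simp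
qed

lemma (in vectorspace) fin_dim_subspace:
  assumes fd: fin_dim and W: "subspace K W V"
  shows "vectorspace.fin_dim K (V\<lparr>carrier := W\<rparr>)"
proof -
  interpret W: vectorspace K "vs W" by (rule subspace_is_vs[OF W])
  obtain A where "finite A" "A \<subseteq> W" "span A = W"
    by (rule subspace_finitely_spanned[OF assms])
  then show ?thesis
    unfolding W.fin_dim_def using span_li_not_depend(1)[of A W] W by auto
qed

context bilinear_form
begin

lemma form_zero_left [simp]: "x \<in> carrier V \<Longrightarrow> B \<zero>\<^bsub>V\<^esub> x = \<zero>\<^bsub>F\<^esub>"
  using form_smult_left[of "\<zero>\<^bsub>F\<^esub>" x x] form_closed by simp

lemma form_zero_right [simp]: "x \<in> carrier V \<Longrightarrow> B x \<zero>\<^bsub>V\<^esub> = \<zero>\<^bsub>F\<^esub>"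
  using form_smult_right[of "\<zero>\<^bsub>F\<^esub>" x x] form_closed by simp

lemma form_uminus_left: "\<lbrakk>x \<in> carrier V; y \<in> carrier V\<rbrakk> \<Longrightarrow> B (\<ominus>\<^bsub>V\<^esub> x) y = \<ominus>\<^bsub>F\<^esub> B x y"
  using form_smult_left[of "\<ominus>\<^bsub>F\<^esub> \<one>\<^bsub>F\<^esub>" x y] form_closed
  by (simp add: smult_minus_1 l_minus)

lemma form_uminus_right: "\<lbrakk>x \<in> carrier V; y \<in> carrier V\<rbrakk> \<Longrightarrow> B x (\<ominus>\<^bsub>V\<^esub> y) = \<ominus>\<^bsub>F\<^esub> B x y"
  using form_smult_right[of "\<ominus>\<^bsub>F\<^esub> \<one>\<^bsub>F\<^esub>" x y] form_closed
  by (simp add: smult_minus_1 l_minus)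

lemma form_minus_left:
  "\<lbrakk>x \<in> carrier V; x' \<in> carrier V; y \<in> carrier V\<rbrakk> \<Longrightarrow> B (x \<ominus>\<^bsub>V\<^esub> x') y = B x y \<ominus>\<^bsub>F\<^esub> B x' y"
  by (simp add: a_minus_def form_add_left form_uminus_left)

lemma form_minus_right:
  "\<lbrakk>x \<in> carrier V; y \<in> carrier V; y' \<in> carrier V\<rbrakk> \<Longrightarrow> B x (y \<ominus>\<^bsub>V\<^esub> y') = B x y \<ominus>\<^bsub>F\<^esub> B x y'"
  by (simp add: a_minus_def form_add_right form_uminus_right)

lemma perp_zero: "perp F V B {\<zero>\<^bsub>V\<^esub>} = carrier V"
  by (auto simp: perp_def)

lemma perp_subspace:
  assumes "N \<subseteq> carrier V"
  shows "subspace F (perp F V B N) V"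
  by (rule subspaceI) (use assms in \<open>auto simp: perp_def form_add_left form_smult_left subset_iff\<close>)

lemma perp_span:
  assumes A: "A \<subseteq> carrier V"
  shows "perp F V B (span A) = perp F V B A"
proof
  show "perp F V B (span A) \<subseteq> perp F V B A"
    using in_own_span[OF A] by (auto simp: perp_def)
  show "perp F V B A \<subseteq> perp F V B (span A)"
  proof
    fix x assume x: "x \<in> perp F V B A"
    have "subspace F {y \<in> carrier V. B x y = \<zero>\<^bsub>F\<^esub>} V"
      by (rule subspaceI) (use x in \<open>auto simp: perp_def form_add_right form_smult_right\<close>)
    then have "span A \<subseteq> {y \<in> carrier V. B x y = \<zero>\<^bsub>F\<^esub>}"
      by (rule span_least) (use x A in \<open>auto simp: perp_def\<close>)
    with x show "x \<in> perp F V B (span A)"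
      by (auto simp: perp_def)
  qed
qed

text \<open>A linear functional that vanishes on the common kernel of finitely many others is a
  combination of them; here the functionals are those represented by the form. The proof removes
  the last functional \<open>B _ a\<close> from the list: if it is not redundant, some \<open>x\<^sub>0\<close> killed by
  the others has \<open>B x\<^sub>0 a = 1\<close>, and subtracting \<open>B x\<^sub>0 y\<close> times \<open>a\<close> from \<open>y\<close> gives a
  functional that vanishes on the larger kernel.\<close>

lemma perp_perp_span:
  assumes nondeg: "\<And>y. \<lbrakk>y \<in> carrier V; \<And>x. x \<in> carrier V \<Longrightarrow> B x y = \<zero>\<^bsub>F\<^esub>\<rbrakk> \<Longrightarrow> y = \<zero>\<^bsub>V\<^esub>"
    and "finite A" "A \<subseteq> carrier V" "y \<in> carrier V"
    and "\<And>x. x \<in> perp F V B A \<Longrightarrow> B x y = \<zero>\<^bsub>F\<^esub>"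
  shows "y \<in> span A"
  using assms(2-)
proof (induction A arbitrary: y rule: finite_induct)
  case empty
  then have "y = \<zero>\<^bsub>V\<^esub>" by (intro nondeg) (auto simp: perp_def)
  then show ?case by (simp add: span_zero)
next
  case (insert a A)
  have a: "a \<in> carrier V" and A: "A \<subseteq> carrier V" using insert.prems by auto
  have mono: "span A \<subseteq> span (insert a A)" by (rule span_is_monotone) auto
  show ?case
  proof (cases "\<forall>x \<in> perp F V B A. B x a = \<zero>\<^bsub>F\<^esub>")
    case True
    then have "perp F V B A = perp F V B (insert a A)" by (auto simp: perp_def)
    then show ?thesis using insert.IH[OF A] insert.prems mono by auto
  next
    case False
    then obtain x1 where x1: "x1 \<in> perp F V B A" "B x1 a \<noteq> \<zero>\<^bsub>F\<^esub>" by auto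
    note perpD = subspaceD[OF perp_subspace[OF A]]
    have x1V: "x1 \<in> carrier V" using x1(1) perpD(1) by auto
    have unit: "B x1 a \<in> Units F" using x1 x1V a by (simp add: field_Units form_closed)
    define x0 where "x0 = inv\<^bsub>F\<^esub> (B x1 a) \<odot>\<^bsub>V\<^esub> x1"
    have x0: "x0 \<in> perp F V B A" unfolding x0_def by (rule perpD(4)) (use unit x1 in auto)
    then have x0V: "x0 \<in> carrier V" using perpD(1) by auto
    have x0a: "B x0 a = \<one>\<^bsub>F\<^esub>"
      unfolding x0_def using unit x1V a by (simp add: form_smult_left)
    define c where "c = B x0 y"
    have c: "c \<in> carrier F" unfolding c_def using x0V insert.prems by (simp add: form_closed)
    define y' where "y' = y \<ominus>\<^bsub>V\<^esub> c \<odot>\<^bsub>V\<^esub> a"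
    have y: "y \<in> carrier V" and y': "y' \<in> carrier V"
      using insert.prems a c by (auto simp: y'_def)
    have "B x y' = \<zero>\<^bsub>F\<^esub>" if x: "x \<in> perp F V B A" for x
    proof -
      have xV: "x \<in> carrier V" using x perpD(1) by auto
      have Bxa: "B x a \<in> carrier F" using xV a by (rule form_closed)
      define z where "z = x \<ominus>\<^bsub>V\<^esub> B x a \<odot>\<^bsub>V\<^esub> x0"
      have "z \<in> perp F V B A"
        unfolding z_def by (rule subspace_minus[OF perp_subspace[OF A]]) (use x x0 Bxa perpD(4) in auto)
      moreover have "B z a = \<zero>\<^bsub>F\<^esub>"
        unfolding z_def using xV x0V a Bxa
        by (simp add: form_minus_left form_smult_left x0a form_closed)
      ultimately have "B z y = \<zero>\<^bsub>F\<^esub>" using insert.prems by (auto simp: perp_def)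
      then show ?thesis
        unfolding z_def y'_def using xV x0V a y c Bxa
        by (simp add: form_minus_left form_minus_right form_smult_left form_smult_right
            form_closed m_comm flip: c_def)
    qed
    then have "y' \<in> span A" using insert.IH[OF A y'] by auto
    then have "y' \<in> span (insert a A)" using mono by auto
    moreover have "c \<odot>\<^bsub>V\<^esub> a \<in> span (insert a A)"
      using in_own_span[OF insert.prems(1)] c
        subspaceD(4)[OF span_is_subspace[OF insert.prems(1)]] by auto
    moreover have "y = y' \<oplus>\<^bsub>V\<^esub> c \<odot>\<^bsub>V\<^esub> a"
      unfolding y'_def using y a c by (simp add: a_minus_def a_assoc l_neg)
    ultimately show ?thesis
      using subspaceD(3)[OF span_is_subspace[OF insert.prems(1)]] by auto
  qed
qed

end

section \<open>Symmetric spaces and form-preserving surjections\<close>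

locale symmetric_space = bilinear_form F Q "form Q"
  for F (structure) and Q :: "('a, 'c) form_space" (structure) +
  assumes fin_dim: "fin_dim"
    and symmetric: "\<lbrakk>x \<in> carrier Q; y \<in> carrier Q\<rbrakk> \<Longrightarrow> form Q x y = form Q y x"

lemma quadratic_space_iff:
  "quadratic_space F Q \<longleftrightarrow> symmetric_space F Q \<and>
    (\<forall>x\<in>carrier Q. (\<forall>y\<in>carrier Q. form Q x y = \<zero>\<^bsub>F\<^esub>) \<longrightarrow> x = \<zero>\<^bsub>Q\<^esub>)"
  by (auto simp: quadratic_space_def quadratic_space_axioms_def
      symmetric_space_def symmetric_space_axioms_def)

lemma quadratic_imp_symmetric: "quadratic_space F Q \<Longrightarrow> symmetric_space F Q"
  by (simp add: quadratic_space_iff)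

text \<open>The target is a bare record, so that \<open>f 0 = 0\<close> does not follow from additivity.\<close>

definition form_epi ::
  "('a, 'd) ring_scheme \<Rightarrow> ('a, 'b) form_space \<Rightarrow> ('a, 'c) form_space \<Rightarrow> ('b \<Rightarrow> 'c) \<Rightarrow> bool"
  where "form_epi F P Q f \<longleftrightarrow> f ` carrier P = carrier Q \<and> f \<zero>\<^bsub>P\<^esub> = \<zero>\<^bsub>Q\<^esub> \<and>
    (\<forall>x\<in>carrier P. \<forall>y\<in>carrier P. f (x \<oplus>\<^bsub>P\<^esub> y) = f x \<oplus>\<^bsub>Q\<^esub> f y) \<and>
    (\<forall>c\<in>carrier F. \<forall>x\<in>carrier P. f (c \<odot>\<^bsub>P\<^esub> x) = c \<odot>\<^bsub>Q\<^esub> f x) \<and>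
    (\<forall>x\<in>carrier P. \<forall>y\<in>carrier P. form Q (f x) (f y) = form P x y)"

lemma form_epiD:
  assumes "form_epi F P Q f"
  shows "f ` carrier P = carrier Q" "f \<zero>\<^bsub>P\<^esub> = \<zero>\<^bsub>Q\<^esub>"
    "\<And>x. x \<in> carrier P \<Longrightarrow> f x \<in> carrier Q"
    "\<And>x y. \<lbrakk>x \<in> carrier P; y \<in> carrier P\<rbrakk> \<Longrightarrow> f (x \<oplus>\<^bsub>P\<^esub> y) = f x \<oplus>\<^bsub>Q\<^esub> f y"
    "\<And>c x. \<lbrakk>c \<in> carrier F; x \<in> carrier P\<rbrakk> \<Longrightarrow> f (c \<odot>\<^bsub>P\<^esub> x) = c \<odot>\<^bsub>Q\<^esub> f x"
    "\<And>x y. \<lbrakk>x \<in> carrier P; y \<in> carrier P\<rbrakk> \<Longrightarrow> form Q (f x) (f y) = form P x y"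
  using assms by (auto simp: form_epi_def)

lemma form_epi_id: "form_epi F P P (\<lambda>x. x)"
  by (simp add: form_epi_def)

lemma form_epi_comp:
  assumes "form_epi F P Q f" "form_epi F Q R g"
  shows "form_epi F P R (\<lambda>x. g (f x))"
proof -
  have "(\<lambda>x. g (f x)) ` carrier P = carrier R"
    using form_epiD(1)[OF assms(1)] form_epiD(1)[OF assms(2)] by (metis image_image)
  then show ?thesis
    using form_epiD[OF assms(1)] form_epiD[OF assms(2)] by (simp add: form_epi_def)
qed

text \<open>All the structure of \<open>Q\<close> comes from \<open>P\<close>. Hence a record built from spaces is shown to be a
  space itself by exhibiting a surjection onto it, without checking axioms for it again.\<close>

lemma form_epi_symmetric_space:
  assumes P: "symmetric_space F P" and f: "form_epi F P Q f"
  shows "symmetric_space F Q"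
proof -
  interpret P: symmetric_space F P by (rule P)
  note im = form_epiD(1)[OF f, symmetric]
  note hom = form_epiD(2,4,5)[OF f, symmetric] and form = form_epiD(6)[OF f]
  have "module F Q"
  proof (rule module_criteria)
    show "cring F" by (rule P.R.is_cring)
    show "\<forall>v\<in>carrier Q. \<exists>w\<in>carrier Q. v \<oplus>\<^bsub>Q\<^esub> w = \<zero>\<^bsub>Q\<^esub>"
    proof
      fix v assume "v \<in> carrier Q"
      then obtain x where "x \<in> carrier P" "v = f x" by (auto simp: im)
      then show "\<exists>w\<in>carrier Q. v \<oplus>\<^bsub>Q\<^esub> w = \<zero>\<^bsub>Q\<^esub>"
        by (intro bexI[of _ "f (\<ominus>\<^bsub>P\<^esub> x)"]) (auto simp: im hom P.r_neg)
    qed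
  qed (auto simp: im hom P.a_ac P.smult_assoc1 P.smult_l_distr P.smult_r_distr)
  then have vs: "vectorspace F Q"
    by (simp add: vectorspace_def P.field_axioms)
  interpret Q: vectorspace F Q by (rule vs)
  obtain A where A: "finite A" "A \<subseteq> carrier P"
      "\<And>W. \<lbrakk>subspace F W P; A \<subseteq> W\<rbrakk> \<Longrightarrow> W = carrier P"
    using P.fin_dim unfolding P.fin_dim_iff by auto
  have "W = carrier Q" if W: "subspace F W Q" "f ` A \<subseteq> W" for W
  proof -
    have "subspace F {x \<in> carrier P. f x \<in> W} P"
      by (rule P.subspaceI) (use form_epiD[OF f] subspaceD[OF W(1)] in auto)
    then have "{x \<in> carrier P. f x \<in> W} = carrier P"
      by (rule A(3)) (use A(2) W(2) in auto)
    then show ?thesis using subspaceD(1)[OF W(1)] by (auto simp: im)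
  qed
  then have "Q.fin_dim"
    unfolding Q.fin_dim_iff using A(1,2) form_epiD(3)[OF f] by (intro exI[of _ "f ` A"]) auto
  moreover have "bilinear_form F Q (form Q)"
    using vs by (auto simp: bilinear_form_def bilinear_form_axioms_def im hom form P.form_closed
        P.form_add_left P.form_add_right P.form_smult_left P.form_smult_right)
  ultimately show ?thesis
    by (auto simp: symmetric_space_def symmetric_space_axioms_def im form P.symmetric)
qed

lemma form_epi_quadratic_space:
  assumes P: "symmetric_space F P" and f: "form_epi F P Q f"
    and rad: "\<And>x. \<lbrakk>x \<in> carrier P; \<And>y. y \<in> carrier P \<Longrightarrow> form P x y = \<zero>\<^bsub>F\<^esub>\<rbrakk> \<Longrightarrow> f x = \<zero>\<^bsub>Q\<^esub>"
  shows "quadratic_space F Q"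
  using form_epi_symmetric_space[OF P f] rad form_epiD(6)[OF f]
  by (auto simp: quadratic_space_iff simp flip: form_epiD(1)[OF f])

lemma form_epi_quadratic_zero_iff:
  assumes Q: "quadratic_space F Q" and f: "form_epi F P Q f" and x: "x \<in> carrier P"
  shows "f x = \<zero>\<^bsub>Q\<^esub> \<longleftrightarrow> (\<forall>y\<in>carrier P. form P x y = \<zero>\<^bsub>F\<^esub>)"
proof -
  interpret Q: quadratic_space F Q by (rule Q)
  show ?thesis
  proof
    assume "f x = \<zero>\<^bsub>Q\<^esub>"
    then show "\<forall>y\<in>carrier P. form P x y = \<zero>\<^bsub>F\<^esub>"
      using form_epiD(3,6)[OF f] x by (metis Q.form_zero_left)
  next
    assume "\<forall>y\<in>carrier P. form P x y = \<zero>\<^bsub>F\<^esub>"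
    then show "f x = \<zero>\<^bsub>Q\<^esub>"
      using x form_epiD(3,6)[OF f]
      by (intro Q.nondegenerate) (auto simp flip: form_epiD(1)[OF f])
  qed
qed

lemma form_epi_quadratic_eq_iff:
  assumes P: "symmetric_space F P" and Q: "quadratic_space F Q" and f: "form_epi F P Q f"
    and x: "x \<in> carrier P" and y: "y \<in> carrier P"
  shows "f x = f y \<longleftrightarrow> (\<forall>z\<in>carrier P. form P x z = form P y z)"
proof -
  interpret P: symmetric_space F P by (rule P)
  interpret Q: quadratic_space F Q by (rule Q)
  have "f (x \<ominus>\<^bsub>P\<^esub> y) = f x \<ominus>\<^bsub>Q\<^esub> f y"
    using form_epiD(3,4)[OF f] form_epiD(5)[OF f, of "\<ominus>\<^bsub>F\<^esub> \<one>\<^bsub>F\<^esub>" y] x y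
    by (simp add: a_minus_def P.smult_minus_1 Q.smult_minus_1)
  then have "f x = f y \<longleftrightarrow> f (x \<ominus>\<^bsub>P\<^esub> y) = \<zero>\<^bsub>Q\<^esub>"
    using x y form_epiD(3)[OF f] by simp
  also have "\<dots> \<longleftrightarrow> (\<forall>z\<in>carrier P. form P x z = form P y z)"
    using x y by (simp add: form_epi_quadratic_zero_iff[OF Q f] P.form_minus_left P.form_closed)
  finally show ?thesis .
qed

text \<open>Both surjections have the radical of \<open>P\<close> as their kernel, so the two targets are the same
  quotient of \<open>P\<close>.\<close>

lemma isometric_of_common_epi:
  assumes P: "symmetric_space F P" and Q: "quadratic_space F Q" and R: "quadratic_space F R"
    and f: "form_epi F P Q f" and g: "form_epi F P R g"
  shows "isometric F Q R"
proof -
  interpret Q: quadratic_space F Q by (rule Q)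
  interpret R: quadratic_space F R by (rule R)
  interpret P: symmetric_space F P by (rule P)
  define h where "h = (\<lambda>q. g (SOME x. x \<in> carrier P \<and> f x = q))"
  have h: "h (f x) = g x" if x: "x \<in> carrier P" for x
  proof -
    have "\<exists>x'. x' \<in> carrier P \<and> f x' = f x" using x by auto
    from someI_ex[OF this] have "(SOME x'. x' \<in> carrier P \<and> f x' = f x) \<in> carrier P"
      "f (SOME x'. x' \<in> carrier P \<and> f x' = f x) = f x" by auto
    then show ?thesis
      using x unfolding h_def
      by (simp add: form_epi_quadratic_eq_iff[OF P Q f] form_epi_quadratic_eq_iff[OF P R g])
  qed
  note imf = form_epiD(1)[OF f, symmetric] and img = form_epiD(1)[OF g, symmetric]
  have "h \<in> module_hom F Q R"
    by (auto simp: module_hom_def imf h form_epiD[OF g] simp flip: form_epiD(4,5)[OF f])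
  then have "linear_map F Q R h"
    by (simp add: linear_map_def mod_hom_def mod_hom_axioms_def
        Q.vectorspace_axioms R.vectorspace_axioms Q.module_axioms R.module_axioms)
  moreover have "inj_on h (carrier Q)"
    by (auto simp: inj_on_def imf h form_epi_quadratic_eq_iff[OF P Q f]
        form_epi_quadratic_eq_iff[OF P R g])
  moreover have "h ` carrier Q = carrier R"
    by (auto simp: imf img h image_image cong: image_cong)
  moreover have "\<forall>x\<in>carrier Q. \<forall>y\<in>carrier Q. form R (h x) (h y) = form Q x y"
    by (auto simp: imf h form_epiD(6)[OF f] form_epiD(6)[OF g])
  ultimately show ?thesis
    using Q R by (auto simp: isometric_def bij_betw_def)
qed

text \<open>The kernel of a form-preserving map lies in the radical. So a surjection from a
  non-degenerate space is injective, and its target is non-degenerate.\<close>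

lemma isometric_iff_form_epi:
  "isometric F Q R \<longleftrightarrow> quadratic_space F Q \<and> (\<exists>f. form_epi F Q R f)"
proof
  assume iso: "isometric F Q R"
  then obtain f where f: "linear_map F Q R f" "bij_betw f (carrier Q) (carrier R)"
     "\<forall>x\<in>carrier Q. \<forall>y\<in>carrier Q. form R (f x) (f y) = form Q x y"
    and QR: "quadratic_space F Q" "quadratic_space F R"
    by (auto simp: isometric_def)
  interpret f: linear_map F Q R f by (rule f(1))
  have "form_epi F Q R f"
    using f(2,3) by (simp add: form_epi_def bij_betw_def)
  with QR show "quadratic_space F Q \<and> (\<exists>f. form_epi F Q R f)" by auto
next
  assume "quadratic_space F Q \<and> (\<exists>f. form_epi F Q R f)"
  then obtain f where Q: "quadratic_space F Q" and f: "form_epi F Q R f" by auto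
  interpret Q: quadratic_space F Q by (rule Q)
  have "quadratic_space F R"
    by (rule form_epi_quadratic_space[OF quadratic_imp_symmetric[OF Q] f])
      (use Q.nondegenerate form_epiD(2)[OF f] in metis)
  then show "isometric F Q R"
    by (rule isometric_of_common_epi[OF quadratic_imp_symmetric[OF Q] Q _ form_epi_id f])
qed

lemma isometricI: "\<lbrakk>quadratic_space F Q; form_epi F Q R f\<rbrakk> \<Longrightarrow> isometric F Q R"
  by (auto simp: isometric_iff_form_epi)

lemma isometric_refl: "quadratic_space F Q \<Longrightarrow> isometric F Q Q"
  by (rule isometricI[OF _ form_epi_id])

lemma isometric_sym:
  assumes "isometric F Q R" shows "isometric F R Q"
proof -
  obtain f where "form_epi F Q R f" using assms by (auto simp: isometric_iff_form_epi)
  moreover have "quadratic_space F Q" "quadratic_space F R" using assms by (auto simp: isometric_def)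
  ultimately show ?thesis
    using isometric_of_common_epi[OF _ _ _ _ form_epi_id] quadratic_imp_symmetric by blast
qed

lemma isometric_trans [trans]:
  assumes "isometric F P Q" "isometric F Q R" shows "isometric F P R"
  using assms form_epi_comp by (auto simp: isometric_iff_form_epi) blast

lemma symmetric_space_subspace:
  assumes P: "symmetric_space F P" and U: "subspace F U P"
  shows "symmetric_space F (P\<lparr>carrier := U\<rparr>)"
proof -
  interpret P: symmetric_space F P by (rule P)
  have U': "\<And>x. x \<in> U \<Longrightarrow> x \<in> carrier P" using subspaceD(1)[OF U] by auto
  have "bilinear_form F (P\<lparr>carrier := U\<rparr>) (form (P\<lparr>carrier := U\<rparr>))"
    using P.subspace_is_vs[OF U] U'
    by (auto simp: bilinear_form_def bilinear_form_axioms_def P.form_closed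
        P.form_add_left P.form_add_right P.form_smult_left P.form_smult_right)
  then show ?thesis
    using P.fin_dim_subspace[OF P.fin_dim U] U' P.symmetric
    by (auto simp: symmetric_space_def symmetric_space_axioms_def)
qed

subsection \<open>Orthogonal sums\<close>

lemma with_form_simps [simp]:
  "carrier (with_form M b) = carrier M" "zero (with_form M b) = zero M"
  "add (with_form M b) = add M" "smult (with_form M b) = smult M" "form (with_form M b) = b"
  by (simp_all add: with_form_def module.defs form_space.defs)

lemma orth_sum_simps [simp]:
  "carrier (orth_sum F P Q) = carrier P \<times> carrier Q"
  "\<zero>\<^bsub>orth_sum F P Q\<^esub> = (\<zero>\<^bsub>P\<^esub>, \<zero>\<^bsub>Q\<^esub>)"
  "x \<oplus>\<^bsub>orth_sum F P Q\<^esub> y = (fst x \<oplus>\<^bsub>P\<^esub> fst y, snd x \<oplus>\<^bsub>Q\<^esub> snd y)"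
  "c \<odot>\<^bsub>orth_sum F P Q\<^esub> x = (c \<odot>\<^bsub>P\<^esub> fst x, c \<odot>\<^bsub>Q\<^esub> snd x)"
  "form (orth_sum F P Q) x y = form P (fst x) (fst y) \<oplus>\<^bsub>F\<^esub> form Q (snd x) (snd y)"
  by (simp_all add: orth_sum_def direct_sum_def)

lemma symmetric_space_orth_sum:
  assumes P: "symmetric_space F P" and Q: "symmetric_space F Q"
  shows "symmetric_space F (orth_sum F P Q)"
proof -
  interpret P: symmetric_space F P by (rule P)
  interpret Q: symmetric_space F Q by (rule Q)
  let ?S = "orth_sum F P Q"
  have "module F ?S"
  proof (rule module_criteria)
    show "cring F" by (rule P.R.is_cring)
    show "\<forall>v\<in>carrier ?S. \<exists>w\<in>carrier ?S. v \<oplus>\<^bsub>?S\<^esub> w = \<zero>\<^bsub>?S\<^esub>"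
    proof
      fix v assume "v \<in> carrier ?S"
      then show "\<exists>w\<in>carrier ?S. v \<oplus>\<^bsub>?S\<^esub> w = \<zero>\<^bsub>?S\<^esub>"
        by (intro bexI[of _ "(\<ominus>\<^bsub>P\<^esub> fst v, \<ominus>\<^bsub>Q\<^esub> snd v)"]) (auto simp: P.r_neg Q.r_neg)
    qed
  qed (auto simp: P.a_ac P.smult_assoc1 P.smult_l_distr P.smult_r_distr
      Q.a_ac Q.smult_assoc1 Q.smult_l_distr Q.smult_r_distr)
  then have vs: "vectorspace F ?S"
    by (simp add: vectorspace_def P.field_axioms)
  interpret S: vectorspace F ?S by (rule vs)
  obtain A where A: "finite A" "A \<subseteq> carrier P"
      "\<And>W. \<lbrakk>subspace F W P; A \<subseteq> W\<rbrakk> \<Longrightarrow> W = carrier P"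
    using P.fin_dim unfolding P.fin_dim_iff by auto
  obtain B where B: "finite B" "B \<subseteq> carrier Q"
      "\<And>W. \<lbrakk>subspace F W Q; B \<subseteq> W\<rbrakk> \<Longrightarrow> W = carrier Q"
    using Q.fin_dim unfolding Q.fin_dim_iff by auto
  let ?G = "A \<times> {\<zero>\<^bsub>Q\<^esub>} \<union> {\<zero>\<^bsub>P\<^esub>} \<times> B"
  have "W = carrier ?S" if W: "subspace F W ?S" "?G \<subseteq> W" for W
  proof -
    note WD = subspaceD[OF W(1)]
    have "subspace F {x \<in> carrier P. (x, \<zero>\<^bsub>Q\<^esub>) \<in> W} P"
      by (rule P.subspaceI) (use WD(2) WD(3)[of "(_, \<zero>\<^bsub>Q\<^esub>)" "(_, \<zero>\<^bsub>Q\<^esub>)"]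
          WD(4)[of _ "(_, \<zero>\<^bsub>Q\<^esub>)"] in \<open>auto\<close>)
    then have 1: "{x \<in> carrier P. (x, \<zero>\<^bsub>Q\<^esub>) \<in> W} = carrier P"
      by (rule A(3)) (use A(2) W(2) in auto)
    have "subspace F {x \<in> carrier Q. (\<zero>\<^bsub>P\<^esub>, x) \<in> W} Q"
      by (rule Q.subspaceI) (use WD(2) WD(3)[of "(\<zero>\<^bsub>P\<^esub>, _)" "(\<zero>\<^bsub>P\<^esub>, _)"]
          WD(4)[of _ "(\<zero>\<^bsub>P\<^esub>, _)"] in \<open>auto\<close>)
    then have 2: "{x \<in> carrier Q. (\<zero>\<^bsub>P\<^esub>, x) \<in> W} = carrier Q"
      by (rule B(3)) (use B(2) W(2) in auto)
    have "(x, y) \<in> W" if "x \<in> carrier P" "y \<in> carrier Q" for x y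
      using WD(3)[of "(x, \<zero>\<^bsub>Q\<^esub>)" "(\<zero>\<^bsub>P\<^esub>, y)"] 1 2 that by auto
    then show ?thesis using WD(1) by auto
  qed
  then have "S.fin_dim"
    unfolding S.fin_dim_iff using A(1,2) B(1,2) by (intro exI[of _ ?G]) auto
  moreover have "bilinear_form F ?S (form ?S)"
    using vs by (auto simp: bilinear_form_def bilinear_form_axioms_def P.form_closed Q.form_closed
        P.form_add_left P.form_add_right P.form_smult_left P.form_smult_right
        Q.form_add_left Q.form_add_right Q.form_smult_left Q.form_smult_right
        P.R.a_ac P.R.r_distr)
  ultimately show ?thesis
    by (auto simp: symmetric_space_def symmetric_space_axioms_def P.symmetric Q.symmetric)
qed

lemma quadratic_space_orth_sum:
  assumes P: "quadratic_space F P" and Q: "quadratic_space F Q"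
  shows "quadratic_space F (orth_sum F P Q)"
proof -
  interpret P: quadratic_space F P by (rule P)
  interpret Q: quadratic_space F Q by (rule Q)
  have "x = \<zero>\<^bsub>P\<^esub> \<and> y = \<zero>\<^bsub>Q\<^esub>"
    if x: "x \<in> carrier P" and y: "y \<in> carrier Q"
      and 0: "\<And>a b. \<lbrakk>a \<in> carrier P; b \<in> carrier Q\<rbrakk> \<Longrightarrow> form P x a \<oplus>\<^bsub>F\<^esub> form Q y b = \<zero>\<^bsub>F\<^esub>"
    for x y
  proof
    show "x = \<zero>\<^bsub>P\<^esub>"
      by (rule P.nondegenerate[OF x]) (use 0[of _ "\<zero>\<^bsub>Q\<^esub>"] x y in \<open>simp add: P.form_closed\<close>)
    show "y = \<zero>\<^bsub>Q\<^esub>"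
      by (rule Q.nondegenerate[OF y]) (use 0[of "\<zero>\<^bsub>P\<^esub>"] x y in \<open>simp add: Q.form_closed\<close>)
  qed
  then show ?thesis
    using symmetric_space_orth_sum[OF quadratic_imp_symmetric[OF P] quadratic_imp_symmetric[OF Q]]
    by (auto simp: quadratic_space_iff)
qed

lemma form_epi_orth_sum:
  assumes "form_epi F P Q f" "form_epi F P' Q' f'"
  shows "form_epi F (orth_sum F P P') (orth_sum F Q Q') (map_prod f f')"
  using form_epiD[OF assms(1)] form_epiD[OF assms(2)]
  by (simp add: form_epi_def map_prod_surj_on)

lemma isometric_orth_sum:
  assumes "isometric F P Q" "isometric F P' Q'"
  shows "isometric F (orth_sum F P P') (orth_sum F Q Q')"
  using assms quadratic_space_orth_sum form_epi_orth_sum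
  by (auto simp: isometric_iff_form_epi) blast

lemma isometric_orth_sum_assoc:
  assumes "quadratic_space F P" "quadratic_space F Q" "quadratic_space F R"
  shows "isometric F (orth_sum F (orth_sum F P Q) R) (orth_sum F P (orth_sum F Q R))"
proof -
  interpret P: quadratic_space F P by fact
  interpret Q: quadratic_space F Q by fact
  interpret R: quadratic_space F R by fact
  have "form_epi F (orth_sum F (orth_sum F P Q) R) (orth_sum F P (orth_sum F Q R))
      (\<lambda>((x, y), z). (x, (y, z)))"
    by (auto simp: form_epi_def P.form_closed Q.form_closed R.form_closed P.R.a_ac image_iff)
  then show ?thesis
    using assms by (intro isometricI) (auto intro: quadratic_space_orth_sum)
qed

lemma isometric_orth_sum_swap:
  assumes "quadratic_space F P" "quadratic_space F Q" "quadratic_space F P'" "quadratic_space F Q'"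
  shows "isometric F (orth_sum F (orth_sum F P Q) (orth_sum F P' Q'))
    (orth_sum F (orth_sum F P P') (orth_sum F Q Q'))"
proof -
  interpret P: quadratic_space F P by fact
  interpret Q: quadratic_space F Q by fact
  interpret P': quadratic_space F P' by fact
  interpret Q': quadratic_space F Q' by fact
  have "form_epi F (orth_sum F (orth_sum F P Q) (orth_sum F P' Q'))
      (orth_sum F (orth_sum F P P') (orth_sum F Q Q'))
      (\<lambda>((x, y), (x', y')). ((x, x'), (y, y')))"
    by (auto simp: form_epi_def P.form_closed Q.form_closed P'.form_closed Q'.form_closed
        P.R.a_ac image_iff)
  then show ?thesis
    using assms by (intro isometricI) (auto intro: quadratic_space_orth_sum)
qed

subsection \<open>Quotients and subquotients\<close>

text \<open>Translating a vector by an element of the radical does not change its products with others,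
  so the form computed from arbitrarily chosen representatives is the right one.\<close>

lemma form_epi_quotient_space:
  assumes P: "symmetric_space F P" and N: "subspace F N P"
    and rad: "\<And>x y. \<lbrakk>x \<in> N; y \<in> carrier P\<rbrakk> \<Longrightarrow> form P x y = \<zero>\<^bsub>F\<^esub>"
  shows "form_epi F P (quotient_space P N) (\<lambda>x. N +>\<^bsub>P\<^esub> x)"
proof -
  interpret P: symmetric_space F P by (rule P)
  note ND = subspaceD[OF N]
  have N_P: "x \<in> N \<Longrightarrow> x \<in> carrier P" for x using ND(1) by auto
  have "subgroup N (add_monoid P)"
    by (rule P.add.subgroupI) (use ND P.subspace_uminus[OF N] in \<open>auto simp: a_inv_def\<close>)
  then interpret N: abelian_subgroup N P
    by (intro abelian_subgroupI3 additive_subgroup.intro P.abelian_group_axioms)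
  have coset: "N +>\<^bsub>P\<^esub> v = (\<lambda>n. n \<oplus>\<^bsub>P\<^esub> v) ` N" for v
    by (auto simp: a_r_coset_def')
  have eq: "N +>\<^bsub>P\<^esub> (n \<oplus>\<^bsub>P\<^esub> v) = N +>\<^bsub>P\<^esub> v" if "n \<in> N" "v \<in> carrier P" for n v
    using that N.a_repr_independence'[of "n \<oplus>\<^bsub>P\<^esub> v" v] by (auto simp: coset)
  have smult: "(\<Union>x\<in>N +>\<^bsub>P\<^esub> v. N +>\<^bsub>P\<^esub> (c \<odot>\<^bsub>P\<^esub> x)) = N +>\<^bsub>P\<^esub> (c \<odot>\<^bsub>P\<^esub> v)"
    if "c \<in> carrier F" "v \<in> carrier P" for c v
  proof -
    have "N +>\<^bsub>P\<^esub> (c \<odot>\<^bsub>P\<^esub> x) = N +>\<^bsub>P\<^esub> (c \<odot>\<^bsub>P\<^esub> v)" if x: "x \<in> N +>\<^bsub>P\<^esub> v" for x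
    proof -
      obtain n where n: "n \<in> N" "x = n \<oplus>\<^bsub>P\<^esub> v" using x by (auto simp: coset)
      then show ?thesis
        using that \<open>c \<in> carrier F\<close> \<open>v \<in> carrier P\<close> ND(4) N_P by (simp add: P.smult_r_distr eq)
    qed
    moreover have "N +>\<^bsub>P\<^esub> v \<noteq> {}" using N.a_rcos_self[OF that(2)] by auto
    ultimately show ?thesis by simp
  qed
  have "form P (SOME x. x \<in> N +>\<^bsub>P\<^esub> v) (SOME x. x \<in> N +>\<^bsub>P\<^esub> w) = form P v w"
    if v: "v \<in> carrier P" and w: "w \<in> carrier P" for v w
  proof -
    have rep: "\<exists>n\<in>N. (SOME x. x \<in> N +>\<^bsub>P\<^esub> u) = n \<oplus>\<^bsub>P\<^esub> u" if u: "u \<in> carrier P" for u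
      using someI[of "\<lambda>x. x \<in> N +>\<^bsub>P\<^esub> u", OF N.a_rcos_self[OF u]] by (auto simp: coset)
    obtain n n' where n: "n \<in> N" "(SOME x. x \<in> N +>\<^bsub>P\<^esub> v) = n \<oplus>\<^bsub>P\<^esub> v"
      and n': "n' \<in> N" "(SOME x. x \<in> N +>\<^bsub>P\<^esub> w) = n' \<oplus>\<^bsub>P\<^esub> w"
      using rep[OF v] rep[OF w] by auto
    have "form P v n' = \<zero>\<^bsub>F\<^esub>" using rad[OF n'(1) v] P.symmetric[OF v, of n'] n' N_P by simp
    then show ?thesis
      unfolding n(2) n'(2) using v w n(1) n'(1) N_P rad
      by (simp add: P.form_add_left P.form_add_right P.form_closed)
  qed
  moreover have "N +>\<^bsub>P\<^esub> \<zero>\<^bsub>P\<^esub> = N"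
    using N_P by (auto simp: coset)
  ultimately show ?thesis
    unfolding form_epi_def quotient_space_def
    by (auto simp: A_RCOSETS_def' N.a_rcos_sum smult)
qed

lemma coset_of_member:
  assumes P: "symmetric_space F P" and N: "subspace F N P"  and x: "x \<in> N"
  shows "N +>\<^bsub>P\<^esub> x = N"
proof -
  interpret P: symmetric_space F P by (rule P)
  note ND = subspaceD[OF N]
  have "y = (y \<ominus>\<^bsub>P\<^esub> x) \<oplus>\<^bsub>P\<^esub> x" if "y \<in> N" for y
    using that x ND(1) by (auto simp: a_minus_def P.a_assoc P.l_neg subset_iff)
  then have "\<exists>z\<in>N. y = z \<oplus>\<^bsub>P\<^esub> x" if "y \<in> N" for y
    using that P.subspace_minus[OF N that x] by blast
  then show ?thesis
    using ND(3) x by (auto simp: a_r_coset_def')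
qed

lemma quadratic_space_mod_radical:
  assumes P: "symmetric_space F P" and N: "N = perp F P (form P) (carrier P)"
  shows "form_epi F P (quotient_space P N) (\<lambda>x. N +>\<^bsub>P\<^esub> x)" "quadratic_space F (quotient_space P N)"
proof -
  interpret P: symmetric_space F P by (rule P)
  have sub: "subspace F N P" unfolding N by (rule P.perp_subspace) simp
  show epi: "form_epi F P (quotient_space P N) (\<lambda>x. N +>\<^bsub>P\<^esub> x)"
    by (rule form_epi_quotient_space[OF P sub]) (simp add: N perp_def)
  show "quadratic_space F (quotient_space P N)"
    by (rule form_epi_quadratic_space[OF P epi])
      (use coset_of_member[OF P sub] in \<open>auto simp: N perp_def quotient_space_def\<close>)
qed

text \<open>The radical of \<open>I\<^sup>\<bottom>\<close> is \<open>I\<^sup>\<bottom>\<^sup>\<bottom> = I\<close>, which is why the subquotient is non-degenerate.\<close>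

lemma quadratic_space_subquotient:
  assumes T: "quadratic_space F T" and I: "isotropic F T I"
  shows "form_epi F (T\<lparr>carrier := perp F T (form T) I\<rparr>) (subquotient F T I)
      (\<lambda>x. I +>\<^bsub>T\<lparr>carrier := perp F T (form T) I\<rparr>\<^esub> x)"
    and "quadratic_space F (subquotient F T I)"
proof -
  interpret T: quadratic_space F T by (rule T)
  let ?U = "perp F T (form T) I"
  have I_sub: "subspace F I T" using I by (simp add: isotropic_def)
  note ID = subspaceD[OF I_sub]
  have U_sub: "subspace F ?U T" by (rule T.perp_subspace[OF ID(1)])
  have U: "symmetric_space F (T\<lparr>carrier := ?U\<rparr>)"
    by (rule symmetric_space_subspace[OF quadratic_imp_symmetric[OF T] U_sub])
  interpret U: symmetric_space F "T\<lparr>carrier := ?U\<rparr>" by (rule U)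
  have I_U: "I \<subseteq> ?U" using I ID(1) by (auto simp: isotropic_def perp_def)
  have sub: "subspace F I (T\<lparr>carrier := ?U\<rparr>)"
    by (rule U.subspaceI) (use I_U ID in auto)
  have orth: "form T x y = \<zero>\<^bsub>F\<^esub>" if "x \<in> I" "y \<in> ?U" for x y
    using that ID(1) T.symmetric[of x y] by (auto simp: perp_def)
  show epi: "form_epi F (T\<lparr>carrier := ?U\<rparr>) (subquotient F T I) (\<lambda>x. I +>\<^bsub>T\<lparr>carrier := ?U\<rparr>\<^esub> x)"
    unfolding subquotient_def by (rule form_epi_quotient_space[OF U sub]) (use orth in auto)
  obtain A where A: "finite A" "A \<subseteq> I" "T.span A = I"
    using T.subspace_finitely_spanned[OF T.fin_dim I_sub] .
  have "x \<in> I" if x: "x \<in> ?U" and 0: "\<And>y. y \<in> ?U \<Longrightarrow> form T x y = \<zero>\<^bsub>F\<^esub>" for x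
  proof -
    have xT: "x \<in> carrier T" using x by (simp add: perp_def)
    have AT: "A \<subseteq> carrier T" using A(2) ID(1) by auto
    have "x \<in> T.span A"
    proof (rule T.perp_perp_span[OF _ A(1) AT xT])
      fix y assume "y \<in> perp F T (form T) A"
      then have "y \<in> ?U" using T.perp_span[OF AT] A(3) by simp
      then show "form T y x = \<zero>\<^bsub>F\<^esub>"
        using 0[of y] T.symmetric[of x y] xT by (simp add: perp_def)
    next
      fix y assume "y \<in> carrier T" "\<And>x. x \<in> carrier T \<Longrightarrow> form T x y = \<zero>\<^bsub>F\<^esub>"
      then show "y = \<zero>\<^bsub>T\<^esub>" using T.nondegenerate[of y] T.symmetric[of y] by simp
    qed
    then show ?thesis by (simp add: A(3))
  qed
  then show "quadratic_space F (subquotient F T I)"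
    by (intro form_epi_quadratic_space[OF U epi])
      (auto simp: coset_of_member[OF U sub] subquotient_def quotient_space_def)
qed

section \<open>Hyperbolic spaces\<close>

lemma (in abelian_monoid) finsum_lessThan_Suc:
  "(\<And>i. i \<le> n \<Longrightarrow> f i \<in> carrier G) \<Longrightarrow>
    (\<Oplus>i\<in>{..<Suc n}. f i) = (\<Oplus>i\<in>{..<n}. f i) \<oplus> f n"
proof -
  assume f: "\<And>i. i \<le> n \<Longrightarrow> f i \<in> carrier G"
  then have "(\<Oplus>i\<in>{..<n}. f i) \<in> carrier G" by (intro finsum_closed) auto
  moreover have "(\<Oplus>i\<in>{..<Suc n}. f i) = f n \<oplus> (\<Oplus>i\<in>{..<n}. f i)"
    unfolding lessThan_Suc using f by (intro finsum_insert) auto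
  ultimately show ?thesis using f[of n] by (simp add: a_comm)
qed

lemma (in abelian_monoid) finsum_lessThan_add:
  "(\<And>i. i < m + n \<Longrightarrow> f i \<in> carrier G) \<Longrightarrow>
    (\<Oplus>i\<in>{..<m + n :: nat}. f i) = (\<Oplus>i\<in>{..<m}. f i) \<oplus> (\<Oplus>i\<in>{..<n}. f (m + i))"
proof (induction n)
  case (Suc n)
  have "(\<Oplus>i\<in>{..<m}. f i) \<in> carrier G" "(\<Oplus>i\<in>{..<n}. f (m + i)) \<in> carrier G"
    using Suc.prems by (auto intro!: finsum_closed)
  then show ?case
    using Suc by (simp add: finsum_lessThan_Suc a_assoc del: lessThan_Suc)
qed (auto intro!: finsum_closed)

lemma module_with_form:
  assumes "module F M" shows "module F (with_form M b)"
proof -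
  interpret M: module F M by (rule assms)
  show ?thesis
  proof (rule module_criteria)
    show "\<forall>v\<in>carrier (with_form M b). \<exists>w\<in>carrier (with_form M b).
        v \<oplus>\<^bsub>with_form M b\<^esub> w = \<zero>\<^bsub>with_form M b\<^esub>"
    proof
      fix v assume "v \<in> carrier (with_form M b)"
      then show "\<exists>w\<in>carrier (with_form M b). v \<oplus>\<^bsub>with_form M b\<^esub> w = \<zero>\<^bsub>with_form M b\<^esub>"
        using M.r_neg by (intro bexI[of _ "\<ominus>\<^bsub>M\<^esub> v"]) auto
    qed
  qed (auto simp: M.is_cring M.a_ac M.smult_assoc1 M.smult_l_distr M.smult_r_distr)
qed

context field
begin

lemma hyperbolic_simps:
  "carrier (hyperbolic_space R n) = ({..<n} \<rightarrow>\<^sub>E carrier R) \<times> ({..<n} \<rightarrow>\<^sub>E carrier R)"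
  "zero (hyperbolic_space R n) = (\<lambda>i\<in>{..<n}. \<zero>, \<lambda>i\<in>{..<n}. \<zero>)"
  "add (hyperbolic_space R n) x y =
    (\<lambda>i\<in>{..<n}. fst x i \<oplus> fst y i, \<lambda>i\<in>{..<n}. snd x i \<oplus> snd y i)"
  "smult (hyperbolic_space R n) c x =
    (\<lambda>i\<in>{..<n}. c \<otimes> fst x i, \<lambda>i\<in>{..<n}. c \<otimes> snd x i)"
  "form (hyperbolic_space R n) x y = (\<Oplus>i\<in>{..<n}. fst x i \<otimes> snd y i \<oplus> snd x i \<otimes> fst y i)"
  by (simp_all add: hyperbolic_space_def direct_sum_def func_space_def)

lemma vectorspace_hyperbolic: "vectorspace R (hyperbolic_space R n)"
  unfolding hyperbolic_space_def vectorspace_def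
  by (intro conjI module_with_form direct_sum_is_module func_space_is_module field_axioms)

lemma hyperbolic_0: "quadratic_space R (hyperbolic_space R 0)"
proof -
  let ?H = "hyperbolic_space R 0"
  interpret H: vectorspace R ?H by (rule vectorspace_hyperbolic)
  have zero: "x \<in> carrier ?H \<longleftrightarrow> x = \<zero>\<^bsub>?H\<^esub>" for x
    by (cases x) (simp add: hyperbolic_simps fun_eq_iff)
  have "W = carrier ?H" if "subspace R W ?H" for W
    using subspaceD(1,2)[OF that] zero by auto
  then have "H.fin_dim"
    unfolding H.fin_dim_iff by (intro exI[of _ "{}"]) simp
  moreover have "bilinear_form R ?H (form ?H)"
    using H.vectorspace_axioms
    by (simp add: bilinear_form_def bilinear_form_axioms_def hyperbolic_simps(5))
  ultimately show ?thesis
    by (simp add: quadratic_space_def quadratic_space_axioms_def hyperbolic_simps(5) zero)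
qed

lemma hyperbolic_1_closed:
  assumes "x \<in> carrier (hyperbolic_space R (Suc 0))"
  shows "fst x 0 \<in> carrier R" "snd x 0 \<in> carrier R"
proof -
  have "fst x \<in> {..<Suc 0} \<rightarrow>\<^sub>E carrier R" "snd x \<in> {..<Suc 0} \<rightarrow>\<^sub>E carrier R"
    using assms unfolding hyperbolic_simps(1) by (simp_all only: mem_Times_iff)
  then show "fst x 0 \<in> carrier R" "snd x 0 \<in> carrier R"
    by (auto dest: PiE_mem[where x = 0])
qed

lemma form_hyperbolic_1:
  assumes "x \<in> carrier (hyperbolic_space R (Suc 0))" "y \<in> carrier (hyperbolic_space R (Suc 0))"
  shows "form (hyperbolic_space R (Suc 0)) x y = fst x 0 \<otimes> snd y 0 \<oplus> snd x 0 \<otimes> fst y 0"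
  unfolding hyperbolic_simps(5) using hyperbolic_1_closed[OF assms(1)] hyperbolic_1_closed[OF assms(2)]
  by (simp add: lessThan_Suc)

lemma hyperbolic_1: "quadratic_space R (hyperbolic_space R (Suc 0))"
proof -
  let ?H = "hyperbolic_space R (Suc 0)"
  interpret H: vectorspace R ?H by (rule vectorspace_hyperbolic)
  define u where "u = (\<lambda>i\<in>{..<Suc 0}. \<one>)"
  define o' where "o' = (\<lambda>i\<in>{..<Suc 0}. \<zero>)"
  have uo: "(u, o') \<in> carrier ?H" "(o', u) \<in> carrier ?H"
    by (auto simp: hyperbolic_simps u_def o'_def)
  note closed = hyperbolic_1_closed and form = form_hyperbolic_1
  have eq: "x = \<zero>\<^bsub>?H\<^esub> \<longleftrightarrow> fst x 0 = \<zero> \<and> snd x 0 = \<zero>" if "x \<in> carrier ?H" for x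
    using that by (cases x) (auto simp: hyperbolic_simps fun_eq_iff PiE_def extensional_def)
  have comp: "fst (x \<oplus>\<^bsub>?H\<^esub> y) 0 = fst x 0 \<oplus> fst y 0" "snd (x \<oplus>\<^bsub>?H\<^esub> y) 0 = snd x 0 \<oplus> snd y 0"
    "fst (c \<odot>\<^bsub>?H\<^esub> x) 0 = c \<otimes> fst x 0" "snd (c \<odot>\<^bsub>?H\<^esub> x) 0 = c \<otimes> snd x 0" for c x y
    by (simp_all add: hyperbolic_simps)
  have bil: "bilinear_form R ?H (form ?H)"
    by (intro bilinear_form.intro H.vectorspace_axioms bilinear_form_axioms.intro)
      (simp_all add: form comp closed H.a_closed H.smult_closed l_distr r_distr a_ac m_ac)
  have "W = carrier ?H" if W: "subspace R W ?H" "{(u, o'), (o', u)} \<subseteq> W" for W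
  proof -
    have "x \<in> W" if x: "x \<in> carrier ?H" for x
    proof -
      have "fst x 0 \<odot>\<^bsub>?H\<^esub> (u, o') \<oplus>\<^bsub>?H\<^esub> snd x 0 \<odot>\<^bsub>?H\<^esub> (o', u) \<in> W"
        using W closed[OF x] by (intro subspaceD(3,4)[OF W(1)]) auto
      also have "fst x 0 \<odot>\<^bsub>?H\<^esub> (u, o') \<oplus>\<^bsub>?H\<^esub> snd x 0 \<odot>\<^bsub>?H\<^esub> (o', u) = x"
        using x closed[OF x] by (cases x)
          (auto simp: hyperbolic_simps u_def o'_def fun_eq_iff PiE_def extensional_def)
      finally show ?thesis .
    qed
    then show ?thesis using subspaceD(1)[OF W(1)] by auto
  qed
  then have "H.fin_dim"
    unfolding H.fin_dim_iff using uo by (intro exI[of _ "{(u, o'), (o', u)}"]) auto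
  moreover have "x = \<zero>\<^bsub>?H\<^esub>"
    if x: "x \<in> carrier ?H" and 0: "\<And>y. y \<in> carrier ?H \<Longrightarrow> form ?H x y = \<zero>" for x
    using 0[OF uo(1)] 0[OF uo(2)] closed[OF x]
    by (simp add: eq[OF x] form[OF x uo(1)] form[OF x uo(2)]) (simp add: u_def o'_def)
  moreover have "form ?H x y = form ?H y x" if "x \<in> carrier ?H" "y \<in> carrier ?H" for x y
    using closed[OF that(1)] closed[OF that(2)] by (simp add: form that m_comm a_comm)
  ultimately show ?thesis
    by (intro quadratic_space.intro quadratic_space_axioms.intro bil) blast+
qed

text \<open>Concatenation of coordinate vectors. Besides comparing sums of hyperbolic spaces it reduces
  the verification that \<open>hyperbolic_space R n\<close> is quadratic to \<open>n = 0\<close> and \<open>n = 1\<close>.\<close>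

lemma form_epi_hyperbolic_add:
  "form_epi R (orth_sum R (hyperbolic_space R m) (hyperbolic_space R n)) (hyperbolic_space R (m + n))
    (\<lambda>(x, y). (\<lambda>i\<in>{..<m + n}. if i < m then fst x i else fst y (i - m),
               \<lambda>i\<in>{..<m + n}. if i < m then snd x i else snd y (i - m)))"
  (is "form_epi R ?S ?H ?f")
proof -
  have "z \<in> ?f ` carrier ?S" if z: "z \<in> carrier ?H" for z
  proof -
    obtain p q where pq: "z = (p, q)" "p \<in> {..<m + n} \<rightarrow>\<^sub>E carrier R" "q \<in> {..<m + n} \<rightarrow>\<^sub>E carrier R"
      using z unfolding hyperbolic_simps(1) by (elim SigmaE)
    let ?l = "\<lambda>g. \<lambda>i\<in>{..<m}. g i" and ?r = "\<lambda>g. \<lambda>i\<in>{..<n}. g (m + i)"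
    have "((?l p, ?l q), (?r p, ?r q)) \<in> carrier ?S"
      using pq(2,3) by (simp add: hyperbolic_simps(1) PiE_iff)
    moreover have "z = ?f ((?l p, ?l q), (?r p, ?r q))"
      using pq by (simp add: fun_eq_iff PiE_iff extensional_def restrict_def)
    ultimately show ?thesis by (rule rev_image_eqI)
  qed
  moreover have "?f z \<in> carrier ?H" if "z \<in> carrier ?S" for z
  proof -
    obtain x1 x2 x3 x4 where "z = ((x1, x2), (x3, x4))" by (metis surj_pair)
    with that show ?thesis by (simp add: hyperbolic_simps(1) PiE_iff)
  qed
  ultimately have "?f ` carrier ?S = carrier ?H" by blast
  moreover have "form ?H (?f x) (?f y) = form ?S x y"
    if "x \<in> carrier ?S" "y \<in> carrier ?S" for x y
  proof -
    obtain x1 x2 x3 x4 y1 y2 y3 y4 where xy: "x = ((x1, x2), (x3, x4))" "y = ((y1, y2), (y3, y4))"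
      by (metis surj_pair)
    have c: "x1 i \<in> carrier R" "x2 i \<in> carrier R" "y1 i \<in> carrier R" "y2 i \<in> carrier R"
      if "i < m" for i
      using \<open>x \<in> carrier ?S\<close> \<open>y \<in> carrier ?S\<close> that by (simp_all add: xy hyperbolic_simps(1) PiE_iff)
    have d: "x3 i \<in> carrier R" "x4 i \<in> carrier R" "y3 i \<in> carrier R" "y4 i \<in> carrier R"
      if "i < n" for i
      using \<open>x \<in> carrier ?S\<close> \<open>y \<in> carrier ?S\<close> that by (simp_all add: xy hyperbolic_simps(1) PiE_iff)
    define G where "G = (\<lambda>i. if i < m then x1 i \<otimes> y2 i \<oplus> x2 i \<otimes> y1 i
      else x3 (i - m) \<otimes> y4 (i - m) \<oplus> x4 (i - m) \<otimes> y3 (i - m))"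
    have G: "G i \<in> carrier R" if "i < m + n" for i
      using that c[of i] d[of "i - m"] by (simp add: G_def)
    have "form ?H (?f x) (?f y) = (\<Oplus>i\<in>{..<m + n}. G i)"
      unfolding hyperbolic_simps(5) xy by (rule finsum_cong') (use G in \<open>auto simp: G_def\<close>)
    also have "\<dots> = (\<Oplus>i\<in>{..<m}. G i) \<oplus> (\<Oplus>i\<in>{..<n}. G (m + i))"
      by (rule finsum_lessThan_add) (rule G)
    also have "(\<Oplus>i\<in>{..<m}. G i) = form (hyperbolic_space R m) (x1, x2) (y1, y2)"
      unfolding hyperbolic_simps(5) by (rule finsum_cong') (use c in \<open>auto simp: G_def\<close>)
    also have "(\<Oplus>i\<in>{..<n}. G (m + i)) = form (hyperbolic_space R n) (x3, x4) (y3, y4)"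
      unfolding hyperbolic_simps(5) by (rule finsum_cong') (use d in \<open>auto simp: G_def\<close>)
    finally show ?thesis by (simp only: xy orth_sum_simps prod.case fst_conv snd_conv)
  qed
  moreover have "?f (x \<oplus>\<^bsub>?S\<^esub> y) = ?f x \<oplus>\<^bsub>?H\<^esub> ?f y" "?f (c \<odot>\<^bsub>?S\<^esub> x) = c \<odot>\<^bsub>?H\<^esub> ?f x"
    "?f \<zero>\<^bsub>?S\<^esub> = \<zero>\<^bsub>?H\<^esub>" for x y c
    by (simp_all add: hyperbolic_simps fun_eq_iff restrict_def split: prod.split) auto
  ultimately show ?thesis
    by (simp add: form_epi_def)
qed

lemma quadratic_space_hyperbolic: "quadratic_space R (hyperbolic_space R n)"
proof (induction n)
  case 0
  show ?case by (rule hyperbolic_0)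
next
  case (Suc n)
  then have "isometric R (orth_sum R (hyperbolic_space R n) (hyperbolic_space R (Suc 0)))
      (hyperbolic_space R (n + Suc 0))"
    using hyperbolic_1 by (intro isometricI[OF _ form_epi_hyperbolic_add] quadratic_space_orth_sum)
  then show ?case by (simp add: isometric_def)
qed

lemma isometric_hyperbolic_add:
  "isometric R (orth_sum R (hyperbolic_space R m) (hyperbolic_space R n)) (hyperbolic_space R (m + n))"
  using quadratic_space_hyperbolic
  by (intro isometricI[OF _ form_epi_hyperbolic_add] quadratic_space_orth_sum)

end

section \<open>Witt equivalence\<close>

lemma quadratic_space_field: "quadratic_space F Q \<Longrightarrow> field F"
  by (simp add: quadratic_space_def bilinear_form_def vectorspace_def)

lemma witt_equivalent_sym: "witt_equivalent F P Q \<Longrightarrow> witt_equivalent F Q P"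
  using isometric_sym unfolding witt_equivalent_def by blast

lemma isometric_orth_sum_hyperbolic:
  assumes P: "quadratic_space F P"
  shows "isometric F (orth_sum F (orth_sum F P (hyperbolic_space F m)) (hyperbolic_space F k))
    (orth_sum F P (hyperbolic_space F (m + k)))"
proof -
  interpret field F by (rule quadratic_space_field[OF P])
  note H = quadratic_space_hyperbolic
  show ?thesis
    using isometric_orth_sum_assoc[OF P H H]
      isometric_orth_sum[OF isometric_refl[OF P] isometric_hyperbolic_add] by (rule isometric_trans)
qed

text \<open>Two Witt equivalences with a common middle term are composed by enlarging both until the
  hyperbolic summands of the middle term agree.\<close>

lemma isometric_add_hyperbolic:
  assumes P: "quadratic_space F P" and Q: "quadratic_space F Q"
    and "isometric F (orth_sum F P (hyperbolic_space F m)) (orth_sum F Q (hyperbolic_space F n))"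
  shows "isometric F (orth_sum F P (hyperbolic_space F (m + k)))
    (orth_sum F Q (hyperbolic_space F (n + k)))"
proof -
  interpret field F by (rule quadratic_space_field[OF P])
  show ?thesis
    using isometric_trans[OF isometric_trans[OF isometric_sym[OF isometric_orth_sum_hyperbolic[OF P]]
      isometric_orth_sum[OF assms(3) isometric_refl[OF quadratic_space_hyperbolic]]]
      isometric_orth_sum_hyperbolic[OF Q]] .
qed

lemma witt_equivalent_trans [trans]:
  assumes PQ: "witt_equivalent F P Q" and QR: "witt_equivalent F Q R"
  shows "witt_equivalent F P R"
proof -
  obtain m n m' n' where
    1: "isometric F (orth_sum F P (hyperbolic_space F m)) (orth_sum F Q (hyperbolic_space F n))" and
    2: "isometric F (orth_sum F Q (hyperbolic_space F m')) (orth_sum F R (hyperbolic_space F n'))"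
    using PQ QR by (auto simp: witt_equivalent_def)
  have P: "quadratic_space F P" and Q: "quadratic_space F Q" and R: "quadratic_space F R"
    using PQ QR by (auto simp: witt_equivalent_def)
  have "isometric F (orth_sum F P (hyperbolic_space F (m + m')))
      (orth_sum F R (hyperbolic_space F (n' + n)))"
    using isometric_trans[OF isometric_add_hyperbolic[OF P Q 1, of m']
      isometric_add_hyperbolic[OF Q R 2, of n, unfolded add.commute[of m' n]]] .
  with P R show ?thesis by (auto simp: witt_equivalent_def)
qed

lemma witt_equivalent_stable:
  assumes P: "quadratic_space F P" and Q: "quadratic_space F Q"
    and "isometric F (orth_sum F P (hyperbolic_space F m)) Q"
  shows "witt_equivalent F P Q"
proof -
  interpret field F by (rule quadratic_space_field[OF P])
  let ?H = "hyperbolic_space F"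
  interpret Q: quadratic_space F Q by (rule Q)
  interpret H: quadratic_space F "?H 0" by (rule hyperbolic_0)
  have "form_epi F Q (orth_sum F Q (?H 0)) (\<lambda>x. (x, \<zero>\<^bsub>?H 0\<^esub>))"
    by (auto simp: form_epi_def image_iff Q.form_closed) (auto simp: hyperbolic_simps fun_eq_iff)
  then have "isometric F Q (orth_sum F Q (?H 0))" by (rule isometricI[OF Q])
  with assms(3) have "isometric F (orth_sum F P (?H m)) (orth_sum F Q (?H 0))"
    by (rule isometric_trans)
  with P Q show ?thesis by (auto simp: witt_equivalent_def)
qed

lemma isometric_imp_witt_equivalent:
  assumes "isometric F P Q" shows "witt_equivalent F P Q"
proof -
  have P: "quadratic_space F P" and Q: "quadratic_space F Q" using assms by (auto simp: isometric_def)
  interpret field F by (rule quadratic_space_field[OF P])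
  show ?thesis
    unfolding witt_equivalent_def
    using P Q isometric_orth_sum[OF assms isometric_refl[OF hyperbolic_0]] by blast
qed

lemma witt_equivalent_orth_sum:
  assumes "witt_equivalent F P Q" "witt_equivalent F P' Q'"
  shows "witt_equivalent F (orth_sum F P P') (orth_sum F Q Q')"
proof -
  let ?H = "hyperbolic_space F"
  obtain m n m' n' where
    1: "isometric F (orth_sum F P (?H m)) (orth_sum F Q (?H n))" and
    2: "isometric F (orth_sum F P' (?H m')) (orth_sum F Q' (?H n'))"
    using assms by (auto simp: witt_equivalent_def)
  have P: "quadratic_space F P" and Q: "quadratic_space F Q"
    and P': "quadratic_space F P'" and Q': "quadratic_space F Q'"
    using assms by (auto simp: witt_equivalent_def)
  interpret field F by (rule quadratic_space_field[OF P])
  note H = quadratic_space_hyperbolic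
  have PP: "quadratic_space F (orth_sum F P P')" and QQ: "quadratic_space F (orth_sum F Q Q')"
    by (intro quadratic_space_orth_sum P P' Q Q')+
  have "isometric F (orth_sum F (orth_sum F P P') (orth_sum F (?H m) (?H m')))
      (orth_sum F (orth_sum F Q Q') (orth_sum F (?H n) (?H n')))"
    using isometric_trans[OF isometric_orth_sum_swap[OF P P' H H] isometric_trans[OF
      isometric_orth_sum[OF 1 2] isometric_orth_sum_swap[OF Q H Q' H]]] .
  then have "isometric F (orth_sum F (orth_sum F P P') (?H (m + m')))
      (orth_sum F (orth_sum F Q Q') (?H (n + n')))"
    using isometric_trans[OF isometric_sym[OF isometric_orth_sum[OF isometric_refl[OF PP]
      isometric_hyperbolic_add]] isometric_trans[OF _ isometric_orth_sum[OF isometric_refl[OF QQ]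
      isometric_hyperbolic_add]]] by blast
  with PP QQ show ?thesis by (auto simp: witt_equivalent_def)
qed

section \<open>Witt classes\<close>

text \<open>By non-degeneracy a vector is determined by its products with finitely many generators.
  This embeds \<open>Q\<close> into the type of functions, and the structure is transported along the
  embedding.\<close>

lemma exists_isometric_on_functions:
  fixes F :: "('a, 'd) ring_scheme" and Q :: "('a, 'b) form_space"
  assumes Q: "quadratic_space F Q"
  shows "\<exists>P :: ('a, nat \<Rightarrow> 'a) form_space. isometric F P Q"
proof -
  interpret Q: quadratic_space F Q by (rule Q)
  obtain A where A: "finite A" "A \<subseteq> carrier Q"
      "\<And>W. \<lbrakk>subspace F W Q; A \<subseteq> W\<rbrakk> \<Longrightarrow> W = carrier Q"
    using Q.fin_dim unfolding Q.fin_dim_iff by auto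
  obtain as where as: "set as = A" using A(1) finite_list by auto
  define j where "j = (\<lambda>x i. if i < length as then form Q x (as ! i) else \<zero>\<^bsub>F\<^esub>)"
  have inj: "inj_on j (carrier Q)"
  proof (rule inj_onI)
    fix x y assume x: "x \<in> carrier Q" and y: "y \<in> carrier Q" and eq: "j x = j y"
    let ?W = "{z \<in> carrier Q. form Q x z = form Q y z}"
    have "form Q x a = form Q y a" if "a \<in> A" for a
    proof -
      obtain i where "i < length as" "as ! i = a" using \<open>a \<in> A\<close> as by (metis in_set_conv_nth)
      then show ?thesis using fun_cong[OF eq, of i] by (simp add: j_def)
    qed
    moreover have "subspace F ?W Q"
      using x y by (intro Q.subspaceI) (auto simp: Q.form_add_right Q.form_smult_right)
    ultimately have W: "?W = carrier Q" by (intro A(3)) (use A(2) in auto)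
    have "x \<ominus>\<^bsub>Q\<^esub> y = \<zero>\<^bsub>Q\<^esub>"
    proof (rule Q.nondegenerate)
      fix z assume z: "z \<in> carrier Q"
      with W have "form Q x z = form Q y z" by blast
      with x y z show "form Q (x \<ominus>\<^bsub>Q\<^esub> y) z = \<zero>\<^bsub>F\<^esub>"
        by (simp add: Q.form_minus_left Q.form_closed)
    qed (use x y in simp)
    with x y show "x = y" by simp
  qed
  define k where "k = the_inv_into (carrier Q) j"
  have k: "k (j x) = x" if "x \<in> carrier Q" for x
    unfolding k_def by (rule the_inv_into_f_f[OF inj that])
  define P :: "('a, nat \<Rightarrow> 'a) form_space" where "P = \<lparr>carrier = j ` carrier Q,
      mult = \<lambda>x y. x, one = j \<zero>\<^bsub>Q\<^esub>, zero = j \<zero>\<^bsub>Q\<^esub>, add = \<lambda>x y. j (k x \<oplus>\<^bsub>Q\<^esub> k y),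
      smult = \<lambda>c x. j (c \<odot>\<^bsub>Q\<^esub> k x), form = \<lambda>x y. form Q (k x) (k y)\<rparr>"
  have "form_epi F Q P j"
    by (simp add: form_epi_def P_def k)
  then show ?thesis using isometric_sym[OF isometricI[OF Q]] by blast
qed

text \<open>The operation of the Witt group ranges over representatives on functions. That the
  product contains every space equivalent to \<open>T\<close> requires \<open>P\<close> and \<open>Q\<close> to have such
  representatives.\<close>

lemma witt_class_mult:
  assumes T: "witt_equivalent F (orth_sum F P Q) T"
    and P: "quadratic_space F P" and Q: "quadratic_space F Q"
  shows "witt_class F P \<otimes>\<^bsub>witt_group F\<^esub> witt_class F Q = witt_class F T"
proof -
  obtain P' :: "('a, nat \<Rightarrow> 'a) form_space" where P': "witt_equivalent F P' P"
    using exists_isometric_on_functions[OF P] isometric_imp_witt_equivalent by blast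
  obtain Q' :: "('a, nat \<Rightarrow> 'a) form_space" where Q': "witt_equivalent F Q' Q"
    using exists_isometric_on_functions[OF Q] isometric_imp_witt_equivalent by blast
  have to_T: "witt_equivalent F (orth_sum F X Y) T"
    if "witt_equivalent F X P" "witt_equivalent F Y Q" for X Y :: "('a, nat \<Rightarrow> 'a) form_space"
    using witt_equivalent_trans[OF witt_equivalent_orth_sum[OF that] T] .
  have "witt_equivalent F X T \<longleftrightarrow>
      (\<exists>A \<in> witt_class F P. \<exists>B \<in> witt_class F Q. witt_equivalent F X (orth_sum F A B))"
    for X :: "('a, nat \<Rightarrow> 'a) form_space"
  proof
    assume "witt_equivalent F X T"
    then have "witt_equivalent F X (orth_sum F P' Q')"
      using witt_equivalent_trans witt_equivalent_sym[OF to_T[OF P' Q']] by blast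
    with P' Q' show "\<exists>A \<in> witt_class F P. \<exists>B \<in> witt_class F Q. witt_equivalent F X (orth_sum F A B)"
      by (auto simp: witt_class_def)
  qed (use witt_equivalent_trans[OF _ to_T] in \<open>auto simp: witt_class_def\<close>)
  then show ?thesis
    by (simp add: witt_group_def witt_class_def)
qed

section \<open>Witt equivalence of a space and its subquotients\<close>

text \<open>Non-degeneracy gives \<open>h\<close> with \<open>form T e h = 1\<close>. Subtracting half of \<open>form T h h\<close> times
  \<open>e\<close> from \<open>h\<close> makes it isotropic; this is where characteristic two is excluded.\<close>

lemma quadratic_space_hyperbolic_partner:
  assumes T: "quadratic_space F T" and char: "\<one>\<^bsub>F\<^esub> \<oplus>\<^bsub>F\<^esub> \<one>\<^bsub>F\<^esub> \<noteq> \<zero>\<^bsub>F\<^esub>"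
    and e: "e \<in> carrier T" "e \<noteq> \<zero>\<^bsub>T\<^esub>" "form T e e = \<zero>\<^bsub>F\<^esub>"
  obtains f where "f \<in> carrier T" "form T e f = \<one>\<^bsub>F\<^esub>" "form T f f = \<zero>\<^bsub>F\<^esub>"
proof -
  interpret T: quadratic_space F T by (rule T)
  obtain g where g: "g \<in> carrier T" "form T e g \<noteq> \<zero>\<^bsub>F\<^esub>"
    using T.nondegenerate[of e] e by auto
  have u: "form T e g \<in> Units F" using g e(1) by (simp add: T.field_Units T.form_closed)
  define h where "h = inv\<^bsub>F\<^esub> (form T e g) \<odot>\<^bsub>T\<^esub> g"
  have h: "h \<in> carrier T" using g u by (simp add: h_def)
  have eh: "form T e h = \<one>\<^bsub>F\<^esub>" using g e(1) u by (simp add: h_def T.form_smult_right)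
  then have he: "form T h e = \<one>\<^bsub>F\<^esub>" using T.symmetric[of e h] e(1) h by simp
  let ?two = "\<one>\<^bsub>F\<^esub> \<oplus>\<^bsub>F\<^esub> \<one>\<^bsub>F\<^esub>"
  have two: "?two \<in> Units F" using char by (simp add: T.field_Units)
  define q where "q = form T h h"
  have q: "q \<in> carrier F" using h by (simp add: q_def T.form_closed)
  define c where "c = inv\<^bsub>F\<^esub> ?two \<otimes>\<^bsub>F\<^esub> q"
  have c: "c \<in> carrier F" using two q by (simp add: c_def)
  have "c \<oplus>\<^bsub>F\<^esub> c = ?two \<otimes>\<^bsub>F\<^esub> c" using c by (simp add: T.l_distr)
  also have "\<dots> = q" using two q by (simp add: c_def T.m_assoc[symmetric])
  finally have cc: "c \<oplus>\<^bsub>F\<^esub> c = q" .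
  define f where "f = h \<ominus>\<^bsub>T\<^esub> c \<odot>\<^bsub>T\<^esub> e"
  have "f \<in> carrier T" using h c e(1) by (simp add: f_def)
  moreover have "form T e f = \<one>\<^bsub>F\<^esub>"
    using h c e by (simp add: f_def T.form_minus_right T.form_smult_right eh T.R.minus_zero_right)
  moreover have "form T f f = q \<ominus>\<^bsub>F\<^esub> c \<ominus>\<^bsub>F\<^esub> c"
    using h c e by (simp add: f_def T.form_minus_left T.form_minus_right T.form_smult_left
        T.form_smult_right eh he T.R.minus_zero_right flip: q_def)
  then have "form T f f = q \<ominus>\<^bsub>F\<^esub> (c \<oplus>\<^bsub>F\<^esub> c)"
    using c q by (simp add: a_minus_def T.R.minus_add T.R.a_assoc)
  then have "form T f f = \<zero>\<^bsub>F\<^esub>" using q by (simp add: cc)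
  ultimately show thesis using that by blast
qed

text \<open>A vector \<open>x\<close> minus \<open>form T x f \<odot> e \<oplus> form T x e \<odot> f\<close> is orthogonal to \<open>e\<close> and \<open>f\<close>. So \<open>T\<close> is the
  orthogonal sum of the plane spanned by \<open>e\<close> and \<open>f\<close> and of its complement.\<close>

lemma hyperbolic_plane_splits:
  assumes T: "quadratic_space F T"
    and e: "e \<in> carrier T" "form T e e = \<zero>\<^bsub>F\<^esub>" and f: "f \<in> carrier T" "form T f f = \<zero>\<^bsub>F\<^esub>"
    and ef: "form T e f = \<one>\<^bsub>F\<^esub>"
  shows "quadratic_space F (T\<lparr>carrier := perp F T (form T) {e, f}\<rparr>)" (is "quadratic_space F ?T0")
    and "witt_equivalent F (T\<lparr>carrier := perp F T (form T) {e, f}\<rparr>) T"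
proof -
  interpret T: quadratic_space F T by (rule T)
  let ?W = "perp F T (form T) {e, f}" and ?H = "hyperbolic_space F (Suc 0)"
  interpret H: quadratic_space F ?H by (rule T.hyperbolic_1)
  have fe: "form T f e = \<one>\<^bsub>F\<^esub>" using T.symmetric[of e f] e f ef by simp
  have W: "subspace F ?W T" using e f by (intro T.perp_subspace) auto
  note WD = subspaceD[OF W]
  have sym: "symmetric_space F ?T0"
    by (rule symmetric_space_subspace[OF quadratic_imp_symmetric[OF T] W])
  define comb where "comb = (\<lambda>t a b. t \<oplus>\<^bsub>T\<^esub> (a \<odot>\<^bsub>T\<^esub> e \<oplus>\<^bsub>T\<^esub> b \<odot>\<^bsub>T\<^esub> f))"
  have W0: "t \<in> carrier T" "form T t e = \<zero>\<^bsub>F\<^esub>" "form T t f = \<zero>\<^bsub>F\<^esub>"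
      "form T e t = \<zero>\<^bsub>F\<^esub>" "form T f t = \<zero>\<^bsub>F\<^esub>" if "t \<in> ?W" for t
    using that e f T.symmetric[of t] by (auto simp: perp_def)
  have decomp: "\<exists>t\<in>?W. x = comb t (form T x f) (form T x e)" if x: "x \<in> carrier T" for x
  proof
    let ?p = "form T x f \<odot>\<^bsub>T\<^esub> e \<oplus>\<^bsub>T\<^esub> form T x e \<odot>\<^bsub>T\<^esub> f"
    have c: "form T x f \<in> carrier F" "form T x e \<in> carrier F"
      using x e f by (simp_all add: T.form_closed)
    show "x \<ominus>\<^bsub>T\<^esub> ?p \<in> ?W"
      using x e f ef fe c
      by (simp add: perp_def T.form_minus_left T.form_add_left T.form_smult_left)
    show "x = comb (x \<ominus>\<^bsub>T\<^esub> ?p) (form T x f) (form T x e)"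
      using x e f c by (simp add: comb_def a_minus_def T.a_assoc T.l_neg)
  qed
  show T0: "quadratic_space F ?T0"
    unfolding quadratic_space_iff
  proof (intro conjI sym ballI impI)
    fix x assume x: "x \<in> carrier ?T0" and 0: "\<forall>y\<in>carrier ?T0. form ?T0 x y = \<zero>\<^bsub>F\<^esub>"
    then have xW: "x \<in> ?W" by simp
    have "x = \<zero>\<^bsub>T\<^esub>"
    proof (rule T.nondegenerate)
      fix y assume y: "y \<in> carrier T"
      then obtain t where t: "t \<in> ?W" "y = comb t (form T y f) (form T y e)"
        using decomp by blast
      have "form T x t = \<zero>\<^bsub>F\<^esub>" using 0 t(1) by simp
      then show "form T x y = \<zero>\<^bsub>F\<^esub>"
        using W0(1-3)[OF xW] W0(1)[OF t(1)] T.form_closed[OF y e(1)] T.form_closed[OF y f(1)] e f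
        by (subst t(2)) (simp add: comb_def T.form_add_right T.form_smult_right)
    qed (use W0[OF xW] in simp)
    then show "x = \<zero>\<^bsub>?T0\<^esub>" by simp
  qed
  let ?g = "\<lambda>(t, h). comb t (fst h 0) (snd h 0)"
  note closed = T.hyperbolic_1_closed and form_H = T.form_hyperbolic_1
  have "comb t a b \<in> ?g ` carrier (orth_sum F ?T0 ?H)"
    if "t \<in> ?W" "a \<in> carrier F" "b \<in> carrier F" for t a b
    by (rule image_eqI[of _ _ "(t, (\<lambda>i\<in>{..<Suc 0}. a, \<lambda>i\<in>{..<Suc 0}. b))"])
      (use that in \<open>simp_all add: T.hyperbolic_simps(1) PiE_iff\<close>)
  note comb_image = this
  have "x \<in> ?g ` carrier (orth_sum F ?T0 ?H)" if x: "x \<in> carrier T" for x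
  proof -
    obtain t where t: "t \<in> ?W" "x = comb t (form T x f) (form T x e)" using decomp[OF x] by blast
    show ?thesis
      using comb_image[OF t(1) T.form_closed[OF x f(1)] T.form_closed[OF x e(1)]] t(2) by simp
  qed
  moreover have "?g z \<in> carrier T" if "z \<in> carrier (orth_sum F ?T0 ?H)" for z
    using that closed W0(1) e f by (auto simp: comb_def)
  ultimately have "?g ` carrier (orth_sum F ?T0 ?H) = carrier T" by blast
  moreover have "comb (s \<oplus>\<^bsub>T\<^esub> t) (a \<oplus>\<^bsub>F\<^esub> a') (b \<oplus>\<^bsub>F\<^esub> b') = comb s a b \<oplus>\<^bsub>T\<^esub> comb t a' b'"
    if "s \<in> ?W" "t \<in> ?W" "a \<in> carrier F" "a' \<in> carrier F" "b \<in> carrier F" "b' \<in> carrier F"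
    for s t a a' b b'
    using that W0(1)[of s] W0(1)[of t] e f by (simp add: comb_def T.smult_l_distr T.a_ac)
  moreover have "comb (c \<odot>\<^bsub>T\<^esub> s) (c \<otimes>\<^bsub>F\<^esub> a) (c \<otimes>\<^bsub>F\<^esub> b) = c \<odot>\<^bsub>T\<^esub> comb s a b"
    if "s \<in> ?W" "a \<in> carrier F" "b \<in> carrier F" "c \<in> carrier F" for s a b c
    using that W0(1)[of s] e f by (simp add: comb_def T.smult_assoc1 T.smult_r_distr)
  moreover have "form T (comb s a b) (comb t a' b') = form T s t \<oplus>\<^bsub>F\<^esub> (a \<otimes>\<^bsub>F\<^esub> b' \<oplus>\<^bsub>F\<^esub> b \<otimes>\<^bsub>F\<^esub> a')"
    if "s \<in> ?W" "t \<in> ?W" "a \<in> carrier F" "a' \<in> carrier F" "b \<in> carrier F" "b' \<in> carrier F"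
    for s t a a' b b'
    using that(3-) W0[OF that(1)] W0[OF that(2)] e f ef fe
    by (simp add: comb_def T.form_add_left T.form_add_right T.form_smult_left T.form_smult_right
        T.form_closed T.m_comm T.R.a_comm)
  ultimately have "form_epi F (orth_sum F ?T0 ?H) T ?g"
    using closed WD(2) e f
    by (auto simp: form_epi_def T.hyperbolic_simps(2-4) form_H) (simp add: comb_def)
  then have "isometric F (orth_sum F ?T0 ?H) T"
    using T0 T.hyperbolic_1 by (intro isometricI quadratic_space_orth_sum)
  then show "witt_equivalent F ?T0 T"
    by (rule witt_equivalent_stable[OF T0 T])
qed

text \<open>Induction on the list \<open>as\<close>, whose members span an isotropic subspace \<open>I\<close>, with \<open>Q\<close> isometric
  to \<open>I\<^sup>\<bottom>/I\<close>. If its head \<open>e\<close> is non-zero, a hyperbolic plane through \<open>e\<close> splits off. The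
  rest of the list, projected to the complement \<open>T0\<close> of the plane, takes its place: its orthogonal
  space in \<open>T0\<close> still maps onto \<open>Q\<close>, because \<open>g\<close> kills \<open>e\<close>, and projecting changes a vector of
  \<open>I\<^sup>\<bottom>\<close> only by a multiple of \<open>e\<close>. Describing \<open>I\<close> by a list of vectors, which may be dependent, avoids dimension
  counts.\<close>

lemma witt_equivalent_coisotropic_quotient:
  assumes char: "\<one>\<^bsub>F\<^esub> \<oplus>\<^bsub>F\<^esub> \<one>\<^bsub>F\<^esub> \<noteq> \<zero>\<^bsub>F\<^esub>" and Q: "quadratic_space F Q"
    and "quadratic_space F T" "set as \<subseteq> carrier T"
    and "\<And>a b. \<lbrakk>a \<in> set as; b \<in> set as\<rbrakk> \<Longrightarrow> form T a b = \<zero>\<^bsub>F\<^esub>"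
    and "form_epi F (T\<lparr>carrier := perp F T (form T) (set as)\<rparr>) Q g"
  shows "witt_equivalent F T Q"
  using assms(3-)
proof (induction "length as" arbitrary: as T)
  case 0
  have "T\<lparr>carrier := perp F T (form T) (set [])\<rparr> = T" by (simp add: perp_def)
  with 0 show ?case
    by (metis isometricI isometric_imp_witt_equivalent length_0_conv)
next
  case (Suc n as')
  obtain e as where as': "as' = e # as" and n: "n = length as"
    using Suc.hyps(2) by (cases as') auto
  note prems = Suc.prems[unfolded as']
  note T = prems(1) and g = prems(4)
  interpret T: quadratic_space F T by (rule T)
  interpret Q: quadratic_space F Q by (rule Q)
  have e: "e \<in> carrier T" "form T e e = \<zero>\<^bsub>F\<^esub>" and as: "set as \<subseteq> carrier T"
    and e_as: "\<And>a. a \<in> set as \<Longrightarrow> form T a e = \<zero>\<^bsub>F\<^esub>"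
    using prems by auto
  let ?U = "perp F T (form T) (set (e # as))"
  show ?case
  proof (cases "e = \<zero>\<^bsub>T\<^esub>")
    case True
    then have "?U = perp F T (form T) (set as)" by (auto simp: perp_def)
    then show ?thesis using Suc.hyps(1)[OF n T as] prems(3,4) by simp
  next
    case False
    obtain f where f: "f \<in> carrier T" "form T e f = \<one>\<^bsub>F\<^esub>" "form T f f = \<zero>\<^bsub>F\<^esub>"
      using quadratic_space_hyperbolic_partner[OF T char e(1) False e(2)] .
    let ?W = "perp F T (form T) {e, f}"
    let ?T0 = "T\<lparr>carrier := ?W\<rparr>"
    have T0: "quadratic_space F ?T0" and equiv: "witt_equivalent F ?T0 T"
      using hyperbolic_plane_splits[OF T e f(1,3,2)] by auto
    have W: "subspace F ?W T" using e f by (intro T.perp_subspace) auto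
    have U: "subspace F ?U T" using prems(2) by (intro T.perp_subspace)
    have U_T: "x \<in> carrier T" if "x \<in> ?U" for x using that by (simp add: perp_def)
    \<comment> \<open>The component orthogonal to \<open>e\<close> and \<open>f\<close> of a vector orthogonal to \<open>e\<close>.\<close>
    define p where "p = (\<lambda>x. x \<ominus>\<^bsub>T\<^esub> form T x f \<odot>\<^bsub>T\<^esub> e)"
    have p: "p x \<in> ?W" if "x \<in> carrier T" "form T x e = \<zero>\<^bsub>F\<^esub>" for x
      using that e f by (simp add: p_def perp_def T.form_minus_left T.form_smult_left T.form_closed)
    have form_p: "form T y (p x) = form T y x" if "x \<in> carrier T" "y \<in> carrier T" "form T y e = \<zero>\<^bsub>F\<^esub>" for x y
      using that e f
      by (simp add: p_def T.form_minus_right T.form_smult_right T.form_closed T.R.minus_zero_right)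
    have as0: "set (map p as) \<subseteq> carrier ?T0"
      using p e_as as by auto
    have orth0: "form ?T0 a b = \<zero>\<^bsub>F\<^esub>" if ab: "a \<in> set (map p as)" "b \<in> set (map p as)" for a b
    proof -
      obtain x y where xy: "x \<in> set as" "y \<in> set as" "a = p x" "b = p y"
        using ab by auto
      have "p x \<in> ?W" using p xy e_as as by auto
      then have px: "p x \<in> carrier T" "form T (p x) e = \<zero>\<^bsub>F\<^esub>" by (auto simp: perp_def)
      have "form T a b = form T (p x) y"
        using form_p[of y "p x"] px xy as by auto
      also have "\<dots> = form T y (p x)" using px xy as by (intro T.symmetric) auto
      also have "\<dots> = form T y x" using form_p[of x y] xy as e_as by auto
      also have "\<dots> = \<zero>\<^bsub>F\<^esub>" using xy prems(3) by simp
      finally show ?thesis by simp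
    qed
    have U0: "perp F ?T0 (form ?T0) (set (map p as)) = ?U \<inter> ?W"
      using form_p as by (auto simp: perp_def subset_iff)
    have gp: "g (p x) = g x" if x: "x \<in> ?U" for x
    proof -
      have eU: "e \<in> ?U" using e(1) prems(3) by (auto simp: perp_def)
      have "form T e y = \<zero>\<^bsub>F\<^esub>" if "y \<in> ?U" for y
        using that T.symmetric[OF e(1), of y] by (auto simp: perp_def)
      then have ge: "g e = \<zero>\<^bsub>Q\<^esub>"
        using form_epi_quadratic_zero_iff[OF Q g, of e] eU by simp
      let ?c = "\<ominus>\<^bsub>F\<^esub> form T x f"
      have c: "?c \<in> carrier F" using U_T[OF x] f(1) by (simp add: T.form_closed)
      have "p x = x \<oplus>\<^bsub>T\<^esub> ?c \<odot>\<^bsub>T\<^esub> e"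
        using U_T[OF x] f(1) e(1) by (simp add: p_def a_minus_def T.form_closed T.smult_l_minus)
      moreover have "g (x \<oplus>\<^bsub>T\<^esub> ?c \<odot>\<^bsub>T\<^esub> e) = g x \<oplus>\<^bsub>Q\<^esub> ?c \<odot>\<^bsub>Q\<^esub> g e"
        using form_epiD(4,5)[OF g] x eU c subspaceD(4)[OF U c eU] by simp
      moreover have "g x \<in> carrier Q" using form_epiD(3)[OF g] x by simp
      ultimately show ?thesis using c by (simp add: ge)
    qed
    have pU: "p x \<in> ?U \<inter> ?W" if x: "x \<in> ?U" for x
    proof
      show "p x \<in> ?W" by (rule p) (use x in \<open>auto simp: perp_def\<close>)
      have eU: "e \<in> ?U" using e(1) prems(3) by (auto simp: perp_def)
      show "p x \<in> ?U"
        unfolding p_def using U_T[OF x] f(1)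
        by (intro T.subspace_minus[OF U x] subspaceD(4)[OF U _ eU] T.form_closed)
    qed
    have "g ` (?U \<inter> ?W) = carrier Q"
    proof
      show "g ` (?U \<inter> ?W) \<subseteq> carrier Q" using form_epiD(3)[OF g] by auto
      have "carrier Q = g ` ?U" using form_epiD(1)[OF g] by simp
      then show "carrier Q \<subseteq> g ` (?U \<inter> ?W)"
        using imageI[OF pU, of _ g] gp by auto
    qed
    moreover have "\<zero>\<^bsub>T\<^esub> \<in> ?U" by (rule subspaceD(2)[OF U])
    ultimately have "form_epi F (?T0\<lparr>carrier := perp F ?T0 (form ?T0) (set (map p as))\<rparr>) Q g"
      unfolding U0 using form_epiD[OF g] by (simp add: form_epi_def)
    from Suc.hyps(1)[OF _ T0 as0 orth0 this] n equiv show ?thesis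
      using witt_equivalent_sym witt_equivalent_trans by (metis length_map)
  qed
qed

lemma witt_equivalent_subquotient:
  assumes char: "\<one>\<^bsub>F\<^esub> \<oplus>\<^bsub>F\<^esub> \<one>\<^bsub>F\<^esub> \<noteq> \<zero>\<^bsub>F\<^esub>" and T: "quadratic_space F T" and I: "isotropic F T I"
  shows "witt_equivalent F T (subquotient F T I)"
proof -
  interpret T: quadratic_space F T by (rule T)
  have I_sub: "subspace F I T" using I by (simp add: isotropic_def)
  obtain A where A: "finite A" "A \<subseteq> I" "T.span A = I"
    using T.subspace_finitely_spanned[OF T.fin_dim I_sub] .
  obtain as where as: "set as = A" using A(1) finite_list by auto
  have AT: "A \<subseteq> carrier T" using A(2) subspaceD(1)[OF I_sub] by auto
  show ?thesis
  proof (rule witt_equivalent_coisotropic_quotient[OF char quadratic_space_subquotient(2)[OF T I] T])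
    show "set as \<subseteq> carrier T" using as AT by simp
    show "form T a b = \<zero>\<^bsub>F\<^esub>" if "a \<in> set as" "b \<in> set as" for a b
      using that as A(2) I by (auto simp: isotropic_def)
    show "form_epi F (T\<lparr>carrier := perp F T (form T) (set as)\<rparr>) (subquotient F T I)
      (\<lambda>x. I +>\<^bsub>T\<lparr>carrier := perp F T (form T) I\<rparr>\<^esub> x)"
      using quadratic_space_subquotient(1)[OF T I] T.perp_span[OF AT] A(3) as by simp
  qed
qed

section \<open>The form of a cyclic sequence of isotropic subspaces\<close>

lemma external_sum_simps:
  "carrier (external_sum V ms) = (\<Pi>\<^sub>E i\<in>{..<length ms}. ms ! i)"
  "\<zero>\<^bsub>external_sum V ms\<^esub> = (\<lambda>i\<in>{..<length ms}. \<zero>\<^bsub>V\<^esub>)"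
  "v \<oplus>\<^bsub>external_sum V ms\<^esub> w = (\<lambda>i\<in>{..<length ms}. v i \<oplus>\<^bsub>V\<^esub> w i)"
  "c \<odot>\<^bsub>external_sum V ms\<^esub> w = (\<lambda>i\<in>{..<length ms}. c \<odot>\<^bsub>V\<^esub> w i)"
  by (simp_all add: external_sum_def Let_def)

lemma maslov_presentation_simps:
  "carrier (maslov_presentation F V B ms) = {w \<in> (\<Pi>\<^sub>E i\<in>{..<length ms}. ms ! i).
      (\<Oplus>\<^bsub>V\<^esub>i\<in>{..<length ms}. w i) = \<zero>\<^bsub>V\<^esub>}"
  "\<zero>\<^bsub>maslov_presentation F V B ms\<^esub> = (\<lambda>i\<in>{..<length ms}. \<zero>\<^bsub>V\<^esub>)"
  "v \<oplus>\<^bsub>maslov_presentation F V B ms\<^esub> w = (\<lambda>i\<in>{..<length ms}. v i \<oplus>\<^bsub>V\<^esub> w i)"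
  "c \<odot>\<^bsub>maslov_presentation F V B ms\<^esub> w = (\<lambda>i\<in>{..<length ms}. c \<odot>\<^bsub>V\<^esub> w i)"
  "form (maslov_presentation F V B ms) = maslov_form F V B (length ms)"
  by (simp_all add: maslov_presentation_def external_sum_simps)

context vectorspace
begin

lemma module_external_sum:
  assumes ms: "\<And>L. L \<in> set ms \<Longrightarrow> subspace K L V"
  shows "module K (external_sum V ms)"
proof -
  let ?E = "external_sum V ms"
  have sub: "subspace K (ms ! i) V" if "i < length ms" for i using ms that by simp
  have comp: "v i \<in> carrier V" "v i \<in> ms ! i" if "v \<in> carrier ?E" "i < length ms" for v i
    using that subspaceD(1)[OF sub[OF that(2)]] by (auto simp: external_sum_simps(1) PiE_iff)
  have ext: "v = w \<longleftrightarrow> (\<forall>i<length ms. v i = w i)" if "v \<in> carrier ?E" "w \<in> carrier ?E" for v w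
    using PiE_ext[OF that[unfolded external_sum_simps(1)]] by auto
  have add: "v \<oplus>\<^bsub>?E\<^esub> w \<in> carrier ?E" if "v \<in> carrier ?E" "w \<in> carrier ?E" for v w
    unfolding external_sum_simps(1,3)
    using subspaceD(3)[OF sub] comp(2)[OF that(1)] comp(2)[OF that(2)] by (simp add: PiE_iff)
  have smult: "c \<odot>\<^bsub>?E\<^esub> v \<in> carrier ?E" if "v \<in> carrier ?E" "c \<in> carrier K" for v c
    unfolding external_sum_simps(1,4)
    using subspaceD(4)[OF sub] comp(2)[OF that(1)] that(2) by (simp add: PiE_iff)
  have z: "\<zero>\<^bsub>?E\<^esub> \<in> carrier ?E"
    using subspaceD(2)[OF sub] by (simp add: external_sum_simps PiE_iff)
  have neg: "(\<lambda>i\<in>{..<length ms}. \<ominus>\<^bsub>V\<^esub> v i) \<in> carrier ?E" if "v \<in> carrier ?E" for v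
    using subspace_uminus[OF sub comp(2)[OF that]]
    by (simp add: external_sum_simps(1) PiE_iff)
  note ops = external_sum_simps(2-4)
  have at: "(v \<oplus>\<^bsub>?E\<^esub> w) i = v i \<oplus>\<^bsub>V\<^esub> w i" "(c \<odot>\<^bsub>?E\<^esub> v) i = c \<odot>\<^bsub>V\<^esub> v i" "\<zero>\<^bsub>?E\<^esub> i = \<zero>\<^bsub>V\<^esub>"
    if "i < length ms" for v w c i using that by (simp_all add: ops)
  show ?thesis
  proof (rule module_criteria)
    show "\<forall>v\<in>carrier ?E. \<exists>w\<in>carrier ?E. v \<oplus>\<^bsub>?E\<^esub> w = \<zero>\<^bsub>?E\<^esub>"
    proof
      fix v assume v: "v \<in> carrier ?E"
      show "\<exists>w\<in>carrier ?E. v \<oplus>\<^bsub>?E\<^esub> w = \<zero>\<^bsub>?E\<^esub>"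
      proof (rule bexI[OF _ neg[OF v]])
        show "v \<oplus>\<^bsub>?E\<^esub> (\<lambda>i\<in>{..<length ms}. \<ominus>\<^bsub>V\<^esub> v i) = \<zero>\<^bsub>?E\<^esub>"
          by (simp add: ext[OF add[OF v neg[OF v]] z] at r_neg comp[OF v])
      qed
    qed
  qed (simp_all add: is_cring add smult ext at comp z a_ac smult_assoc1 smult_l_distr smult_r_distr)
qed

text \<open>The vectors supported at a single index generate, and the ones supported at \<open>i\<close> form a copy of
  the finitely generated \<open>ms ! i\<close>.\<close>

lemma fin_dim_external_sum:
  assumes ms: "\<And>L. L \<in> set ms \<Longrightarrow> subspace K L V" and fd: fin_dim
  shows "vectorspace.fin_dim K (external_sum V ms)"
proof -
  let ?E = "external_sum V ms" and ?r = "length ms"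
  interpret E: vectorspace K ?E
    using module_external_sum[OF ms] by (simp add: vectorspace_def field_axioms)
  have sub: "subspace K (ms ! i) V" if "i < ?r" for i using ms that by simp
  have "\<exists>A. finite A \<and> A \<subseteq> ms ! i \<and> span A = ms ! i" if "i < ?r" for i
    using subspace_finitely_spanned[OF fd sub[OF that]] by metis
  then obtain A where A: "\<And>i. i < ?r \<Longrightarrow> finite (A i) \<and> A i \<subseteq> ms ! i \<and> span (A i) = ms ! i"
    by metis
  define single where "single = (\<lambda>i x. \<lambda>j\<in>{..<?r}. if j = i then x else \<zero>\<^bsub>V\<^esub>)"
  let ?G = "\<Union>i<?r. single i ` A i"
  have "W = carrier ?E" if W: "subspace K W ?E" "?G \<subseteq> W" for W
  proof -
    note WD = subspaceD[OF W(1)]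
    have single: "single i x \<in> W" if i: "i < ?r" and x: "x \<in> ms ! i" for i x
    proof -
      have sadd: "single i (y \<oplus>\<^bsub>V\<^esub> z) = single i y \<oplus>\<^bsub>?E\<^esub> single i z"
        if "y \<in> carrier V" "z \<in> carrier V" for y z
        using that by (simp add: single_def external_sum_simps fun_eq_iff)
      have ssmult: "single i (c \<odot>\<^bsub>V\<^esub> y) = c \<odot>\<^bsub>?E\<^esub> single i y"
        if "y \<in> carrier V" "c \<in> carrier K" for y c
        using that by (simp add: single_def external_sum_simps fun_eq_iff)
      have szero: "single i \<zero>\<^bsub>V\<^esub> = \<zero>\<^bsub>?E\<^esub>"
        by (simp add: single_def external_sum_simps fun_eq_iff)
      have "subspace K {y \<in> carrier V. single i y \<in> W} V"
        by (rule subspaceI) (use WD(2,3,4) sadd ssmult szero in auto)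
      then have "span (A i) \<subseteq> {y \<in> carrier V. single i y \<in> W}"
        by (rule span_least) (use A[OF i] W(2) i subspaceD(1)[OF sub[OF i]] in auto)
      with A[OF i] x show ?thesis by auto
    qed
    have "w \<in> W" if w: "w \<in> carrier ?E" for w
    proof -
      have comp: "w i \<in> ms ! i" "w i \<in> carrier V" if "i < ?r" for i
        using that w subspaceD(1)[OF sub[OF that]] by (auto simp: external_sum_simps(1) PiE_iff)
      have "(\<lambda>j\<in>{..<?r}. if j < k then w j else \<zero>\<^bsub>V\<^esub>) \<in> W" if "k \<le> ?r" for k
        using that
      proof (induction k)
        case 0
        then show ?case using WD(2) by (simp add: external_sum_simps restrict_def)
      next
        case (Suc k)
        have "(\<lambda>j\<in>{..<?r}. if j < Suc k then w j else \<zero>\<^bsub>V\<^esub>) =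
            (\<lambda>j\<in>{..<?r}. if j < k then w j else \<zero>\<^bsub>V\<^esub>) \<oplus>\<^bsub>?E\<^esub> single k (w k)"
          using comp by (auto simp: external_sum_simps single_def fun_eq_iff)
        also have "\<dots> \<in> W"
          using Suc.prems comp by (intro WD(3) single Suc.IH) auto
        finally show ?case .
      qed
      from this[of ?r] have "(\<lambda>j\<in>{..<?r}. if j < ?r then w j else \<zero>\<^bsub>V\<^esub>) \<in> W" by simp
      also have "(\<lambda>j\<in>{..<?r}. if j < ?r then w j else \<zero>\<^bsub>V\<^esub>) = w"
        using w by (auto simp: external_sum_simps(1) PiE_iff extensional_def fun_eq_iff)
      finally show ?thesis .
    qed
    then show ?thesis using WD(1) by auto
  qed
  moreover have "single i x \<in> carrier ?E" if "i < ?r" "x \<in> A i" for i x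
    using that A[of i] subspaceD(2)[OF sub]
    by (auto simp: single_def external_sum_simps(1) PiE_iff)
  ultimately show ?thesis
    unfolding E.fin_dim_iff using A by (intro exI[of _ ?G]) (auto simp del: lessThan_iff)
qed

end

text \<open>The anti-derivative with value zero at the last edge consists of the partial sums of \<open>w\<close>;
  this makes the form an explicit sum.\<close>

definition (in bilinear_form) partial_sum_form :: "nat \<Rightarrow> (nat \<Rightarrow> 'c) \<Rightarrow> (nat \<Rightarrow> 'c) \<Rightarrow> 'a"
  where "partial_sum_form n v w = (\<Oplus>\<^bsub>F\<^esub>i\<in>{..<n}. B (v i) (\<Oplus>\<^bsub>V\<^esub>j\<in>{..<Suc i}. w j))"

context bilinear_form
begin

lemma sum_closed: "(\<And>i. i < (n :: nat) \<Longrightarrow> w i \<in> carrier V) \<Longrightarrow> (\<Oplus>\<^bsub>V\<^esub>j\<in>{..<n}. w j) \<in> carrier V"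
  by (intro M.finsum_closed) auto

lemma sum_Suc: "(\<And>i. i < Suc n \<Longrightarrow> w i \<in> carrier V) \<Longrightarrow>
    (\<Oplus>\<^bsub>V\<^esub>j\<in>{..<Suc n}. w j) = (\<Oplus>\<^bsub>V\<^esub>j\<in>{..<n}. w j) \<oplus>\<^bsub>V\<^esub> w n"
  by (intro M.finsum_lessThan_Suc) auto

lemma sum_add:
  assumes "\<And>i. i < (n :: nat) \<Longrightarrow> v i \<in> carrier V" "\<And>i. i < n \<Longrightarrow> w i \<in> carrier V" "\<And>i. i < n \<Longrightarrow> u i = v i \<oplus>\<^bsub>V\<^esub> w i"
  shows "(\<Oplus>\<^bsub>V\<^esub>j\<in>{..<n}. u j) = (\<Oplus>\<^bsub>V\<^esub>j\<in>{..<n}. v j) \<oplus>\<^bsub>V\<^esub> (\<Oplus>\<^bsub>V\<^esub>j\<in>{..<n}. w j)"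
  using assms
proof (induction n)
  case (Suc n)
  then show ?case by (simp add: sum_Suc sum_closed M.a_ac del: lessThan_Suc)
qed simp

lemma sum_smult:
  assumes "c \<in> carrier F" "\<And>i. i < (n :: nat) \<Longrightarrow> v i \<in> carrier V" "\<And>i. i < n \<Longrightarrow> u i = c \<odot>\<^bsub>V\<^esub> v i"
  shows "(\<Oplus>\<^bsub>V\<^esub>j\<in>{..<n}. u j) = c \<odot>\<^bsub>V\<^esub> (\<Oplus>\<^bsub>V\<^esub>j\<in>{..<n}. v j)"
  using assms(2,3)
proof (induction n)
  case (Suc n)
  then show ?case
    using assms(1) by (simp add: sum_Suc sum_closed smult_r_distr del: lessThan_Suc)
qed (use assms(1) in simp)

lemma sum_zero: "(\<And>i. i < (n :: nat) \<Longrightarrow> w i = \<zero>\<^bsub>V\<^esub>) \<Longrightarrow> (\<Oplus>\<^bsub>V\<^esub>j\<in>{..<n}. w j) = \<zero>\<^bsub>V\<^esub>"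
  by (induction n) (simp_all add: sum_Suc del: lessThan_Suc)

lemma form_sum_left:
  "\<lbrakk>\<And>i. i < (n :: nat) \<Longrightarrow> v i \<in> carrier V; y \<in> carrier V\<rbrakk> \<Longrightarrow>
    (\<Oplus>\<^bsub>F\<^esub>i\<in>{..<n}. B (v i) y) = B (\<Oplus>\<^bsub>V\<^esub>i\<in>{..<n}. v i) y"
proof (induction n)
  case (Suc n)
  then show ?case
    by (simp add: sum_Suc sum_closed R.finsum_lessThan_Suc form_closed form_add_left del: lessThan_Suc)
qed simp

lemma partial_sum_form_0 [simp]: "partial_sum_form 0 v w = \<zero>\<^bsub>F\<^esub>"
  by (simp add: partial_sum_form_def)

context
  fixes n :: nat and v w :: "nat \<Rightarrow> 'c"
  assumes v: "\<And>i. i < n \<Longrightarrow> v i \<in> carrier V" and w: "\<And>i. i < n \<Longrightarrow> w i \<in> carrier V"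
begin

lemma partial_sum_form_closed: "partial_sum_form n v w \<in> carrier F"
  unfolding partial_sum_form_def using v w
  by (intro R.finsum_closed) (auto intro!: form_closed sum_closed)

lemma partial_sum_form_add_left:
  assumes u: "\<And>i. i < n \<Longrightarrow> u i \<in> carrier V" and "\<And>i. i < n \<Longrightarrow> t i = v i \<oplus>\<^bsub>V\<^esub> u i"
  shows "partial_sum_form n t w = partial_sum_form n v w \<oplus>\<^bsub>F\<^esub> partial_sum_form n u w"
  unfolding partial_sum_form_def using assms v w
  by (subst R.finsum_addf[symmetric])
    (auto intro!: R.finsum_cong' form_closed sum_closed simp: form_add_left sum_closed simp del: lessThan_Suc)

lemma partial_sum_form_add_right:
  assumes u: "\<And>i. i < n \<Longrightarrow> u i \<in> carrier V" and t: "\<And>i. i < n \<Longrightarrow> t i = w i \<oplus>\<^bsub>V\<^esub> u i"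
  shows "partial_sum_form n v t = partial_sum_form n v w \<oplus>\<^bsub>F\<^esub> partial_sum_form n v u"
proof -
  have "(\<Oplus>\<^bsub>V\<^esub>j\<in>{..<Suc i}. t j) = (\<Oplus>\<^bsub>V\<^esub>j\<in>{..<Suc i}. w j) \<oplus>\<^bsub>V\<^esub> (\<Oplus>\<^bsub>V\<^esub>j\<in>{..<Suc i}. u j)"
    if "i < n" for i
    using that u w t by (intro sum_add) auto
  then show ?thesis
    unfolding partial_sum_form_def using u v w
    by (subst R.finsum_addf[symmetric])
      (auto intro!: R.finsum_cong' form_closed sum_closed simp: form_add_right sum_closed simp del: lessThan_Suc)
qed

lemma partial_sum_form_smult_left:
  assumes c: "c \<in> carrier F" and "\<And>i. i < n \<Longrightarrow> t i = c \<odot>\<^bsub>V\<^esub> v i"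
  shows "partial_sum_form n t w = c \<otimes>\<^bsub>F\<^esub> partial_sum_form n v w"
  unfolding partial_sum_form_def using assms v w
  by (subst R.finsum_rdistr)
    (auto intro!: R.finsum_cong' form_closed sum_closed simp: form_smult_left sum_closed simp del: lessThan_Suc)

lemma partial_sum_form_smult_right:
  assumes c: "c \<in> carrier F" and t: "\<And>i. i < n \<Longrightarrow> t i = c \<odot>\<^bsub>V\<^esub> w i"
  shows "partial_sum_form n v t = c \<otimes>\<^bsub>F\<^esub> partial_sum_form n v w"
proof -
  have "(\<Oplus>\<^bsub>V\<^esub>j\<in>{..<Suc i}. t j) = c \<odot>\<^bsub>V\<^esub> (\<Oplus>\<^bsub>V\<^esub>j\<in>{..<Suc i}. w j)" if "i < n" for i
    using that w t c by (intro sum_smult) auto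
  then show ?thesis
    unfolding partial_sum_form_def using c v w
    by (subst R.finsum_rdistr)
      (auto intro!: R.finsum_cong' form_closed sum_closed simp: form_smult_right sum_closed simp del: lessThan_Suc)
qed

end

lemma partial_sum_form_Suc:
  assumes "\<And>i. i < Suc n \<Longrightarrow> v i \<in> carrier V" "\<And>i. i < Suc n \<Longrightarrow> w i \<in> carrier V"
  shows "partial_sum_form (Suc n) v w =
    partial_sum_form n v w \<oplus>\<^bsub>F\<^esub> B (v n) (\<Oplus>\<^bsub>V\<^esub>j\<in>{..<Suc n}. w j)"
  unfolding partial_sum_form_def using assms
  by (intro R.finsum_lessThan_Suc) (auto intro!: form_closed sum_closed)

end

context symplectic_space
begin

lemma form_antisym:
  assumes x: "x \<in> carrier V" and y: "y \<in> carrier V"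
  shows "B x y = \<ominus>\<^bsub>F\<^esub> B y x"
proof -
  have "B (x \<oplus>\<^bsub>V\<^esub> y) (x \<oplus>\<^bsub>V\<^esub> y) = \<zero>\<^bsub>F\<^esub>" using assms by (intro alternating) simp
  then have "B x y \<oplus>\<^bsub>F\<^esub> B y x = \<zero>\<^bsub>F\<^esub>"
    using assms by (simp add: form_add_left form_add_right form_closed alternating[OF x]
        alternating[OF y] R.a_comm)
  then show ?thesis using assms by (intro R.minus_equality[symmetric]) (simp_all add: form_closed)
qed

definition isotropic_sequence :: "'c set list \<Rightarrow> bool"
  where "isotropic_sequence ms \<longleftrightarrow> ms \<noteq> [] \<and>
    (\<forall>L\<in>set ms. subspace F L V \<and> (\<forall>x\<in>L. \<forall>y\<in>L. B x y = \<zero>\<^bsub>F\<^esub>))"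

lemma maslov_presentationD:
  assumes ms: "isotropic_sequence ms" and w: "w \<in> carrier (maslov_presentation F V B ms)"
  shows "\<And>i. i < length ms \<Longrightarrow> w i \<in> ms ! i" "\<And>i. i < length ms \<Longrightarrow> w i \<in> carrier V"
    "(\<Oplus>\<^bsub>V\<^esub>i\<in>{..<length ms}. w i) = \<zero>\<^bsub>V\<^esub>"
proof -
  show *: "w i \<in> ms ! i" if "i < length ms" for i
    using w that by (auto simp: maslov_presentation_simps(1) PiE_iff)
  show "w i \<in> carrier V" if "i < length ms" for i
    using *[OF that] ms nth_mem[OF that] subspaceD(1)[of F "ms ! i" V]
    by (auto simp: isotropic_sequence_def)
  show "(\<Oplus>\<^bsub>V\<^esub>i\<in>{..<length ms}. w i) = \<zero>\<^bsub>V\<^esub>"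
    using w by (simp add: maslov_presentation_simps(1))
qed

lemma antiderivative_partial_sums:
  assumes r: "0 < r" and w: "\<And>i. i < r \<Longrightarrow> w i \<in> carrier V" and sum: "(\<Oplus>\<^bsub>V\<^esub>i\<in>{..<r}. w i) = \<zero>\<^bsub>V\<^esub>"
  shows "antiderivative V r w (\<lambda>i. \<Oplus>\<^bsub>V\<^esub>j\<in>{..<Suc i}. w j)"
proof -
  have "(\<Oplus>\<^bsub>V\<^esub>j\<in>{..<Suc i}. w j) \<ominus>\<^bsub>V\<^esub> (\<Oplus>\<^bsub>V\<^esub>j\<in>{..<Suc ((i + (r - 1)) mod r)}. w j) = w i"
    if i: "i < r" for i
  proof (cases i)
    case 0
    then show ?thesis using r w sum sum_Suc[of 0 w]
      by (simp add: M.minus_zero_right del: lessThan_Suc)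
  next
    case (Suc k)
    then have "Suc ((i + (r - 1)) mod r) = i" using i
      by (simp add: mod_if)
    moreover have "(\<Oplus>\<^bsub>V\<^esub>j\<in>{..<i}. w j) \<in> carrier V" "w i \<in> carrier V"
      using i w by (auto intro: sum_closed)
    ultimately show ?thesis using i w
      by (simp add: sum_Suc a_minus_def M.a_ac M.r_neg M.r_neg1 M.r_neg2 del: lessThan_Suc)
  qed
  then show ?thesis
    unfolding antiderivative_def using w by (auto intro!: sum_closed)
qed

lemma antiderivative_unique:
  assumes r: "0 < r" and w: "\<And>i. i < r \<Longrightarrow> w i \<in> carrier V" and h: "antiderivative V r w h"
    and i: "i < r"
  shows "h i = h (r - 1) \<oplus>\<^bsub>V\<^esub> (\<Oplus>\<^bsub>V\<^esub>j\<in>{..<Suc i}. w j)"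
proof -
  have hV: "h i \<in> carrier V" if "i < r" for i using h that by (auto simp: antiderivative_def)
  have step: "h i = h ((i + (r - 1)) mod r) \<oplus>\<^bsub>V\<^esub> w i" if i: "i < r" for i
  proof -
    have "h i \<ominus>\<^bsub>V\<^esub> h ((i + (r - 1)) mod r) = w i" using h i by (auto simp: antiderivative_def)
    moreover have "h ((i + (r - 1)) mod r) \<in> carrier V" using hV r by simp
    ultimately show ?thesis using hV[OF i]
      by (metis M.a_assoc M.a_comm M.a_inv_closed M.l_neg M.r_zero a_minus_def)
  qed
  show ?thesis using i
  proof (induction i)
    case 0
    then show ?case using step[of 0] r w hV sum_Suc[of 0 w] by (simp del: lessThan_Suc)
  next
    case (Suc i)
    then have "(Suc i + (r - 1)) mod r = i" by (simp add: mod_if)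
    then show ?case
      using step[OF Suc.prems] Suc w hV[of "r - 1"] sum_Suc[of "Suc i" w] sum_closed[of "Suc i" w]
      by (simp add: M.a_assoc del: lessThan_Suc)
  qed
qed

lemma maslov_form_eq:
  assumes r: "0 < r" and v: "\<And>i. i < r \<Longrightarrow> v i \<in> carrier V" and w: "\<And>i. i < r \<Longrightarrow> w i \<in> carrier V"
    and sum: "(\<Oplus>\<^bsub>V\<^esub>i\<in>{..<r}. v i) = \<zero>\<^bsub>V\<^esub>" "(\<Oplus>\<^bsub>V\<^esub>i\<in>{..<r}. w i) = \<zero>\<^bsub>V\<^esub>"
  shows "maslov_form F V B r v w = partial_sum_form r v w"
proof -
  define h where "h = (SOME h. antiderivative V r w h)"
  have h: "antiderivative V r w h"
    unfolding h_def by (rule someI[of "antiderivative V r w", OF antiderivative_partial_sums[OF r w sum(2)]])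
  have c: "h (r - 1) \<in> carrier V" using h r by (auto simp: antiderivative_def)
  have "maslov_form F V B r v w = (\<Oplus>\<^bsub>F\<^esub>i\<in>{..<r}. B (v i) (h i))"
    by (simp add: maslov_form_def h_def Let_def)
  also have "\<dots> = (\<Oplus>\<^bsub>F\<^esub>i\<in>{..<r}. B (v i) (h (r - 1)) \<oplus>\<^bsub>F\<^esub> B (v i) (\<Oplus>\<^bsub>V\<^esub>j\<in>{..<Suc i}. w j))"
  proof (rule R.finsum_cong')
    fix i assume "i \<in> {..<r}"
    then have i: "i < r" by simp
    have sV: "(\<Oplus>\<^bsub>V\<^esub>j\<in>{..<Suc i}. w j) \<in> carrier V" using i w by (intro sum_closed) simp
    show "B (v i) (h i) = B (v i) (h (r - 1)) \<oplus>\<^bsub>F\<^esub> B (v i) (\<Oplus>\<^bsub>V\<^esub>j\<in>{..<Suc i}. w j)"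
      by (subst antiderivative_unique[OF r w h i]) (assumption, rule form_add_right[OF v[OF i] c sV])
  qed (use v w c in \<open>auto intro!: R.a_closed form_closed sum_closed\<close>)
  also have "\<dots> = (\<Oplus>\<^bsub>F\<^esub>i\<in>{..<r}. B (v i) (h (r - 1))) \<oplus>\<^bsub>F\<^esub> partial_sum_form r v w"
    unfolding partial_sum_form_def using v w c
    by (intro R.finsum_addf) (auto intro!: form_closed sum_closed)
  also have "(\<Oplus>\<^bsub>F\<^esub>i\<in>{..<r}. B (v i) (h (r - 1))) = \<zero>\<^bsub>F\<^esub>"
    using v c by (simp add: form_sum_left sum)
  finally show ?thesis using partial_sum_form_closed[of r v w] v w by simp
qed

text \<open>Summation by parts: the defect of symmetry telescopes, and it vanishes once the partial
  sums return to zero.\<close>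

lemma partial_sum_form_commute:
  assumes "\<And>i. i < n \<Longrightarrow> v i \<in> carrier V" "\<And>i. i < n \<Longrightarrow> w i \<in> carrier V"
    and "\<And>i. i < n \<Longrightarrow> B (v i) (w i) = \<zero>\<^bsub>F\<^esub>"
  shows "partial_sum_form n v w =
    partial_sum_form n w v \<oplus>\<^bsub>F\<^esub> B (\<Oplus>\<^bsub>V\<^esub>j\<in>{..<n}. v j) (\<Oplus>\<^bsub>V\<^esub>j\<in>{..<n}. w j)"
  using assms
proof (induction n)
  case (Suc n)
  define p where "p = (\<Oplus>\<^bsub>V\<^esub>j\<in>{..<n}. v j)"
  define q where "q = (\<Oplus>\<^bsub>V\<^esub>j\<in>{..<n}. w j)"
  have pq: "p \<in> carrier V" "q \<in> carrier V"
    unfolding p_def q_def using Suc.prems by (auto intro: sum_closed)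
  have vw: "v n \<in> carrier V" "w n \<in> carrier V" "B (v n) (w n) = \<zero>\<^bsub>F\<^esub>" using Suc.prems by auto
  then have wv: "B (w n) (v n) = \<zero>\<^bsub>F\<^esub>" using form_antisym[of "w n" "v n"] by simp
  have wp: "B (w n) p = \<ominus>\<^bsub>F\<^esub> B p (w n)" using vw pq by (intro form_antisym)
  have cl: "partial_sum_form n w v \<in> carrier F"
    using Suc.prems by (intro partial_sum_form_closed) auto
  have cancel: "a \<oplus>\<^bsub>F\<^esub> (x \<oplus>\<^bsub>F\<^esub> (\<ominus>\<^bsub>F\<^esub> a \<oplus>\<^bsub>F\<^esub> y)) = x \<oplus>\<^bsub>F\<^esub> y"
    if "a \<in> carrier F" "x \<in> carrier F" "y \<in> carrier F" for a x y
    using that by (simp add: R.a_lcomm[of a x] R.r_neg2)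
  have "partial_sum_form n v w = partial_sum_form n w v \<oplus>\<^bsub>F\<^esub> B p q"
    unfolding p_def q_def using Suc by auto
  then show ?case
    using Suc.prems vw wv pq cl
    by (simp add: partial_sum_form_Suc sum_Suc form_add_left form_add_right form_closed wp
        R.a_ac cancel del: lessThan_Suc flip: p_def q_def)
qed simp

text \<open>On sequences with sum zero the form is the explicit sum over partial sums, so that it is
  bilinear by inspection and symmetric by summation by parts.\<close>

lemma symmetric_space_maslov_presentation:
  assumes ms: "isotropic_sequence ms"
  shows "symmetric_space F (maslov_presentation F V B ms)"
    and "\<And>v w. \<lbrakk>v \<in> carrier (maslov_presentation F V B ms); w \<in> carrier (maslov_presentation F V B ms)\<rbrakk>
      \<Longrightarrow> form (maslov_presentation F V B ms) v w = partial_sum_form (length ms) v w"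
proof -
  let ?K = "maslov_presentation F V B ms" and ?r = "length ms"
  have r: "0 < ?r" and sub: "\<And>L. L \<in> set ms \<Longrightarrow> subspace F L V" and
    iso: "\<And>i x y. \<lbrakk>i < ?r; x \<in> ms ! i; y \<in> ms ! i\<rbrakk> \<Longrightarrow> B x y = \<zero>\<^bsub>F\<^esub>"
    using ms by (auto simp: isotropic_sequence_def) (meson nth_mem)
  note KD = maslov_presentationD[OF ms]
  show form: "form ?K v w = partial_sum_form ?r v w" if "v \<in> carrier ?K" "w \<in> carrier ?K" for v w
    unfolding maslov_presentation_simps(5)
    by (rule maslov_form_eq[OF r KD(2)[OF that(1)] KD(2)[OF that(2)] KD(3)[OF that(1)] KD(3)[OF that(2)]])
  let ?E = "external_sum V ms"
  interpret E: vectorspace F ?E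
    using module_external_sum[OF sub] by (simp add: vectorspace_def field_axioms)
  have comp: "w i \<in> carrier V" if "w \<in> carrier ?E" "i < ?r" for w i
    using that subspaceD(1)[OF sub[OF nth_mem[OF that(2)]]]
    by (auto simp: external_sum_simps(1) PiE_iff)
  have K: "carrier ?K = {w \<in> carrier ?E. (\<Oplus>\<^bsub>V\<^esub>i\<in>{..<?r}. w i) = \<zero>\<^bsub>V\<^esub>}"
    by (simp add: maslov_presentation_simps(1) external_sum_simps(1))
  have K_sub: "subspace F (carrier ?K) ?E"
  proof (rule E.subspaceI)
    show "carrier ?K \<subseteq> carrier ?E" by (auto simp: K)
    show "\<zero>\<^bsub>?E\<^esub> \<in> carrier ?K"
      using E.M.zero_closed by (simp add: K external_sum_simps(2) sum_zero)
    fix x y assume xy: "x \<in> carrier ?K" "y \<in> carrier ?K"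
    then have xyE: "x \<in> carrier ?E" "y \<in> carrier ?E" by (auto simp: K)
    have "(\<Oplus>\<^bsub>V\<^esub>i\<in>{..<?r}. (x \<oplus>\<^bsub>?E\<^esub> y) i) = (\<Oplus>\<^bsub>V\<^esub>i\<in>{..<?r}. x i) \<oplus>\<^bsub>V\<^esub> (\<Oplus>\<^bsub>V\<^esub>i\<in>{..<?r}. y i)"
      using comp[OF xyE(1)] comp[OF xyE(2)] by (intro sum_add) (auto simp: external_sum_simps(3))
    then show "x \<oplus>\<^bsub>?E\<^esub> y \<in> carrier ?K"
      using xy xyE E.M.a_closed by (simp add: K)
  next
    fix c x assume c: "c \<in> carrier F" and x: "x \<in> carrier ?K"
    then have xE: "x \<in> carrier ?E" by (auto simp: K)
    have "(\<Oplus>\<^bsub>V\<^esub>i\<in>{..<?r}. (c \<odot>\<^bsub>?E\<^esub> x) i) = c \<odot>\<^bsub>V\<^esub> (\<Oplus>\<^bsub>V\<^esub>i\<in>{..<?r}. x i)"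
      using c comp[OF xE] by (intro sum_smult) (auto simp: external_sum_simps(4))
    then show "c \<odot>\<^bsub>?E\<^esub> x \<in> carrier ?K"
      using x xE c E.smult_closed by (simp add: K)
  qed
  have rec: "?K = with_form (?E\<lparr>carrier := carrier ?K\<rparr>) (maslov_form F V B ?r)"
    by (simp add: maslov_presentation_def)
  interpret S: vectorspace F "?E\<lparr>carrier := carrier ?K\<rparr>"
    by (rule E.subspace_is_vs[OF K_sub])
  have Kvs: "vectorspace F ?K"
    using module_with_form[OF S.module_axioms, of "maslov_form F V B ?r"]
    by (simp add: vectorspace_def field_axioms flip: rec)
  interpret K: vectorspace F ?K by (rule Kvs)
  have "S.fin_dim" by (rule E.fin_dim_subspace[OF fin_dim_external_sum[OF sub fin_dim] K_sub])
  then obtain A where A: "finite A" "A \<subseteq> carrier ?K"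
    "\<And>W. \<lbrakk>subspace F W (?E\<lparr>carrier := carrier ?K\<rparr>); A \<subseteq> W\<rbrakk> \<Longrightarrow> W = carrier ?K"
    unfolding S.fin_dim_iff by auto
  have "subspace F W (?E\<lparr>carrier := carrier ?K\<rparr>)" if "subspace F W ?K" for W
    using subspaceD[OF that]
    by (intro S.subspaceI) (simp_all add: maslov_presentation_simps(2-4) external_sum_simps(2-4))
  then have "K.fin_dim" unfolding K.fin_dim_iff using A by (intro exI[of _ A]) auto
  have at: "(v \<oplus>\<^bsub>?K\<^esub> w) i = v i \<oplus>\<^bsub>V\<^esub> w i" "(c \<odot>\<^bsub>?K\<^esub> v) i = c \<odot>\<^bsub>V\<^esub> v i" if "i < ?r" for v w c i
    using that by (simp_all add: maslov_presentation_simps(3,4))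
  have "bilinear_form F ?K (form ?K)"
    by (intro bilinear_form.intro Kvs bilinear_form_axioms.intro)
      (simp_all only: form K.M.a_closed K.smult_closed,
       (rule partial_sum_form_closed partial_sum_form_add_left partial_sum_form_add_right
         partial_sum_form_smult_left partial_sum_form_smult_right; simp add: KD(2) at)+)
  moreover have "form ?K v w = form ?K w v" if "v \<in> carrier ?K" "w \<in> carrier ?K" for v w
    using partial_sum_form_commute[of ?r v w] iso KD[OF that(1)] KD[OF that(2)]
      partial_sum_form_closed[of ?r w v]
    by (simp add: form that)
  ultimately show "symmetric_space F ?K"
    using \<open>K.fin_dim\<close> by (intro symmetric_space.intro symmetric_space_axioms.intro)
qed

lemma quadratic_space_maslov_space:
  assumes ms: "isotropic_sequence ms"
  obtains p where "form_epi F (maslov_presentation F V B ms) (maslov_space F V B ms) p"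
    and "quadratic_space F (maslov_space F V B ms)"
  using quadratic_space_mod_radical[OF symmetric_space_maslov_presentation(1)[OF ms] refl]
  by (auto simp: maslov_space_def Let_def)

end

section \<open>Cutting a cyclic sequence along a chord\<close>

context symplectic_space
begin

lemma isotropic_sequence_lagrangian:
  assumes "ms \<noteq> []" "\<And>L. L \<in> set ms \<Longrightarrow> lagrangian F V B L"
  shows "isotropic_sequence ms"
  using assms by (fastforce simp: isotropic_sequence_def lagrangian_def perp_def)

text \<open>For Lagrangians \<open>(L + M)\<^sup>\<bottom> = L\<^sup>\<bottom> \<inter> M\<^sup>\<bottom> = L \<inter> M\<close>, and taking the orthogonal space twice gives
  \<open>L + M\<close> back.\<close>

lemma lagrangian_sum_is_perp:
  assumes L: "lagrangian F V B L" and M: "lagrangian F V B M"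
    and y: "y \<in> carrier V" and orth: "\<And>u. u \<in> L \<inter> M \<Longrightarrow> B y u = \<zero>\<^bsub>F\<^esub>"
  obtains a b where "a \<in> L" "b \<in> M" "y = a \<oplus>\<^bsub>V\<^esub> b"
proof -
  have Ls: "subspace F L V" "perp F V B L = L" and Ms: "subspace F M V" "perp F V B M = M"
    using L M by (auto simp: lagrangian_def)
  have S: "subspace F (subspace_sum L M) V" by (rule sum_is_subspace[OF Ls(1) Ms(1)])
  obtain A where A: "finite A" "A \<subseteq> subspace_sum L M" "span A = subspace_sum L M"
    using subspace_finitely_spanned[OF fin_dim S] .
  have AV: "A \<subseteq> carrier V" using A(2) subspaceD(1)[OF S] by auto
  have "L \<subseteq> subspace_sum L M" "M \<subseteq> subspace_sum L M"
    using in_sum_vs[OF Ls(1) Ms(1)] in_sum_vs[OF Ms(1) Ls(1)] vsum_comm[OF Ls(1) Ms(1)] by auto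
  then have "perp F V B (subspace_sum L M) \<subseteq> perp F V B L \<inter> perp F V B M"
    by (auto simp: perp_def)
  then have perp: "perp F V B A \<subseteq> L \<inter> M"
    using perp_span[OF AV] A(3) Ls(2) Ms(2) by simp
  have "y \<in> span A"
  proof (rule perp_perp_span[OF _ A(1) AV y])
    fix x assume x: "x \<in> perp F V B A"
    then have "x \<in> carrier V" "B y x = \<zero>\<^bsub>F\<^esub>" using orth perp by (auto simp: perp_def)
    then show "B x y = \<zero>\<^bsub>F\<^esub>" using form_antisym[of x y] y by simp
  next
    fix z assume z: "z \<in> carrier V" "\<And>x. x \<in> carrier V \<Longrightarrow> B x z = \<zero>\<^bsub>F\<^esub>"
    show "z = \<zero>\<^bsub>V\<^esub>"
      by (rule nondegenerate[OF z(1)]) (use z form_antisym[of z] in auto)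
  qed
  then show thesis using that by (auto simp: A(3) submodule_sum_def)
qed

text \<open>The sequence \<open>z\<close> of length \<open>p + 1 + q\<close> arises from the sequences \<open>x\<close> of length \<open>p + 1\<close> and \<open>y\<close> of
  length \<open>q + 2\<close> by adding them where they meet: at the two ends of the chord, which have the
  positions \<open>0\<close> and \<open>p\<close> in \<open>x\<close> and in \<open>z\<close>, and \<open>0\<close> and \<open>1\<close> in \<open>y\<close>.\<close>

definition glued :: "nat \<Rightarrow> nat \<Rightarrow> (nat \<Rightarrow> 'c) \<Rightarrow> (nat \<Rightarrow> 'c) \<Rightarrow> (nat \<Rightarrow> 'c) \<Rightarrow> bool"
  where "glued p q x y z \<longleftrightarrow> 0 < p \<and> z 0 = x 0 \<oplus>\<^bsub>V\<^esub> y 0 \<and> (\<forall>i. 0 < i \<and> i < p \<longrightarrow> z i = x i) \<and>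
    z p = x p \<oplus>\<^bsub>V\<^esub> y 1 \<and> (\<forall>j<q. z (Suc p + j) = y (j + 2)) \<and>
    (\<forall>i\<le>p. x i \<in> carrier V) \<and> (\<forall>i<q + 2. y i \<in> carrier V) \<and>
    (\<Oplus>\<^bsub>V\<^esub>i\<in>{..<Suc p}. x i) = \<zero>\<^bsub>V\<^esub>"

lemma gluedD:
  assumes "glued p q x y z"
  shows "0 < p" "z 0 = x 0 \<oplus>\<^bsub>V\<^esub> y 0" "\<And>i. \<lbrakk>0 < i; i < p\<rbrakk> \<Longrightarrow> z i = x i" "z p = x p \<oplus>\<^bsub>V\<^esub> y 1"
    "\<And>j. j < q \<Longrightarrow> z (Suc p + j) = y (j + 2)"
    "\<And>i. i \<le> p \<Longrightarrow> x i \<in> carrier V" "\<And>i. i < q + 2 \<Longrightarrow> y i \<in> carrier V"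
    "(\<Oplus>\<^bsub>V\<^esub>i\<in>{..<Suc p}. x i) = \<zero>\<^bsub>V\<^esub>"
  using assms by (auto simp: glued_def)

lemma glued_closed:
  assumes g: "glued p q x y z" and i: "i < Suc p + q"
  shows "z i \<in> carrier V"
proof -
  note D = gluedD[OF g]
  consider "i = 0" | "0 < i" "i < p" | "i = p" | j where "i = Suc p + j" "j < q"
    using i by (metis add_diff_inverse_nat less_SucE nat_add_left_cancel_less neq0_conv not_less_eq)
  then show ?thesis using D by cases auto
qed

lemma glued_chord_sum:
  assumes g: "glued p q x y z"
  shows "(\<Oplus>\<^bsub>V\<^esub>i\<in>{..<p}. x i) = \<ominus>\<^bsub>V\<^esub> x p"
proof -
  note D = gluedD[OF g]
  have "(\<Oplus>\<^bsub>V\<^esub>i\<in>{..<p}. x i) \<oplus>\<^bsub>V\<^esub> x p = \<zero>\<^bsub>V\<^esub>"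
    using sum_Suc[of p x] D(6,8) by auto
  then show ?thesis
    using D(6) sum_closed[of p x] by (intro M.minus_equality[symmetric]) auto
qed

lemma glued_sum_lower:
  assumes g: "glued p q x y z" and "m < p"
  shows "(\<Oplus>\<^bsub>V\<^esub>i\<in>{..<Suc m}. z i) = (\<Oplus>\<^bsub>V\<^esub>i\<in>{..<Suc m}. x i) \<oplus>\<^bsub>V\<^esub> y 0"
  using assms(2)
proof (induction m)
  case 0
  then show ?case
    using gluedD[OF g] glued_closed[OF g, of 0] sum_Suc[of 0 z] sum_Suc[of 0 x]
    by (simp del: lessThan_Suc)
next
  case (Suc m)
  have "(\<Oplus>\<^bsub>V\<^esub>i\<in>{..<Suc m}. x i) \<in> carrier V"
    using gluedD(6)[OF g] Suc.prems by (intro sum_closed) auto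
  then show ?case
    using Suc gluedD[OF g] glued_closed[OF g] sum_Suc[of "Suc m" z] sum_Suc[of "Suc m" x]
    by (simp add: M.a_ac del: lessThan_Suc)
qed

lemma glued_sum_upper:
  assumes g: "glued p q x y z" and "j \<le> q"
  shows "(\<Oplus>\<^bsub>V\<^esub>i\<in>{..<Suc p + j}. z i) = (\<Oplus>\<^bsub>V\<^esub>i\<in>{..<j + 2}. y i)"
  using assms(2)
proof (induction j)
  case 0
  note D = gluedD[OF g]
  obtain m where m: "p = Suc m" using D(1) gr0_implies_Suc by blast
  have y: "(\<Oplus>\<^bsub>V\<^esub>i\<in>{..<2}. y i) = y 0 \<oplus>\<^bsub>V\<^esub> y 1"
    using D(7) sum_Suc[of 0 y] sum_Suc[of 1 y] by (simp add: numeral_2_eq_2 del: lessThan_Suc)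
  have "(\<Oplus>\<^bsub>V\<^esub>i\<in>{..<Suc p}. z i) = (\<Oplus>\<^bsub>V\<^esub>i\<in>{..<p}. z i) \<oplus>\<^bsub>V\<^esub> z p"
    using glued_closed[OF g] by (intro sum_Suc) auto
  also have "(\<Oplus>\<^bsub>V\<^esub>i\<in>{..<p}. z i) = \<ominus>\<^bsub>V\<^esub> x p \<oplus>\<^bsub>V\<^esub> y 0"
    using glued_sum_lower[OF g, of m] glued_chord_sum[OF g] by (simp add: m del: lessThan_Suc)
  also have "\<dots> \<oplus>\<^bsub>V\<^esub> z p = y 0 \<oplus>\<^bsub>V\<^esub> y 1"
  proof -
    have "x p \<in> carrier V" "y 0 \<in> carrier V" "y 1 \<in> carrier V" using D(6,7) by auto
    then show ?thesis
      by (simp add: D(4) M.a_assoc M.a_lcomm[of "\<ominus>\<^bsub>V\<^esub> x p" "y 0"] M.r_neg1)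
  qed
  finally show ?case using y by (simp only: add_0_left add_0_right)
next
  case (Suc j)
  then show ?case
    using gluedD(5,7)[OF g] glued_closed[OF g] sum_Suc[of "Suc p + j" z] sum_Suc[of "j + 2" y]
    by (simp del: lessThan_Suc)
qed

text \<open>Take partial sums as anti-derivatives. That of \<open>x\<close> vanishes on the chord, and that of \<open>y\<close> has the
  value \<open>y 0\<close> there. On the edges of the first piece the anti-derivative of \<open>z\<close> is that of \<open>x\<close>
  shifted by \<open>y 0\<close>, and the pairing with a sequence of sum zero does not see a constant. On the
  edges of the second piece it is that of \<open>y\<close>. The remaining products, at the two ends of the chord,
  vanish because the subspaces there are isotropic.\<close>

lemma glued_form:
  assumes g: "glued p q x y z" and g': "glued p q x' y' z'"
    and iso: "B (x 0) (x' 0) = \<zero>\<^bsub>F\<^esub>" "B (x 0) (y' 0) = \<zero>\<^bsub>F\<^esub>" "B (y 0) (x' 0) = \<zero>\<^bsub>F\<^esub>"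
      "B (y 0) (y' 0) = \<zero>\<^bsub>F\<^esub>" "B (x p) (y' 1) = \<zero>\<^bsub>F\<^esub>"
  shows "partial_sum_form (Suc p + q) z z' =
    partial_sum_form (Suc p) x x' \<oplus>\<^bsub>F\<^esub> partial_sum_form (q + 2) y y'"
proof -
  note D = gluedD[OF g] and D' = gluedD[OF g']
  note zV = glued_closed[OF g] and zV' = glued_closed[OF g']
  have base: "x 0 \<in> carrier V" "x' 0 \<in> carrier V" "y 0 \<in> carrier V" "y' 0 \<in> carrier V"
    "y 1 \<in> carrier V" "y' 1 \<in> carrier V" "x p \<in> carrier V"
    using D(6,7) D'(6,7) by auto
  have Sx': "(\<Oplus>\<^bsub>V\<^esub>i\<in>{..<n}. x' i) \<in> carrier V" if "n \<le> Suc p" for n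
    using that D'(6) by (intro sum_closed) auto
  have Sx: "(\<Oplus>\<^bsub>V\<^esub>i\<in>{..<n}. x i) \<in> carrier V" if "n \<le> Suc p" for n
    using that D(6) by (intro sum_closed) auto
  have lower: "partial_sum_form (Suc m) z z' =
      partial_sum_form (Suc m) x x' \<oplus>\<^bsub>F\<^esub> B (\<Oplus>\<^bsub>V\<^esub>i\<in>{..<Suc m}. x i) (y' 0)" if "m < p" for m
    using that
  proof (induction m)
    case 0
    have "partial_sum_form (Suc 0) z z' = \<zero>\<^bsub>F\<^esub>" "partial_sum_form (Suc 0) x x' = \<zero>\<^bsub>F\<^esub>"
      using base iso zV zV' D(2,6) D'(2,6)
      by (simp_all add: partial_sum_form_Suc sum_Suc form_add_left form_add_right del: lessThan_Suc)
    then show ?case using base iso sum_Suc[of 0 x] by (simp del: lessThan_Suc)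
  next
    case (Suc m)
    have xm: "x (Suc m) \<in> carrier V" using D(6) Suc.prems by auto
    have s: "(\<Oplus>\<^bsub>V\<^esub>i\<in>{..<Suc m}. x i) \<in> carrier V" "(\<Oplus>\<^bsub>V\<^esub>i\<in>{..<Suc (Suc m)}. x' i) \<in> carrier V"
      using Sx[of "Suc m"] Sx'[of "Suc (Suc m)"] Suc.prems by auto
    have cl: "partial_sum_form (Suc m) x x' \<in> carrier F"
      using D(6) D'(6) Suc.prems by (intro partial_sum_form_closed) auto
    have "partial_sum_form (Suc (Suc m)) z z' = partial_sum_form (Suc m) z z' \<oplus>\<^bsub>F\<^esub>
        B (x (Suc m)) ((\<Oplus>\<^bsub>V\<^esub>i\<in>{..<Suc (Suc m)}. x' i) \<oplus>\<^bsub>V\<^esub> y' 0)"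
      using glued_sum_lower[OF g' Suc.prems] zV zV' Suc.prems D(3)[of "Suc m"]
      by (subst partial_sum_form_Suc) auto
    moreover have "partial_sum_form (Suc (Suc m)) x x' = partial_sum_form (Suc m) x x' \<oplus>\<^bsub>F\<^esub>
        B (x (Suc m)) (\<Oplus>\<^bsub>V\<^esub>i\<in>{..<Suc (Suc m)}. x' i)"
      using D(6) D'(6) Suc.prems by (intro partial_sum_form_Suc) auto
    moreover have "(\<Oplus>\<^bsub>V\<^esub>i\<in>{..<Suc (Suc m)}. x i) = (\<Oplus>\<^bsub>V\<^esub>i\<in>{..<Suc m}. x i) \<oplus>\<^bsub>V\<^esub> x (Suc m)"
      using D(6) Suc.prems by (intro sum_Suc) auto
    ultimately show ?case
      using Suc.IH Suc.prems xm s cl base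
      by (simp add: form_add_left form_add_right form_closed R.a_ac del: lessThan_Suc)
  qed
  have middle: "partial_sum_form (Suc p) z z' = partial_sum_form (Suc p) x x' \<oplus>\<^bsub>F\<^esub> partial_sum_form 2 y y'"
  proof -
    obtain m where m: "p = Suc m" using D(1) gr0_implies_Suc by blast
    define w where "w = (\<Oplus>\<^bsub>V\<^esub>i\<in>{..<2}. y' i)"
    have w: "w = y' 0 \<oplus>\<^bsub>V\<^esub> y' 1"
      using D'(7) sum_Suc[of 0 y'] sum_Suc[of 1 y']
      by (simp add: w_def numeral_2_eq_2 del: lessThan_Suc)
    have wV: "w \<in> carrier V" using w base by simp
    have cl: "partial_sum_form p x x' \<in> carrier F"
      using D(6) D'(6) by (intro partial_sum_form_closed) auto
    have "partial_sum_form (Suc p) z z' = partial_sum_form p z z' \<oplus>\<^bsub>F\<^esub> B (x p \<oplus>\<^bsub>V\<^esub> y 1) w"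
    proof -
      have "(\<Oplus>\<^bsub>V\<^esub>i\<in>{..<Suc p}. z' i) = w"
        using glued_sum_upper[OF g', of 0] by (simp only: w_def add_0_left add_0_right le0)
      then show ?thesis using zV zV' D(4) by (subst partial_sum_form_Suc) auto
    qed
    also have "partial_sum_form p z z' = partial_sum_form p x x' \<oplus>\<^bsub>F\<^esub> \<ominus>\<^bsub>F\<^esub> B (x p) (y' 0)"
      using lower[of m] glued_chord_sum[OF g] base
      by (simp add: m form_uminus_left del: lessThan_Suc)
    also have "B (x p \<oplus>\<^bsub>V\<^esub> y 1) w = B (x p) (y' 0) \<oplus>\<^bsub>F\<^esub> B (y 1) w"
      using base wV iso by (simp add: form_add_left) (simp add: w form_add_right form_closed)
    also have "partial_sum_form p x x' \<oplus>\<^bsub>F\<^esub> \<ominus>\<^bsub>F\<^esub> B (x p) (y' 0) \<oplus>\<^bsub>F\<^esub> (B (x p) (y' 0) \<oplus>\<^bsub>F\<^esub> B (y 1) w) =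
        partial_sum_form p x x' \<oplus>\<^bsub>F\<^esub> B (y 1) w"
      using cl base wV by (simp add: R.a_assoc R.r_neg1 R.r_neg2 form_closed)
    also have "partial_sum_form p x x' = partial_sum_form (Suc p) x x'"
      using D(6) D'(6,8) cl base by (subst partial_sum_form_Suc) auto
    also have "B (y 1) w = partial_sum_form 2 y y'"
      using D(7) D'(7) base iso wV partial_sum_form_Suc[of 0 y y'] partial_sum_form_Suc[of 1 y y']
        sum_Suc[of 0 y']
      by (simp add: numeral_2_eq_2 w_def form_closed del: lessThan_Suc)
    finally show ?thesis .
  qed
  have "partial_sum_form (Suc p + j) z z' =
      partial_sum_form (Suc p) x x' \<oplus>\<^bsub>F\<^esub> partial_sum_form (j + 2) y y'" if "j \<le> q" for j
    using that
  proof (induction j)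
    case 0
    show ?case using middle by (simp only: add_0_left add_0_right)
  next
    case (Suc j)
    have "partial_sum_form (Suc p) x x' \<in> carrier F"
      using D(6) D'(6) by (intro partial_sum_form_closed) auto
    moreover have "partial_sum_form (j + 2) y y' \<in> carrier F"
      using D(7) D'(7) Suc.prems by (intro partial_sum_form_closed) auto
    moreover have "y (j + 2) \<in> carrier V" "(\<Oplus>\<^bsub>V\<^esub>i\<in>{..<Suc (j + 2)}. y' i) \<in> carrier V"
      using D(7) D'(7) Suc.prems by (auto intro!: sum_closed)
    moreover have "partial_sum_form (Suc (Suc p + j)) z z' = partial_sum_form (Suc p + j) z z' \<oplus>\<^bsub>F\<^esub>
        B (y (j + 2)) (\<Oplus>\<^bsub>V\<^esub>i\<in>{..<Suc (j + 2)}. y' i)"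
      using glued_sum_upper[OF g' Suc.prems] zV zV' Suc.prems D(5)[of j]
      by (subst partial_sum_form_Suc) (auto simp del: lessThan_Suc)
    moreover have "partial_sum_form (Suc (j + 2)) y y' = partial_sum_form (j + 2) y y' \<oplus>\<^bsub>F\<^esub>
        B (y (j + 2)) (\<Oplus>\<^bsub>V\<^esub>i\<in>{..<Suc (j + 2)}. y' i)"
      using D(7) D'(7) Suc.prems by (intro partial_sum_form_Suc) auto
    ultimately show ?case
      using Suc by (simp add: R.a_assoc form_closed del: lessThan_Suc)
  qed
  then show ?thesis by simp
qed

text \<open>The gluing of \<open>u, 0, ..., 0, - u\<close> on the first piece with zero on the second, and also that of zero
  on the first with \<open>u, - u, 0, ..., 0\<close> on the second.\<close>

definition chord_vector :: "nat \<Rightarrow> nat \<Rightarrow> 'c \<Rightarrow> nat \<Rightarrow> 'c"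
  where "chord_vector p q u =
    (\<lambda>i\<in>{..<Suc p + q}. if i = 0 then u else if i = p then \<ominus>\<^bsub>V\<^esub> u else \<zero>\<^bsub>V\<^esub>)"

lemma chord_vector_sum:
  assumes u: "u \<in> carrier V" and p: "0 < p"
  shows "n \<le> Suc p + q \<Longrightarrow>
    (\<Oplus>\<^bsub>V\<^esub>i\<in>{..<n}. chord_vector p q u i) = (if 0 < n \<and> n \<le> p then u else \<zero>\<^bsub>V\<^esub>)"
proof (induction n)
  case (Suc n)
  have "chord_vector p q u i \<in> carrier V" if "i < Suc p + q" for i
    using u that by (simp add: chord_vector_def)
  then have "(\<Oplus>\<^bsub>V\<^esub>i\<in>{..<Suc n}. chord_vector p q u i) =
      (\<Oplus>\<^bsub>V\<^esub>i\<in>{..<n}. chord_vector p q u i) \<oplus>\<^bsub>V\<^esub> chord_vector p q u n"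
    using Suc.prems by (intro sum_Suc) auto
  then show ?case
    using Suc u p by (auto simp: chord_vector_def M.r_neg simp del: lessThan_Suc)
qed simp

lemma chord_vector_form:
  assumes u: "u \<in> carrier V" and p: "0 < p" and z: "\<And>i. i < Suc p + q \<Longrightarrow> z i \<in> carrier V"
  shows "partial_sum_form (Suc p + q) z (chord_vector p q u) = B (\<Oplus>\<^bsub>V\<^esub>i\<in>{..<p}. z i) u"
proof -
  have cV: "chord_vector p q u i \<in> carrier V" if "i < Suc p + q" for i
    using u that by (simp add: chord_vector_def)
  have Suc_form: "partial_sum_form (Suc n) z (chord_vector p q u) =
      partial_sum_form n z (chord_vector p q u) \<oplus>\<^bsub>F\<^esub> B (z n) (if n < p then u else \<zero>\<^bsub>V\<^esub>)"
    if "n < Suc p + q" for n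
    using that z cV chord_vector_sum[OF u p, of "Suc n" q]
    by (subst partial_sum_form_Suc) (auto simp: Suc_le_eq simp del: lessThan_Suc)
  have 1: "partial_sum_form n z (chord_vector p q u) = B (\<Oplus>\<^bsub>V\<^esub>i\<in>{..<n}. z i) u" if "n \<le> p" for n
    using that
  proof (induction n)
    case (Suc n)
    have "(\<Oplus>\<^bsub>V\<^esub>i\<in>{..<n}. z i) \<in> carrier V" using z Suc.prems by (intro sum_closed) auto
    then show ?case
      using Suc z u Suc_form[of n] by (simp add: sum_Suc form_add_left del: lessThan_Suc)
  qed (use u in simp)
  have S: "B (\<Oplus>\<^bsub>V\<^esub>i\<in>{..<p}. z i) u \<in> carrier F" using z u by (auto intro!: form_closed sum_closed)
  have "partial_sum_form (p + j) z (chord_vector p q u) = B (\<Oplus>\<^bsub>V\<^esub>i\<in>{..<p}. z i) u" if "j \<le> Suc q" for j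
    using that
  proof (induction j)
    case (Suc j)
    then show ?case using Suc_form[of "p + j"] z S by simp
  qed (use 1 in simp)
  from this[of "Suc q"] show ?thesis by simp
qed

text \<open>Gluing maps \<open>Ka \<oplus> Kb\<close> onto those \<open>z\<close> in \<open>Kc\<close> whose sum over the positions before \<open>m\<close>, that is
  over \<open>m0\<close> and \<open>as\<close>, lies in \<open>m0 + m\<close>. As \<open>m0 + m = (m0 \<inter> m)\<^sup>\<bottom>\<close>, these are the \<open>z\<close> orthogonal to all
  chord vectors of elements of \<open>m0 \<inter> m\<close>. So \<open>I\<close> is the image of the chord vectors in \<open>T\<close>; it is isotropic
  because chord vectors satisfy the condition themselves.\<close>

lemma cut_along_chord:
  fixes m0 m :: "'c set" and as bs :: "'c set list"
  defines "Ka \<equiv> maslov_presentation F V B (m0 # as @ [m])"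
    and "Kb \<equiv> maslov_presentation F V B (m0 # m # bs)"
    and "Kc \<equiv> maslov_presentation F V B (m0 # as @ m # bs)"
    and "T \<equiv> maslov_space F V B (m0 # as @ m # bs)"
  assumes m0: "lagrangian F V B m0" and m: "lagrangian F V B m"
    and iso: "isotropic_sequence (m0 # as @ m # bs)"
  obtains I f where "isotropic F T I" "form_epi F (orth_sum F Ka Kb) (T\<lparr>carrier := perp F T (form T) I\<rparr>) f"
    "m0 \<inter> m = {\<zero>\<^bsub>V\<^esub>} \<Longrightarrow> I = {\<zero>\<^bsub>T\<^esub>}"
proof -
  define p q where "p = Suc (length as)" and "q = length bs"
  let ?c = "m0 # as @ m # bs"
  have iso_a: "isotropic_sequence (m0 # as @ [m])" and iso_b: "isotropic_sequence (m0 # m # bs)"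
    using iso by (simp_all add: isotropic_sequence_def ball_Un)
  have len: "length (m0 # as @ [m]) = Suc p" "length (m0 # m # bs) = q + 2" "length ?c = Suc p + q"
    by (simp_all add: p_def q_def)
  have p: "0 < p" by (simp add: p_def)
  have nth: "?c ! 0 = m0" "\<And>i. \<lbrakk>0 < i; i < p\<rbrakk> \<Longrightarrow> ?c ! i = (m0 # as @ [m]) ! i" "?c ! p = m"
    "\<And>j. j < q \<Longrightarrow> ?c ! (Suc p + j) = (m0 # m # bs) ! (j + 2)"
    "(m0 # as @ [m]) ! p = m"
    by (auto simp: p_def q_def nth_append nth_Cons' )
  have sub: "subspace F m0 V" "subspace F m V" and isoL: "\<And>x y. \<lbrakk>x \<in> m0; y \<in> m0\<rbrakk> \<Longrightarrow> B x y = \<zero>\<^bsub>F\<^esub>"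
    "\<And>x y. \<lbrakk>x \<in> m; y \<in> m\<rbrakk> \<Longrightarrow> B x y = \<zero>\<^bsub>F\<^esub>"
    using iso by (auto simp: isotropic_sequence_def)
  note sub0 = subspaceD[OF sub(1)] and subm = subspaceD[OF sub(2)]
  have subc: "subspace F (?c ! i) V" if "i < Suc p + q" for i
    using iso that nth_mem[of i ?c] unfolding len(3) isotropic_sequence_def by blast
  note aD = maslov_presentationD[OF iso_a, folded Ka_def, unfolded len(1)]
  note bD = maslov_presentationD[OF iso_b, folded Kb_def, unfolded len(2)]
  note cD = maslov_presentationD[OF iso, folded Kc_def, unfolded len(3)]
  have c_iff: "z \<in> carrier Kc \<longleftrightarrow> z \<in> extensional {..<Suc p + q} \<and> (\<forall>i<Suc p + q. z i \<in> ?c ! i) \<and>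
      (\<Oplus>\<^bsub>V\<^esub>i\<in>{..<Suc p + q}. z i) = \<zero>\<^bsub>V\<^esub>" for z
    unfolding Kc_def maslov_presentation_simps(1) len(3) by (auto simp: PiE_iff)
  have a_iff: "z \<in> carrier Ka \<longleftrightarrow> z \<in> extensional {..<Suc p} \<and> (\<forall>i<Suc p. z i \<in> (m0 # as @ [m]) ! i) \<and>
      (\<Oplus>\<^bsub>V\<^esub>i\<in>{..<Suc p}. z i) = \<zero>\<^bsub>V\<^esub>" for z
    unfolding Ka_def maslov_presentation_simps(1) len(1) by (auto simp: PiE_iff)
  have b_iff: "z \<in> carrier Kb \<longleftrightarrow> z \<in> extensional {..<q + 2} \<and> (\<forall>i<q + 2. z i \<in> (m0 # m # bs) ! i) \<and>
      (\<Oplus>\<^bsub>V\<^esub>i\<in>{..<q + 2}. z i) = \<zero>\<^bsub>V\<^esub>" for z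
    unfolding Kb_def maslov_presentation_simps(1) len(2) by (auto simp: PiE_iff)
  have index: thesis' if "i < Suc p + q" "i = 0 \<Longrightarrow> thesis'" "\<lbrakk>0 < i; i < p\<rbrakk> \<Longrightarrow> thesis'" "i = p \<Longrightarrow> thesis'"
    "\<And>j. \<lbrakk>i = Suc p + j; j < q\<rbrakk> \<Longrightarrow> thesis'" for i thesis'
    using that by (metis add_diff_inverse_nat less_SucE nat_add_left_cancel_less neq0_conv not_less_eq)
  \<comment> \<open>Position \<open>Suc p + j\<close> of the glued sequence is position \<open>j + 2\<close> of the second piece.\<close>
  define glue where "glue = (\<lambda>(x, y). \<lambda>i\<in>{..<Suc p + q}. if i = 0 then x 0 \<oplus>\<^bsub>V\<^esub> y 0 else if i < p then x i
      else if i = p then x p \<oplus>\<^bsub>V\<^esub> y 1 else y (Suc i - p))"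
  have glued: "glued p q x y (glue (x, y))" if "x \<in> carrier Ka" "y \<in> carrier Kb" for x y
    using p aD(2,3)[OF that(1)] bD(2)[OF that(2)] by (simp add: glued_def glue_def less_Suc_eq_le)
  have mem: "x 0 \<in> m0" "x p \<in> m" "y 0 \<in> m0" "y 1 \<in> m" if "x \<in> carrier Ka" "y \<in> carrier Kb" for x y
    using aD(1)[OF that(1), of 0] aD(1)[OF that(1), of p] bD(1)[OF that(2), of 0] bD(1)[OF that(2), of 1]
      nth(5) by auto
  have glue_Kc: "glue (x, y) \<in> carrier Kc" if x: "x \<in> carrier Ka" and y: "y \<in> carrier Kb" for x y
  proof -
    note g = gluedD[OF glued[OF x y]]
    have "glue (x, y) i \<in> ?c ! i" if i: "i < Suc p + q" for i
    proof (rule index[OF i])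
      assume "i = 0"
      then show ?thesis using mem[OF x y] sub0(3) by (simp only: g(2) nth(1))
    next
      assume i: "0 < i" "i < p"
      have "x i \<in> (m0 # as @ [m]) ! i" by (rule aD(1)[OF x]) (use i in simp)
      then show ?thesis by (simp only: g(3)[OF i] nth(2)[OF i])
    next
      assume "i = p"
      then show ?thesis using mem[OF x y] subm(3) by (simp only: g(4) nth(3))
    next
      fix j assume j: "i = Suc p + j" "j < q"
      have "y (j + 2) \<in> (m0 # m # bs) ! (j + 2)" by (rule bD(1)[OF y]) (use j in simp)
      then show ?thesis by (simp only: j(1) g(5)[OF j(2)] nth(4)[OF j(2)])
    qed
    moreover have "(\<Oplus>\<^bsub>V\<^esub>i\<in>{..<Suc p + q}. glue (x, y) i) = \<zero>\<^bsub>V\<^esub>"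
      using glued_sum_upper[OF glued[OF x y], of q] bD(3)[OF y] by simp
    ultimately show ?thesis by (simp add: c_iff) (simp add: glue_def)
  qed
  let ?S = "orth_sum F Ka Kb"
  define U where "U = {z \<in> carrier Kc. \<exists>a\<in>m0. \<exists>b\<in>m. (\<Oplus>\<^bsub>V\<^esub>i\<in>{..<p}. z i) = a \<oplus>\<^bsub>V\<^esub> b}"
  have glue_U: "glue (x, y) \<in> U" if x: "x \<in> carrier Ka" and y: "y \<in> carrier Kb" for x y
  proof -
    obtain k where k: "p = Suc k" using p gr0_implies_Suc by blast
    have "(\<Oplus>\<^bsub>V\<^esub>i\<in>{..<p}. glue (x, y) i) = \<ominus>\<^bsub>V\<^esub> x p \<oplus>\<^bsub>V\<^esub> y 0"
      using glued_sum_lower[OF glued[OF x y], of k] glued_chord_sum[OF glued[OF x y]] by (simp add: k)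
    also have "\<dots> = y 0 \<oplus>\<^bsub>V\<^esub> \<ominus>\<^bsub>V\<^esub> x p" using mem[OF x y] sub0(1) subm(1) by (intro M.a_comm) auto
    finally show ?thesis
      using glue_Kc[OF x y] mem[OF x y] subspace_uminus[OF sub(2)] unfolding U_def by blast
  qed
  have U_glue: "z \<in> glue ` carrier ?S" if "z \<in> U" for z
  proof -
    obtain a b where ab: "a \<in> m0" "b \<in> m" "(\<Oplus>\<^bsub>V\<^esub>i\<in>{..<p}. z i) = a \<oplus>\<^bsub>V\<^esub> b" and z: "z \<in> carrier Kc"
      using \<open>z \<in> U\<close> by (auto simp: U_def)
    have abV: "a \<in> carrier V" "b \<in> carrier V" using ab sub0(1) subm(1) by auto
    have z0: "z 0 \<in> m0" "z 0 \<in> carrier V" and zp: "z p \<in> m" "z p \<in> carrier V"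
      using cD(1,2)[OF z, of 0] cD(1,2)[OF z, of p] nth by auto
    \<comment> \<open>The corrections at the ends of the chord are forced by requiring that \<open>x\<close> have sum zero.\<close>
    define x where "x = (\<lambda>i\<in>{..<Suc p}. if i = 0 then z 0 \<ominus>\<^bsub>V\<^esub> a else if i = p then \<ominus>\<^bsub>V\<^esub> b else z i)"
    define y where "y = (\<lambda>i\<in>{..<q + 2}. if i = 0 then a else if i = 1 then z p \<oplus>\<^bsub>V\<^esub> b else z (p + i - 1))"
    have xV: "x i \<in> carrier V" if "i < Suc p" for i
      using that abV z0 cD(2)[OF z] by (simp add: x_def)
    have yV: "y i \<in> carrier V" if "i < q + 2" for i
      using that abV zp cD(2)[OF z] by (simp add: y_def)
    have sum_x: "(\<Oplus>\<^bsub>V\<^esub>i\<in>{..<Suc n}. x i) = (\<Oplus>\<^bsub>V\<^esub>i\<in>{..<Suc n}. z i) \<ominus>\<^bsub>V\<^esub> a" if "n < p" for n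
      using that
    proof (induction n)
      case 0
      then show ?case using p z0 abV xV sum_Suc[of 0 x] sum_Suc[of 0 z]
        by (simp add: x_def del: lessThan_Suc)
    next
      case (Suc n)
      have "(\<Oplus>\<^bsub>V\<^esub>i\<in>{..<Suc n}. z i) \<in> carrier V" "z (Suc n) \<in> carrier V"
        using cD(2)[OF z] Suc.prems by (auto intro!: sum_closed)
      moreover have "x (Suc n) = z (Suc n)" using Suc.prems by (simp add: x_def)
      ultimately show ?case
        using Suc xV cD(2)[OF z] abV sum_Suc[of "Suc n" x] sum_Suc[of "Suc n" z]
        by (simp add: a_minus_def M.a_ac del: lessThan_Suc)
    qed
    have "(\<Oplus>\<^bsub>V\<^esub>i\<in>{..<p}. x i) = (a \<oplus>\<^bsub>V\<^esub> b) \<ominus>\<^bsub>V\<^esub> a"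
      using sum_x[of "p - 1"] p ab(3) by simp
    also have "\<dots> = b" using abV by (simp add: a_minus_def M.a_assoc M.a_comm[of b] M.r_neg2)
    finally have "(\<Oplus>\<^bsub>V\<^esub>i\<in>{..<Suc p}. x i) = \<zero>\<^bsub>V\<^esub>"
      using sum_Suc[of p x] xV abV p by (simp add: x_def M.r_neg del: lessThan_Suc)
    moreover have "x i \<in> (m0 # as @ [m]) ! i" if "i < Suc p" for i
    proof -
      consider "i = 0" | "0 < i" "i < p" | "i = p" using \<open>i < Suc p\<close> by linarith
      then show ?thesis
      proof cases
        case 1
        then show ?thesis using subspace_minus[OF sub(1) z0(1) ab(1)] by (simp add: x_def)
      next
        case 2
        then show ?thesis using cD(1)[OF z, of i] nth(2) by (simp add: x_def)
      next
        case 3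
        then show ?thesis using p nth(5) subspace_uminus[OF sub(2) ab(2)] by (simp add: x_def)
      qed
    qed
    ultimately have xK: "x \<in> carrier Ka" by (simp add: a_iff) (simp add: x_def)
    have sum_y: "(\<Oplus>\<^bsub>V\<^esub>i\<in>{..<j + 2}. y i) = (\<Oplus>\<^bsub>V\<^esub>i\<in>{..<Suc p + j}. z i)" if "j \<le> q" for j
      using that
    proof (induction j)
      case 0
      have "(\<Oplus>\<^bsub>V\<^esub>i\<in>{..<2}. y i) = a \<oplus>\<^bsub>V\<^esub> (z p \<oplus>\<^bsub>V\<^esub> b)"
        using yV abV zp sum_Suc[of 0 y] sum_Suc[of 1 y]
        by (simp add: numeral_2_eq_2 del: lessThan_Suc) (simp add: y_def)
      moreover have "(\<Oplus>\<^bsub>V\<^esub>i\<in>{..<Suc p}. z i) = (a \<oplus>\<^bsub>V\<^esub> b) \<oplus>\<^bsub>V\<^esub> z p"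
        using sum_Suc[of p z] cD(2)[OF z] ab(3) by simp
      ultimately have "(\<Oplus>\<^bsub>V\<^esub>i\<in>{..<2}. y i) = (\<Oplus>\<^bsub>V\<^esub>i\<in>{..<Suc p}. z i)"
        using abV zp by (simp add: M.a_ac del: lessThan_Suc)
      then show ?case by (simp only: add_0_left add_0_right)
    next
      case (Suc j)
      then show ?case
        using yV cD(2)[OF z] sum_Suc[of "j + 2" y] sum_Suc[of "Suc p + j" z]
        by (simp del: lessThan_Suc) (simp add: y_def)
    qed
    then have "(\<Oplus>\<^bsub>V\<^esub>i\<in>{..<q + 2}. y i) = \<zero>\<^bsub>V\<^esub>" using cD(3)[OF z] by simp
    moreover have "y i \<in> (m0 # m # bs) ! i" if "i < q + 2" for i
    proof -
      consider "i = 0" | "i = 1" | j where "i = j + 2" "j < q"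
        using \<open>i < q + 2\<close> by (metis One_nat_def add_2_eq_Suc' add_less_cancel_right not0_implies_Suc)
      then show ?thesis
      proof cases
        case 3
        then show ?thesis using cD(1)[OF z, of "Suc p + j"] nth(4)[of j] by (simp add: y_def)
      qed (use ab zp subm(3) in \<open>auto simp: y_def\<close>)
    qed
    ultimately have yK: "y \<in> carrier Kb" by (simp add: b_iff) (simp add: y_def)
    have "glue (x, y) i = z i" if i: "i < Suc p + q" for i
    proof (rule index[OF i])
      assume "i = 0"
      then show ?thesis using p abV z0
        by (simp add: glue_def x_def y_def a_minus_def M.a_assoc M.l_neg)
    next
      assume "i = p"
      then show ?thesis using p abV zp
        by (simp add: glue_def x_def y_def M.a_lcomm[of _ "z p"] M.l_neg)
    next
      fix j assume "i = Suc p + j" "j < q"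
      then show ?thesis by (simp add: glue_def y_def)
    qed (use i in \<open>simp add: glue_def x_def\<close>)
    moreover have "glue (x, y) \<in> extensional {..<Suc p + q}" by (simp add: glue_def)
    ultimately have "z = glue (x, y)"
      using z unfolding c_iff by (intro extensionalityI[of z "{..<Suc p + q}"]) auto
    then show ?thesis using xK yK by (intro image_eqI[of _ _ "(x, y)"]) auto
  qed
  have im: "glue ` carrier ?S = U" using glue_U U_glue by auto
  note formK = symmetric_space_maslov_presentation(2)
  have glue_form: "form Kc (glue (x, y)) (glue (x', y')) = form Ka x x' \<oplus>\<^bsub>F\<^esub> form Kb y y'"
    if x: "x \<in> carrier Ka" and y: "y \<in> carrier Kb" and x': "x' \<in> carrier Ka" and y': "y' \<in> carrier Kb"
    for x y x' y'
    using glued_form[OF glued[OF x y] glued[OF x' y']] mem[OF x y] mem[OF x' y'] isoL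
      formK[OF iso, folded Kc_def, unfolded len, OF glue_Kc[OF x y] glue_Kc[OF x' y']]
      formK[OF iso_a, folded Ka_def, unfolded len, OF x x']
      formK[OF iso_b, folded Kb_def, unfolded len, OF y y'] by simp
  obtain \<pi> where epi: "form_epi F Kc T \<pi>" and T: "quadratic_space F T"
    unfolding Kc_def T_def by (rule quadratic_space_maslov_space[OF iso])
  interpret T: quadratic_space F T by (rule T)
  note \<pi> = form_epiD[OF epi]
  have chord_Kc: "chord_vector p q u \<in> carrier Kc" if "u \<in> m0" "u \<in> m" for u
  proof -
    have "chord_vector p q u i \<in> ?c ! i" if i: "i < Suc p + q" for i
    proof -
      consider "i = 0" | "i = p" | "i \<noteq> 0" "i \<noteq> p" by blast
      then show ?thesis
      proof cases
        case 1
        then have "chord_vector p q u i = u" by (simp add: chord_vector_def)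
        with 1 \<open>u \<in> m0\<close> show ?thesis by (simp only: nth(1))
      next
        case 2
        then have "chord_vector p q u i = \<ominus>\<^bsub>V\<^esub> u" using p by (simp add: chord_vector_def)
        with 2 show ?thesis
          using subspace_uminus[OF sub(2) \<open>u \<in> m\<close>] by (simp only: nth(3))
      next
        case 3
        then have "chord_vector p q u i = \<zero>\<^bsub>V\<^esub>" using i by (simp add: chord_vector_def)
        then show ?thesis using subspaceD(2)[OF subc[OF i]] by (simp only:)
      qed
    qed
    moreover have "(\<Oplus>\<^bsub>V\<^esub>i\<in>{..<Suc p + q}. chord_vector p q u i) = \<zero>\<^bsub>V\<^esub>"
      using chord_vector_sum[OF _ p, of u "Suc p + q" q] \<open>u \<in> m\<close> subm(1) by auto
    ultimately show ?thesis by (simp add: c_iff) (simp add: chord_vector_def)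
  qed
  have chord_form: "form Kc z (chord_vector p q u) = B (\<Oplus>\<^bsub>V\<^esub>i\<in>{..<p}. z i) u"
    if "z \<in> carrier Kc" "u \<in> m0" "u \<in> m" for z u
    using formK[OF iso, folded Kc_def, unfolded len, OF that(1) chord_Kc[OF that(2,3)]]
      chord_vector_form[OF _ p cD(2)[OF that(1)]] that subm(1) by auto
  define I where "I = (\<lambda>u. \<pi> (chord_vector p q u)) ` (m0 \<inter> m)"
  have U_iff: "z \<in> U \<longleftrightarrow> \<pi> z \<in> perp F T (form T) I" if z: "z \<in> carrier Kc" for z
  proof -
    have s: "(\<Oplus>\<^bsub>V\<^esub>i\<in>{..<p}. z i) \<in> carrier V" using cD(2)[OF z] by (intro sum_closed) auto
    have "\<pi> z \<in> perp F T (form T) I \<longleftrightarrow> (\<forall>u\<in>m0 \<inter> m. B (\<Oplus>\<^bsub>V\<^esub>i\<in>{..<p}. z i) u = \<zero>\<^bsub>F\<^esub>)"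
      using z \<pi>(3) \<pi>(6)[OF z chord_Kc] chord_form[OF z] by (auto simp: perp_def I_def)
    also have "\<dots> \<longleftrightarrow> (\<exists>a\<in>m0. \<exists>b\<in>m. (\<Oplus>\<^bsub>V\<^esub>i\<in>{..<p}. z i) = a \<oplus>\<^bsub>V\<^esub> b)"
    proof
      assume "\<forall>u\<in>m0 \<inter> m. B (\<Oplus>\<^bsub>V\<^esub>i\<in>{..<p}. z i) u = \<zero>\<^bsub>F\<^esub>"
      then show "\<exists>a\<in>m0. \<exists>b\<in>m. (\<Oplus>\<^bsub>V\<^esub>i\<in>{..<p}. z i) = a \<oplus>\<^bsub>V\<^esub> b"
        using lagrangian_sum_is_perp[OF m0 m s] by metis
    next
      assume "\<exists>a\<in>m0. \<exists>b\<in>m. (\<Oplus>\<^bsub>V\<^esub>i\<in>{..<p}. z i) = a \<oplus>\<^bsub>V\<^esub> b"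
      then obtain a b where ab: "a \<in> m0" "b \<in> m" "(\<Oplus>\<^bsub>V\<^esub>i\<in>{..<p}. z i) = a \<oplus>\<^bsub>V\<^esub> b" by auto
      show "\<forall>u\<in>m0 \<inter> m. B (\<Oplus>\<^bsub>V\<^esub>i\<in>{..<p}. z i) u = \<zero>\<^bsub>F\<^esub>"
        unfolding ab(3) using ab(1,2) isoL sub0(1) subm(1) by (auto simp: form_add_left subset_iff)
    qed
    finally show ?thesis using z by (simp add: U_def)
  qed
  have chord_U: "chord_vector p q u \<in> U" if "u \<in> m0" "u \<in> m" for u
  proof -
    have "u \<in> carrier V" using that subm(1) by auto
    then have "(\<Oplus>\<^bsub>V\<^esub>i\<in>{..<p}. chord_vector p q u i) = u \<oplus>\<^bsub>V\<^esub> \<zero>\<^bsub>V\<^esub>"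
      using chord_vector_sum[of u p p q] p by simp
    then show ?thesis using chord_Kc[OF that] that(1) subm(2) unfolding U_def by blast
  qed
  have "isotropic F T I"
    unfolding isotropic_def
  proof
    have zero: "chord_vector p q \<zero>\<^bsub>V\<^esub> = \<zero>\<^bsub>Kc\<^esub>"
      unfolding Kc_def maslov_presentation_simps(2) len(3) by (auto simp: chord_vector_def fun_eq_iff)
    have add: "chord_vector p q (u \<oplus>\<^bsub>V\<^esub> v) = chord_vector p q u \<oplus>\<^bsub>Kc\<^esub> chord_vector p q v"
      if "u \<in> carrier V" "v \<in> carrier V" for u v
      unfolding Kc_def maslov_presentation_simps(3) len(3)
      using that by (auto simp: chord_vector_def fun_eq_iff M.minus_add)
    have smult: "chord_vector p q (c \<odot>\<^bsub>V\<^esub> u) = c \<odot>\<^bsub>Kc\<^esub> chord_vector p q u"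
      if "u \<in> carrier V" "c \<in> carrier F" for u c
      unfolding Kc_def maslov_presentation_simps(4) len(3)
      using that by (auto simp: chord_vector_def fun_eq_iff smult_r_minus)
    have mV: "u \<in> carrier V" if "u \<in> m" for u using that subm(1) by auto
    show "subspace F I T"
    proof (rule T.subspaceI)
      show "I \<subseteq> carrier T" using \<pi>(3) chord_Kc by (auto simp: I_def)
      show "\<zero>\<^bsub>T\<^esub> \<in> I"
        unfolding I_def using zero \<pi>(2) sub0(2) subm(2) by (intro image_eqI[of _ _ "\<zero>\<^bsub>V\<^esub>"]) auto
      fix s t assume "s \<in> I" "t \<in> I"
      then obtain u v where uv: "u \<in> m0 \<inter> m" "v \<in> m0 \<inter> m" "s = \<pi> (chord_vector p q u)" "t = \<pi> (chord_vector p q v)"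
        by (auto simp: I_def)
      show "s \<oplus>\<^bsub>T\<^esub> t \<in> I"
        unfolding I_def using uv add mV \<pi>(4) chord_Kc sub0(3) subm(3)
        by (intro image_eqI[of _ _ "u \<oplus>\<^bsub>V\<^esub> v"]) auto
    next
      fix c s assume c: "c \<in> carrier F" and "s \<in> I"
      then obtain u where u: "u \<in> m0 \<inter> m" "s = \<pi> (chord_vector p q u)" by (auto simp: I_def)
      show "c \<odot>\<^bsub>T\<^esub> s \<in> I"
        unfolding I_def using u c smult mV \<pi>(5) chord_Kc sub0(4) subm(4)
        by (intro image_eqI[of _ _ "c \<odot>\<^bsub>V\<^esub> u"]) auto
    qed
    show "\<forall>x\<in>I. \<forall>y\<in>I. form T x y = \<zero>\<^bsub>F\<^esub>"
    proof (intro ballI)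
      fix x y assume "x \<in> I" "y \<in> I"
      then obtain u where u: "u \<in> m0" "u \<in> m" "x = \<pi> (chord_vector p q u)" by (auto simp: I_def)
      have "x \<in> perp F T (form T) I"
        using U_iff[OF chord_Kc[OF u(1,2)]] chord_U[OF u(1,2)] u(3) by simp
      then show "form T x y = \<zero>\<^bsub>F\<^esub>" using \<open>y \<in> I\<close> by (simp add: perp_def)
    qed
  qed
  moreover have "form_epi F ?S (T\<lparr>carrier := perp F T (form T) I\<rparr>) (\<lambda>s. \<pi> (glue s))"
  proof -
    have "\<pi> ` U = perp F T (form T) I"
    proof
      show "\<pi> ` U \<subseteq> perp F T (form T) I" using U_iff by (auto simp: U_def)
      show "perp F T (form T) I \<subseteq> \<pi> ` U"
      proof
        fix t assume t: "t \<in> perp F T (form T) I"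
        then have "t \<in> \<pi> ` carrier Kc" using \<pi>(1) by (simp add: perp_def)
        then show "t \<in> \<pi> ` U" using t U_iff by auto
      qed
    qed
    then have "(\<lambda>s. \<pi> (glue s)) ` carrier ?S = perp F T (form T) I"
      using im by (metis image_image)
    moreover have add: "glue (x \<oplus>\<^bsub>?S\<^esub> y) = glue x \<oplus>\<^bsub>Kc\<^esub> glue y"
      if "x \<in> carrier ?S" "y \<in> carrier ?S" for x y
    proof -
      obtain x1 x2 y1 y2 where xy: "x = (x1, x2)" "y = (y1, y2)" by (metis surj_pair)
      then have K: "x1 \<in> carrier Ka" "x2 \<in> carrier Kb" "y1 \<in> carrier Ka" "y2 \<in> carrier Kb"
        using that by auto
      note V = aD(2)[OF K(1)] aD(2)[OF K(3)] bD(2)[OF K(2)] bD(2)[OF K(4)]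
      have "glue (x \<oplus>\<^bsub>?S\<^esub> y) i = (glue x \<oplus>\<^bsub>Kc\<^esub> glue y) i" for i
      proof (cases "i < Suc p + q")
        case True
        show ?thesis
          unfolding xy orth_sum_simps fst_conv snd_conv Ka_def Kb_def Kc_def maslov_presentation_simps(3) len
          by (rule index[OF True]) (use V p in \<open>simp_all add: glue_def M.a_ac\<close>)
      next
        case False
        then show ?thesis
          unfolding Kc_def maslov_presentation_simps(3) len(3) by (simp add: xy glue_def)
      qed
      then show ?thesis by auto
    qed
    moreover have smult: "glue (c \<odot>\<^bsub>?S\<^esub> x) = c \<odot>\<^bsub>Kc\<^esub> glue x"
      if "x \<in> carrier ?S" "c \<in> carrier F" for x c
    proof -
      obtain x1 x2 where x: "x = (x1, x2)" by (metis surj_pair)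
      then have K: "x1 \<in> carrier Ka" "x2 \<in> carrier Kb" using that by auto
      note V = aD(2)[OF K(1)] bD(2)[OF K(2)]
      have "glue (c \<odot>\<^bsub>?S\<^esub> x) i = (c \<odot>\<^bsub>Kc\<^esub> glue x) i" for i
      proof (cases "i < Suc p + q")
        case True
        show ?thesis
          unfolding x orth_sum_simps fst_conv snd_conv Ka_def Kb_def Kc_def maslov_presentation_simps(4) len
          by (rule index[OF True]) (use V p \<open>c \<in> carrier F\<close> in \<open>simp_all add: glue_def smult_r_distr\<close>)
      next
        case False
        then show ?thesis
          unfolding Kc_def maslov_presentation_simps(4) len(3) by (simp add: x glue_def)
      qed
      then show ?thesis by auto
    qed
    moreover have "glue \<zero>\<^bsub>?S\<^esub> = \<zero>\<^bsub>Kc\<^esub>"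
      unfolding orth_sum_simps Ka_def Kb_def Kc_def maslov_presentation_simps(2) len
      by (auto simp: glue_def fun_eq_iff)
    moreover have "glue s \<in> carrier Kc" if "s \<in> carrier ?S" for s
      using that glue_Kc by auto
    moreover have "form Kc (glue s) (glue t) = form ?S s t" if "s \<in> carrier ?S" "t \<in> carrier ?S" for s t
      using that glue_form by (cases s, cases t) auto
    ultimately show ?thesis
      using \<pi>(2,4,5,6) by (simp add: form_epi_def del: orth_sum_simps)
  qed
  moreover have "I = {\<zero>\<^bsub>T\<^esub>}" if "m0 \<inter> m = {\<zero>\<^bsub>V\<^esub>}"
  proof -
    have "chord_vector p q \<zero>\<^bsub>V\<^esub> = \<zero>\<^bsub>Kc\<^esub>"
      unfolding Kc_def maslov_presentation_simps(2) len(3) by (auto simp: chord_vector_def fun_eq_iff)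
    then show ?thesis using that \<pi>(2) by (simp add: I_def)
  qed
  ultimately show thesis by (rule that)
qed

end

section \<open>Additivity of the Maslov index\<close>

theorem proposition6:
  fixes F :: "('a, 'd) ring_scheme" and V :: "('a, 'b, 'e) module_scheme"
    and B :: "'b \<Rightarrow> 'b \<Rightarrow> 'a" and l :: "nat \<Rightarrow> 'b set" and n k :: nat
  assumes "symplectic_space F V B"
    and "\<one>\<^bsub>F\<^esub> \<oplus>\<^bsub>F\<^esub> \<one>\<^bsub>F\<^esub> \<noteq> \<zero>\<^bsub>F\<^esub>"
    and "2 \<le> n"
    and "\<And>i. i \<in> {1..n} \<Longrightarrow> lagrangian F V B (l i)"
    and "k \<in> {2..n}"
  shows "(l 1 \<inter> l k = {\<zero>\<^bsub>V\<^esub>} \<longrightarrow>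
      isometric F
        (orth_sum F (maslov_space F V B (map l [1..<k + 1]))
                    (maslov_space F V B (l 1 # map l [k..<n + 1])))
        (maslov_space F V B (map l [1..<n + 1])))
    \<and> (\<exists>I. isotropic F (maslov_space F V B (map l [1..<n + 1])) I \<and>
      isometric F
        (orth_sum F (maslov_space F V B (map l [1..<k + 1]))
                    (maslov_space F V B (l 1 # map l [k..<n + 1])))
        (subquotient F (maslov_space F V B (map l [1..<n + 1])) I))
    \<and> maslov_index F V B (map l [1..<k + 1])
        \<otimes>\<^bsub>witt_group F\<^esub> maslov_index F V B (l 1 # map l [k..<n + 1])
      = maslov_index F V B (map l [1..<n + 1])"
proof -
  interpret symplectic_space F V B by (rule assms(1))
  let ?as = "map l [2..<k]" and ?bs = "map l [k + 1..<n + 1]"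
  have k: "2 \<le> k" "k \<le> n" using assms(5) by auto
  have "[1..<k + 1] = 1 # [2..<k] @ [k]"
    using k by (simp add: upt_conv_Cons numeral_2_eq_2)
  then have seq_a: "map l [1..<k + 1] = l 1 # ?as @ [l k]" by simp
  have seq_b: "l 1 # map l [k..<n + 1] = l 1 # l k # ?bs"
    using k by (simp add: upt_conv_Cons del: upt_Suc)
  have "[1..<n + 1] = 1 # [2..<k] @ k # [k + 1..<n + 1]"
    using k upt_add_eq_append[of 2 k "n + 1 - k"]
    by (simp add: upt_conv_Cons numeral_2_eq_2 del: upt_Suc)
  then have seq_c: "map l [1..<n + 1] = l 1 # ?as @ l k # ?bs" by simp
  let ?a = "l 1 # ?as @ [l k]" and ?b = "l 1 # l k # ?bs" and ?c = "l 1 # ?as @ l k # ?bs"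
  have lag: "lagrangian F V B L" if "L \<in> set ?c" for L
    using that assms(4) k by auto
  have iso: "isotropic_sequence ?a" "isotropic_sequence ?b" "isotropic_sequence ?c"
    by (rule isotropic_sequence_lagrangian, simp, rule lag, auto)+
  let ?Ta = "maslov_space F V B ?a" and ?Tb = "maslov_space F V B ?b" and ?Tc = "maslov_space F V B ?c"
  let ?K = "orth_sum F (maslov_presentation F V B ?a) (maslov_presentation F V B ?b)"
  obtain pa pb where pa: "form_epi F (maslov_presentation F V B ?a) ?Ta pa"
    and pb: "form_epi F (maslov_presentation F V B ?b) ?Tb pb"
    and Ta: "quadratic_space F ?Ta" and Tb: "quadratic_space F ?Tb" and Tc: "quadratic_space F ?Tc"
    using quadratic_space_maslov_space[OF iso(1)] quadratic_space_maslov_space[OF iso(2)]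
      quadratic_space_maslov_space[OF iso(3)] by metis
  have K: "symmetric_space F ?K"
    by (intro symmetric_space_orth_sum symmetric_space_maslov_presentation(1) iso)
  have sum: "quadratic_space F (orth_sum F ?Ta ?Tb)" by (rule quadratic_space_orth_sum[OF Ta Tb])
  obtain I f where I: "isotropic F ?Tc I"
    and f: "form_epi F ?K (?Tc\<lparr>carrier := perp F ?Tc (form ?Tc) I\<rparr>) f"
    and I0: "l 1 \<inter> l k = {\<zero>\<^bsub>V\<^esub>} \<Longrightarrow> I = {\<zero>\<^bsub>?Tc\<^esub>}"
    by (rule cut_along_chord[OF lag lag iso(3)]) auto
  note common = isometric_of_common_epi[OF K sum _ form_epi_orth_sum[OF pa pb]]
  have subq: "isometric F (orth_sum F ?Ta ?Tb) (subquotient F ?Tc I)"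
    using common[OF quadratic_space_subquotient(2)[OF Tc I]
      form_epi_comp[OF f quadratic_space_subquotient(1)[OF Tc I]]] .
  have "isometric F (orth_sum F ?Ta ?Tb) ?Tc" if 0: "l 1 \<inter> l k = {\<zero>\<^bsub>V\<^esub>}"
  proof -
    interpret Tc: quadratic_space F ?Tc by (rule Tc)
    have "?Tc\<lparr>carrier := carrier ?Tc\<rparr> = ?Tc" by (rule partial_object.equality) simp_all
    then show ?thesis using common[OF Tc] f by (simp only: I0[OF 0] Tc.perp_zero)
  qed
  moreover have "witt_equivalent F (orth_sum F ?Ta ?Tb) ?Tc"
    using witt_equivalent_trans[OF isometric_imp_witt_equivalent[OF subq]
      witt_equivalent_sym[OF witt_equivalent_subquotient[OF assms(2) Tc I]]] .
  then have "maslov_index F V B ?a \<otimes>\<^bsub>witt_group F\<^esub> maslov_index F V B ?b = maslov_index F V B ?c"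
    unfolding maslov_index_def by (rule witt_class_mult[OF _ Ta Tb])
  ultimately show ?thesis
    unfolding seq_a seq_b seq_c using I subq by blast
qed

end
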